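(* Assume (S), (F), (G) and (AC). Then the semilinear system $$y'(t)=Ay(t)+Bu(t)+f(t,y(t))+g(t,y(t)),\quad t\in[0,T],\qquad y(0)=y_0,$$ is finite-approximately controllable on $[0,T]$: for every finite-dimensional subspace $M\subset\mathfrak{X}$ (with orthogonal projection $\pi_M$), every $y_0,y_f\in\mathfrak{X}$ and every $\varepsilon>0$ there exists $u\in L^2([0,T],U)$ such that the mild solution $y$ satisfies $\|y(T)-y_f\|<\varepsilon$ and $\pi_My(T)=\pi_My_f$.
   Context: $\mathfrak{X}$, $U$ Hilbert spaces, $A:D(A)\subset\mathfrak{X}\to\mathfrak{X}$ densely defined, generating a $C_0$-semigroup $\mathfrak{U}(t)$; $B\in L(U,\mathfrak{X})$; $f,g:[0,T]\times\mathfrak{X}\to\mathfrak{X}$. A mild solution is $y\in C([0,T],\mathfrak{X})$ with $y(t)=\mathfrak{U}(t)y_0+\int_0^t\mathfrak{U}(t-s)[Bu(s)+f(s,y(s))+g(s,y(s))]ds$. (S): $\mathfrak{X}$, $U$ separable, $\mathfrak{U}(t)$ compact for $t>0$, $B\in L(U,\mathfrak{X})$. (F): $f$ is continuous and has a continuous Fréchet derivative $f'_z$ in the second variable with $\|f'_z(t,z)\|_{L(\mathfrak{X})}\le L$ for some $L>0$ and all $(t,z)\in[0,T]\times\mathfrak{X}$. (G): $g$ is continuous and there is $m\in C([0,T],\mathbb{R}^+)$ with $\|g(t,z)\|\le m(t)$ for all $(t,z)$. (AC): for every $G\in L^2(0,T;L(\mathfrak{X}))$ the linear system $y(t)=\mathfrak{U}(t)y_0+\int_0^t\mathfrak{U}(t-s)[Bu(s)+G(s)y(s)]ds$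 is approximately controllable on $[0,T]$, i.e. for all $y_0,y_f\in\mathfrak{X}$ and $\varepsilon>0$ there is $u\in L^2(0,T;U)$ with $\|y(T)-y_f\|<\varepsilon$. *)

theory Defs
  imports "HOL-Analysis.Analysis"
begin

text \<open>Real separable Hilbert spaces are modelled by the type class
  {real_inner, complete_space, second_countable_topology}
  (second countable = separable for metric spaces).\<close>

definition C0_semigroup :: "(real \<Rightarrow> ('x::real_normed_vector \<Rightarrow>\<^sub>L 'x)) \<Rightarrow> bool" where
  "C0_semigroup S \<longleftrightarrow>
     S 0 = id_blinfun \<and>
     (\<forall>t s. 0 \<le> t \<longrightarrow> 0 \<le> s \<longrightarrow> S (t + s) = S t o\<^sub>L S s) \<and>
     (\<forall>x. ((\<lambda>t. blinfun_apply (S t) x) \<longlongrightarrow> x) (at_right 0))"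

definition generator :: "('x::real_normed_vector \<Rightarrow> 'x) \<Rightarrow> 'x set \<Rightarrow> (real \<Rightarrow> ('x \<Rightarrow>\<^sub>L 'x)) \<Rightarrow> bool" where
  "generator A D S \<longleftrightarrow>
     D = {x. \<exists>l. ((\<lambda>h. (1 / h) *\<^sub>R (S h x - x)) \<longlongrightarrow> l) (at_right 0)} \<and>
     (\<forall>x\<in>D. ((\<lambda>h. (1 / h) *\<^sub>R (S h x - x)) \<longlongrightarrow> A x) (at_right 0))"

definition compact_operator :: "('x::real_normed_vector \<Rightarrow>\<^sub>L 'y::real_normed_vector) \<Rightarrow> bool" where
  "compact_operator K \<longleftrightarrow> compact (closure (blinfun_apply K ` cball 0 1))"

definition L2_on :: "real \<Rightarrow> (real \<Rightarrow> 'v::real_normed_vector) \<Rightarrow> bool" where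
  "L2_on T u \<longleftrightarrow> u \<in> borel_measurable (lebesgue_on {0..T}) \<and>
     integrable (lebesgue_on {0..T}) (\<lambda>t. (norm (u t))\<^sup>2)"

text \<open>Mild solution on [0,T] of y' = Ay + Bu + F(t,y), y(0)=y0, where S is generated by A.\<close>
definition mild_solution ::
  "(real \<Rightarrow> ('x::{real_inner,complete_space,second_countable_topology} \<Rightarrow>\<^sub>L 'x)) \<Rightarrow> ('u::real_normed_vector \<Rightarrow>\<^sub>L 'x)
    \<Rightarrow> (real \<Rightarrow> 'x \<Rightarrow> 'x) \<Rightarrow> real \<Rightarrow> 'x \<Rightarrow> (real \<Rightarrow> 'u) \<Rightarrow> (real \<Rightarrow> 'x) \<Rightarrow> bool" where
  "mild_solution S B F T y0 u y \<longleftrightarrow>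
     continuous_on {0..T} y \<and>
     (\<forall>t\<in>{0..T}.
        integrable (lebesgue_on {0..t}) (\<lambda>s. S (t - s) (B (u s) + F s (y s))) \<and>
        y t = S t y0 + integral\<^sup>L (lebesgue_on {0..t}) (\<lambda>s. S (t - s) (B (u s) + F s (y s))))"

definition orth_proj :: "'x::real_inner set \<Rightarrow> 'x \<Rightarrow> 'x" where
  "orth_proj M x = (THE p. p \<in> M \<and> (\<forall>m\<in>M. inner (x - p) m = 0))"

definition finite_dim_subspace :: "'x::real_vector set \<Rightarrow> bool" where
  "finite_dim_subspace M \<longleftrightarrow> (\<exists>E. finite E \<and> M = span E)"

end

theory Submission
  imports Defs "HOL-Library.Diagonal_Subsequence"
begin

text \<open>With \<open>h = f + g\<close> and \<open>k t z = h t z / (1 + norm z\<^sup>2)\<close> one has \<open>h t z = \<langle>z, z\<rangle> k t z + k t z\<close>, so a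
  solution \<open>y\<close> of the semilinear system solves a linear system with bounded potential \<open>\<langle>\<cdot>, y\<rangle> k(t, y)\<close> and
  bounded forcing \<open>k(t, y)\<close>. Take the control \<open>u = B* p\<close>, where \<open>p\<close> solves the adjoint equation with
  terminal value \<open>\<phi>\<close>, and require \<open>y T + \<epsilon> (\<phi> - \<pi> \<phi>) = yf\<close>, \<open>\<pi>\<close> being the projection onto \<open>M\<close>; then
  \<open>\<pi> (y T) = \<pi> yf\<close> holds exactly. The triple \<open>(y, p, \<phi>)\<close> is a fixed point of a compact map and is
  found by Schaefer's theorem. The a priori bound rests on the inequality
  \<open>c * norm \<phi>\<^sup>2 \<le> norm (\<phi> - \<pi> \<phi>)\<^sup>2 + \<integral> norm (B* p)\<^sup>2\<close>, uniform in all potentials below a given bound. It follows by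
  compactness from unique continuation: if \<open>B* p = 0\<close> for an adjoint state \<open>p\<close> with source \<open>q\<close>,
  \<open>norm q \<le> K * norm p\<close>, then the rank-one potential \<open>x \<mapsto> \<langle>x, q\<rangle> p / norm p\<^sup>2\<close> realizes \<open>q\<close>, and approximate
  controllability for this potential forces \<open>\<phi> = 0\<close>. The same inequality and compactness give
  \<open>\<epsilon> (\<phi> - \<pi> \<phi>) \<rightarrow> 0\<close> along a sequence \<open>\<epsilon> \<rightarrow> 0\<close>.\<close>

text \<open>Condition (AC) gives for each potential G its own dense reachable set, without any
  uniformity in G, while the potential of the linearized system moves with the unknown state. Limits
  are therefore never taken in G itself. The pair (\<open>\<phi>\<close>, \<open>q\<close>) is kept
  instead, subject to norm q \<le> K * norm p; for a fixed limit state p this constraint is convex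
  in q, so it survives averaging and limits, and every limiting q again comes from a potential. The
  denominator 1 + norm z squared matches the linear growth of h: both k and norm z * k stay bounded,
  and there is no singularity at z = 0. In the pairing of state and adjoint state, the part of h
  that carries the potential cancels against q, so that only terms linear in p remain besides the
  squared norm of the control. The penalty acts only on the component of \<open>\<phi>\<close>
  orthogonal to M. This is what makes the M-component of the target exact, but it costs coercivity
  in the directions of M. The observation of p through the adjoint of B has to restore it, and it
  can do so because the projection onto M is compact.\<close>

section \<open>Fixed points of compact maps\<close>

text \<open>Kuhn's cubical form of Sperner's lemma on a grid of mesh 1/p. The cube lives in
  functions on nat because its dimension \<open>n\<close> is the size of a covering, hence a number
  and not a type. Uniform continuity suffices as only an approximate fixed point is claimed.\<close>

lemma approximate_fixed_point_cube:
  fixes F :: "(nat \<Rightarrow> real) \<Rightarrow> nat \<Rightarrow> real" and n :: nat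
  assumes ran: "\<And>w i. \<lbrakk>\<forall>j<n. 0 \<le> w j \<and> w j \<le> 1; i < n\<rbrakk> \<Longrightarrow> 0 \<le> F w i \<and> F w i \<le> 1"
    and uc: "\<And>e. e > 0 \<Longrightarrow> \<exists>d>0. \<forall>v w. (\<forall>j<n. 0 \<le> v j \<and> v j \<le> 1 \<and> 0 \<le> w j \<and> w j \<le> 1 \<and> \<bar>v j - w j\<bar> < d)
        \<longrightarrow> (\<forall>i<n. \<bar>F v i - F w i\<bar> < e)"
    and "e > 0"
  shows "\<exists>w. (\<forall>j<n. 0 \<le> w j \<and> w j \<le> 1) \<and> (\<forall>i<n. \<bar>F w i - w i\<bar> < e)"
proof -
  obtain d where d: "d > 0" "\<And>v w i. \<lbrakk>\<forall>j<n. 0 \<le> v j \<and> v j \<le> 1 \<and> 0 \<le> w j \<and> w j \<le> 1 \<and> \<bar>v j - w j\<bar> < d; i < n\<rbrakk>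
        \<Longrightarrow> \<bar>F v i - F w i\<bar> < e/2"
    using uc[of "e/2"] \<open>e > 0\<close> by (metis half_gt_zero)
  obtain p :: nat where p: "p > 0" "1 / real p < min d (e/2)"
    using reals_Archimedean[of "min d (e/2)"] d(1) \<open>e > 0\<close>
    by (metis half_gt_zero inverse_eq_divide min_less_iff_conj zero_less_Suc)
  define x where "x v j = real (v j) / real p" for v :: "nat \<Rightarrow> nat" and j
  \<comment> \<open>Label 0 means that F does not decrease coordinate i, label 1 that F does not
    increase it. The clauses for \<open>v i = 0\<close> and \<open>v i = p\<close> enforce the
    boundary labels of \<open>kuhn_lemma\<close>; they agree with this meaning because F maps into
    the cube.\<close>
  define lab where "lab v i = (if v i \<noteq> p \<and> (v i = 0 \<or> x v i \<le> F (x v) i) then 0 else 1::nat)" for v i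
  have x01: "\<forall>j<n. 0 \<le> x v j \<and> x v j \<le> 1" if "\<forall>j<n. v j \<le> p" for v
    using that p(1) by (auto simp: x_def)
  obtain q where q: "\<forall>i<n. q i < p"
    "\<forall>i<n. \<exists>r s. (\<forall>j<n. q j \<le> r j \<and> r j \<le> q j + 1) \<and> (\<forall>j<n. q j \<le> s j \<and> s j \<le> q j + 1) \<and> lab r i \<noteq> lab s i"
    by (rule kuhn_lemma[of p n lab]) (use p(1) in \<open>auto simp: lab_def\<close>)
  have l0: "x v i \<le> F (x v) i" if "lab v i = 0" "\<forall>j<n. v j \<le> p" "i < n" for v i
    using that ran[OF x01[OF that(2)] that(3)] by (auto simp: lab_def x_def[of v i] split: if_splits)
  have l1: "F (x v) i \<le> x v i" if "lab v i \<noteq> 0" "\<forall>j<n. v j \<le> p" "i < n" for v i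
    using that ran[OF x01[OF that(2)] that(3)] p(1) by (auto simp: lab_def x_def[of v i] split: if_splits)
  have qp: "\<forall>j<n. q j \<le> p" using q(1) by (simp add: less_imp_le)
  have near: "\<bar>F (x q) i - F (x r) i\<bar> < e/2" "\<bar>x q i - x r i\<bar> < e/2" "\<forall>j<n. r j \<le> p"
    if r: "\<forall>j<n. q j \<le> r j \<and> r j \<le> q j + 1" and i: "i < n" for r i
  proof -
    show rp: "\<forall>j<n. r j \<le> p"
      using r q(1) by (metis Suc_eq_plus1 Suc_leI le_trans)
    have dx: "\<bar>x q j - x r j\<bar> \<le> 1 / real p" if "j < n" for j
    proof -
      have "x q j - x r j = (real (q j) - real (r j)) / real p"
        by (simp add: x_def diff_divide_distrib)
      moreover have "\<bar>real (q j) - real (r j)\<bar> \<le> 1" using r that by fastforce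
      ultimately show ?thesis by (simp add: abs_divide divide_right_mono)
    qed
    show "\<bar>x q i - x r i\<bar> < e/2" using dx[OF i] p(2) by linarith
    show "\<bar>F (x q) i - F (x r) i\<bar> < e/2"
      using x01[OF qp] x01[OF rp] dx p(2) by (intro d(2)[OF _ i]) force
  qed
  \<comment> \<open>Two vertices of the Kuhn cell at q have different labels in coordinate i, so F
    minus the identity changes sign between them, and both are e/2-close to q in argument and in
    value.\<close>
  have "\<bar>F (x q) i - x q i\<bar> < e" if i: "i < n" for i
  proof -
    obtain r s where rs: "\<forall>j<n. q j \<le> r j \<and> r j \<le> q j + 1" "\<forall>j<n. q j \<le> s j \<and> s j \<le> q j + 1" "lab r i \<noteq> lab s i"
      using q(2) i by blast
    note near(1,2)[OF rs(1) i] near(1,2)[OF rs(2) i]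
    moreover have "(x r i \<le> F (x r) i \<and> F (x s) i \<le> x s i) \<or> (x s i \<le> F (x s) i \<and> F (x r) i \<le> x r i)"
    proof (cases "lab r i = 0")
      case True
      then have "lab s i \<noteq> 0" using rs(3) by simp
      from l0[OF True near(3)[OF rs(1) i] i] l1[OF this near(3)[OF rs(2) i] i] show ?thesis by blast
    next
      case False
      then have "lab s i = 0" using rs(3) by (auto simp: lab_def split: if_splits)
      from l1[OF False near(3)[OF rs(1) i] i] l0[OF this near(3)[OF rs(2) i] i] show ?thesis by blast
    qed
    ultimately show ?thesis by linarith
  qed
  then show ?thesis using x01[OF qp] by blast
qed

text \<open>The functions max 0 (e - norm (y - c i)) over an e-net vanish unless c i is within e of
  y. After normalization their combination is an average of points e-close to y.\<close>

lemma schauder_projection: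
  fixes K :: "'a::real_normed_vector set"
  assumes "compact K" "K \<noteq> {}" "e > 0"
  obtains n :: nat and c :: "nat \<Rightarrow> 'a" and v :: "nat \<Rightarrow> 'a \<Rightarrow> real"
  where "n > 0" "\<And>i. i < n \<Longrightarrow> c i \<in> K" "\<And>i. continuous_on K (v i)"
    "\<And>i y. 0 \<le> v i y" "\<And>y. y \<in> K \<Longrightarrow> (\<Sum>i<n. v i y) = 1"
    "\<And>y. y \<in> K \<Longrightarrow> norm ((\<Sum>i<n. v i y *\<^sub>R c i) - y) \<le> e"
proof -
  obtain k where k: "finite k" "k \<subseteq> K" "K \<subseteq> (\<Union>x\<in>k. ball x e)"
    using seq_compact_imp_totally_bounded assms(1,3) compact_eq_seq_compact_metric by metis
  obtain n and c :: "nat \<Rightarrow> 'a" where c: "k = c ` {i. i < n}"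
    using finite_imp_nat_seg_image_inj_on[OF k(1)] by blast
  define u where "u i y = max 0 (e - norm (y - c i))" for i y
  define U where "U y = (\<Sum>i<n. u i y)" for y
  have u0: "0 \<le> u i y" for i y by (simp add: u_def)
  have Upos: "U y > 0" if "y \<in> K" for y
  proof -
    have "y \<in> (\<Union>x\<in>c ` {i. i < n}. ball x e)" using k(3) that c by blast
    then obtain i where i: "i < n" "dist (c i) y < e" by auto
    have "0 < u i y" using i(2) by (simp add: u_def dist_norm norm_minus_commute)
    also have "\<dots> \<le> U y" unfolding U_def using i(1) u0 by (intro member_le_sum) auto
    finally show ?thesis .
  qed
  show thesis
  proof (rule that[of n c "\<lambda>i y. u i y / U y"])
    show "n > 0" using k(3) assms(2) c by (cases n) auto
    show "c i \<in> K" if "i < n" for i using that c k(2) by auto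
    show "continuous_on K (\<lambda>y. u i y / U y)" for i
      using Upos unfolding U_def u_def by (intro continuous_intros) fastforce
    show "0 \<le> u i y / U y" for i y
      unfolding U_def by (intro divide_nonneg_nonneg sum_nonneg u0)
    show sum1: "(\<Sum>i<n. u i y / U y) = 1" if "y \<in> K" for y
      using Upos[OF that] by (simp add: sum_divide_distrib[symmetric] U_def[symmetric])
    show "norm ((\<Sum>i<n. (u i y / U y) *\<^sub>R c i) - y) \<le> e" if "y \<in> K" for y
    proof -
      have "(\<Sum>i<n. (u i y / U y) *\<^sub>R c i) - y = (\<Sum>i<n. (u i y / U y) *\<^sub>R (c i - y))"
        using sum1[OF that] by (simp add: scaleR_diff_right sum_subtractf scaleR_sum_left[symmetric])
      also have "norm \<dots> \<le> (\<Sum>i<n. (u i y / U y) * e)"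
      proof (intro order.trans[OF norm_sum] sum_mono)
        fix i assume "i \<in> {..<n}"
        show "norm ((u i y / U y) *\<^sub>R (c i - y)) \<le> (u i y / U y) * e"
        proof (cases "norm (y - c i) < e")
          case True
          then show ?thesis using u0[of i y] Upos[OF that]
            by (simp add: norm_minus_commute mult_left_mono divide_right_mono)
        next
          case False
          then have "u i y = 0" by (simp add: u_def)
          then show ?thesis by simp
        qed
      qed
      also have "\<dots> = e" using sum1[OF that] by (subst sum_distrib_right[symmetric]) simp
      finally show ?thesis .
    qed
  qed
qed

text \<open>The Schauder projection of \<open>f\<close> is read in its weights: a cube point w gives
  a point \<open>x w\<close> of the convex hull, and F w consists of the weights of
  \<open>f (x w)\<close>. One e is lost by the projection, the other by passing from w to F
  w.\<close>

lemma schauder_approximate_fixed_point: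
  fixes f :: "'a::real_normed_vector \<Rightarrow> 'a"
  assumes "convex C" "C \<noteq> {}" "continuous_on C f" "f ` C \<subseteq> K" "compact K" "K \<subseteq> C" "e > 0"
  shows "\<exists>x\<in>C. norm (f x - x) \<le> 2 * e"
proof -
  have "K \<noteq> {}" using assms(2,4) by blast
  obtain n :: nat and c :: "nat \<Rightarrow> 'a" and v :: "nat \<Rightarrow> 'a \<Rightarrow> real"
    where n: "n > 0" and cK: "\<And>i. i < n \<Longrightarrow> c i \<in> K" and vcont: "\<And>i. continuous_on K (v i)"
      and v0: "\<And>i y. 0 \<le> v i y" and vsum: "\<And>y. y \<in> K \<Longrightarrow> (\<Sum>i<n. v i y) = 1"
      and vapp: "\<And>y. y \<in> K \<Longrightarrow> norm ((\<Sum>i<n. v i y *\<^sub>R c i) - y) \<le> e"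
    by (rule schauder_projection[OF assms(5) \<open>K \<noteq> {}\<close> assms(7)], rule that) assumption+
  define B where "B = (\<Sum>i<n. norm (c i - c 0))"
  have B: "norm (c i - c 0) \<le> B" if "i < n" for i
    unfolding B_def using that by (intro member_le_sum) auto
  have B0: "0 \<le> B" unfolding B_def by (intro sum_nonneg) auto
  \<comment> \<open>The coordinates of a cube point need not sum to 1. Dividing by the maximum of 1
    and their sum, and giving the missing mass to \<open>c 0\<close>, retracts the cube onto the
    simplex in a Lipschitz way, without a special case at sum 0.\<close>
  define mx where "mx w = max 1 (\<Sum>i<n. w i)" for w :: "nat \<Rightarrow> real"
  define x where "x w = c 0 + (\<Sum>i<n. (w i / mx w) *\<^sub>R (c i - c 0))" for w
  define H where "H = convex hull (c ` {..<n})"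
  have HC: "H \<subseteq> C" unfolding H_def using cK assms(6) by (intro hull_minimal assms(1)) auto
  have Hc: "compact H" unfolding H_def by (intro finite_imp_compact_convex_hull) auto
  have xH: "x w \<in> H" if "\<forall>j<n. 0 \<le> w j" for w
  proof -
    have pos: "mx w \<ge> 1" by (simp add: mx_def)
    have s0: "0 \<le> (\<Sum>i<n. w i)" using that by (intro sum_nonneg) auto
    define t where "t = (\<Sum>i<n. w i / mx w)"
    have t: "t \<le> 1" "t \<ge> 0"
      using pos s0 unfolding t_def sum_divide_distrib[symmetric] by (auto simp: mx_def)
    define w' where "w' i = w i / mx w + (if i = 0 then 1 - t else 0)" for i
    have sp: "(\<Sum>i<n. g i + (if i = 0 then a else 0)) = (\<Sum>i<n. g i) + a" for g :: "nat \<Rightarrow> 'b::real_vector" and a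
      using n by (subst sum.distrib) (simp add: sum.delta)
    have "x w = (\<Sum>i<n. (w i / mx w) *\<^sub>R c i) + (1 - t) *\<^sub>R c 0"
      by (simp add: x_def t_def scaleR_diff_right sum_subtractf scaleR_sum_left scaleR_diff_left)
    also have "\<dots> = (\<Sum>i<n. (w i / mx w) *\<^sub>R c i + (if i = 0 then (1 - t) *\<^sub>R c 0 else 0))"
      by (rule sp[symmetric])
    also have "\<dots> = (\<Sum>i<n. w' i *\<^sub>R c i)"
      by (intro sum.cong) (auto simp: w'_def scaleR_add_left)
    also have "\<dots> \<in> H"
    proof (rule convex_sum)
      show "(\<Sum>i<n. w' i) = 1" unfolding w'_def by (subst sp) (simp add: t_def)
      show "0 \<le> w' i" if "i \<in> {..<n}" for i
        using that \<open>\<forall>j<n. 0 \<le> w j\<close> t pos by (auto simp: w'_def)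
      show "c i \<in> H" if "i \<in> {..<n}" for i
        using that unfolding H_def by (intro hull_inc) auto
    qed (auto simp: H_def)
    finally show ?thesis .
  qed
  have fuc: "uniformly_continuous_on H (\<lambda>z. v i (f z))" for i
    using Hc HC assms(3,4) vcont[of i]
    by (intro compact_uniformly_continuous continuous_on_compose2[OF vcont[of i]]) (auto intro: continuous_on_subset)
  have xlip: "norm (x w - x u) \<le> real n * ((real n + 1) * d * B)"
    if w: "\<forall>j<n. 0 \<le> w j \<and> w j \<le> 1 \<and> 0 \<le> u j \<and> u j \<le> 1 \<and> \<bar>w j - u j\<bar> \<le> d" for w u d
  proof -
    have md: "\<bar>mx w - mx u\<bar> \<le> real n * d"
    proof -
      have "\<bar>mx w - mx u\<bar> \<le> \<bar>(\<Sum>i<n. w i) - (\<Sum>i<n. u i)\<bar>" by (auto simp: mx_def)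
      also have "\<dots> = \<bar>\<Sum>i<n. w i - u i\<bar>" by (simp add: sum_subtractf)
      also have "\<dots> \<le> (\<Sum>i<n. d)" using w by (intro order.trans[OF sum_abs] sum_mono) auto
      finally show ?thesis by simp
    qed
    have m1: "mx w \<ge> 1" "mx u \<ge> 1" by (auto simp: mx_def)
    have div1: "a / b \<le> a" if "1 \<le> b" "0 \<le> a" for a b :: real
      using that by (simp add: divide_le_eq mult_le_cancel_left1)
    have "x w - x u = (\<Sum>i<n. (w i / mx w - u i / mx u) *\<^sub>R (c i - c 0))"
      by (simp add: x_def sum_subtractf scaleR_diff_left)
    also have "norm \<dots> \<le> (\<Sum>i<n. (real n + 1) * d * B)"
    proof (intro order.trans[OF norm_sum] sum_mono)
      fix i assume i: "i \<in> {..<n}"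
      have "w i / mx w - u i / mx u = (w i - u i) / mx w + (u i / mx u) * ((mx u - mx w) / mx w)"
        using m1 by (simp add: field_simps)
      also have "\<bar>\<dots>\<bar> \<le> d + 1 * (real n * d)"
      proof (intro order.trans[OF abs_triangle_ineq] add_mono)
        have d0: "0 \<le> d" using w i by (meson abs_ge_zero lessThan_iff order.trans)
        have "\<bar>(w i - u i) / mx w\<bar> = \<bar>w i - u i\<bar> / mx w" using m1 by simp
        also have "\<dots> \<le> \<bar>w i - u i\<bar>" using m1(1) by (rule div1) simp
        finally show "\<bar>(w i - u i) / mx w\<bar> \<le> d" using w i by (meson lessThan_iff order.trans)
        have "\<bar>(mx u - mx w) / mx w\<bar> \<le> \<bar>mx u - mx w\<bar>"
          using m1(1) div1[OF m1(1), of "\<bar>mx u - mx w\<bar>"] by simp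
        then have A: "\<bar>(mx u - mx w) / mx w\<bar> \<le> real n * d" using md by linarith
        have "0 \<le> u i" "u i \<le> 1" using w i by auto
        then have "\<bar>u i / mx u\<bar> \<le> 1" using m1(2) by simp
        then show "\<bar>u i / mx u * ((mx u - mx w) / mx w)\<bar> \<le> 1 * (real n * d)"
          unfolding abs_mult using A by (intro mult_mono) auto
      qed
      finally have "\<bar>w i / mx w - u i / mx u\<bar> \<le> (real n + 1) * d" by (simp add: algebra_simps)
      then show "norm ((w i / mx w - u i / mx u) *\<^sub>R (c i - c 0)) \<le> (real n + 1) * d * B"
        unfolding norm_scaleR using B i by (intro mult_mono) auto
    qed
    finally show ?thesis by simp
  qed
  \<comment> \<open>The Lipschitz constant of \<open>x\<close> with respect to the largest
    coordinate difference, from \<open>xlip\<close>. Tolerances are divided by D + 1 so that D = 0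
    needs no separate treatment.\<close>
  define D where "D = real n * ((real n + 1) * B)"
  have D0: "D \<ge> 0" using B0 by (simp add: D_def)
  have D1: "D / (D + 1) < 1" using D0 by simp
  define F where "F w i = v i (f (x w))" for w i
  have v1: "v i y \<le> 1" if "y \<in> K" "i < n" for i y
  proof -
    have "v i y \<le> (\<Sum>i<n. v i y)" using that v0 by (intro member_le_sum) auto
    then show ?thesis using vsum[OF that(1)] by simp
  qed
  have fK: "f (x w) \<in> K" if "\<forall>j<n. 0 \<le> w j" for w
    using xH[OF that] HC assms(4) by blast
  have "\<exists>w. (\<forall>j<n. 0 \<le> w j \<and> w j \<le> 1) \<and> (\<forall>i<n. \<bar>F w i - w i\<bar> < e / (D + 1))"
  proof (rule approximate_fixed_point_cube)
    show "0 \<le> F w i \<and> F w i \<le> 1" if "\<forall>j<n. 0 \<le> w j \<and> w j \<le> 1" "i < n" for w i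
      unfolding F_def using v0 v1[OF fK \<open>i < n\<close>] that by auto
    show "0 < e / (D + 1)" using assms(7) D0 by simp
    fix \<eta> :: real assume "\<eta> > 0"
    have "\<exists>d>0. \<forall>z\<in>H. \<forall>z'\<in>H. dist z' z < d \<longrightarrow> \<bar>v i (f z') - v i (f z)\<bar> < \<eta>" for i
      using fuc[of i] \<open>\<eta> > 0\<close> unfolding uniformly_continuous_on_def dist_real_def by blast
    then obtain d where d: "\<And>i. d i > 0" "\<And>i z z'. \<lbrakk>z \<in> H; z' \<in> H; dist z' z < d i\<rbrakk> \<Longrightarrow> \<bar>v i (f z') - v i (f z)\<bar> < \<eta>"
      by metis
    define d0 where "d0 = Min (d ` {..<n})"
    have "d ` {..<n} \<noteq> {}" using n by auto
    then have d0: "d0 > 0" "\<And>i. i < n \<Longrightarrow> d0 \<le> d i"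
      unfolding d0_def by (subst Min_gr_iff; use d(1) in auto) auto
    show "\<exists>d>0. \<forall>v w. (\<forall>j<n. 0 \<le> v j \<and> v j \<le> 1 \<and> 0 \<le> w j \<and> w j \<le> 1 \<and> \<bar>v j - w j\<bar> < d)
        \<longrightarrow> (\<forall>i<n. \<bar>F v i - F w i\<bar> < \<eta>)"
    proof (intro exI[of _ "d0 / (D + 1)"] conjI allI impI)
      show "0 < d0 / (D + 1)" using d0 D0 by simp
      fix w u :: "nat \<Rightarrow> real" and i
      assume a: "\<forall>j<n. 0 \<le> w j \<and> w j \<le> 1 \<and> 0 \<le> u j \<and> u j \<le> 1 \<and> \<bar>w j - u j\<bar> < d0 / (D + 1)" and i: "i < n"
      have "norm (x w - x u) \<le> real n * ((real n + 1) * (d0 / (D + 1)) * B)"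
        using a by (intro xlip) (auto simp: less_imp_le)
      also have "\<dots> = d0 * (D / (D + 1))" by (simp add: D_def)
      also have "\<dots> < d0" using mult_strict_left_mono[OF D1 d0(1)] by simp
      finally have "dist (x w) (x u) < d i" using d0(2)[OF i] by (simp add: dist_norm)
      then show "\<bar>F w i - F u i\<bar> < \<eta>"
        unfolding F_def using a by (intro d(2) xH) auto
    qed
  qed
  then obtain w where w: "\<And>j. j < n \<Longrightarrow> 0 \<le> w j \<and> w j \<le> 1" "\<And>i. i < n \<Longrightarrow> \<bar>F w i - w i\<bar> < e / (D + 1)"
    by blast
  have xw: "x w \<in> H" using w(1) by (intro xH) auto
  have fw: "f (x w) \<in> K" using w(1) by (intro fK) auto
  have F01: "0 \<le> F w i \<and> F w i \<le> 1" if "i < n" for i using v0 v1[OF fw that] by (auto simp: F_def)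
  have mF: "mx (F w) = 1" using vsum[OF fw] by (simp add: mx_def F_def)
  have "x (F w) = (\<Sum>i<n. v i (f (x w)) *\<^sub>R c i)"
    using vsum[OF fw] unfolding x_def[of "F w"] mF
    by (simp add: F_def scaleR_diff_right sum_subtractf scaleR_sum_left[symmetric])
  then have A: "norm (x (F w) - f (x w)) \<le> e" using vapp[OF fw] by simp
  have "norm (x w - x (F w)) \<le> real n * ((real n + 1) * (e / (D + 1)) * B)"
    using w F01 by (intro xlip) (auto simp: abs_minus_commute less_imp_le)
  also have "\<dots> = e * (D / (D + 1))" by (simp add: D_def)
  also have "\<dots> \<le> e" using mult_left_mono[of _ _ e, OF less_imp_le[OF D1]] assms(7) by simp
  finally have "norm (f (x w) - x w) \<le> 2 * e"
    using A norm_triangle_ineq[of "x (F w) - f (x w)" "x w - x (F w)"] by (simp add: norm_minus_commute)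
  then show ?thesis using xw HC by blast
qed

text \<open>Approximate fixed points need not accumulate in \<open>C\<close> by themselves; their
  images do, as they lie in the compact \<open>K\<close>, and the approximate fixed points follow
  their images.\<close>

theorem schauder_fixed_point:
  fixes f :: "'a::real_normed_vector \<Rightarrow> 'a"
  assumes "convex C" "C \<noteq> {}" "continuous_on C f" "f ` C \<subseteq> K" "compact K" "K \<subseteq> C"
  shows "\<exists>x\<in>C. f x = x"
proof -
  have "\<exists>x\<in>C. norm (f x - x) \<le> 2 * (1 / real (Suc k))" for k
    by (intro schauder_approximate_fixed_point[OF assms]) auto
  then obtain x where x: "\<And>k. x k \<in> C" "\<And>k. norm (f (x k) - x k) \<le> 2 * (1 / real (Suc k))"
    by metis
  have "\<forall>k. f (x k) \<in> K" using x(1) assms(4) by blast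
  then obtain r l where r: "l \<in> K" "strict_mono r" "((\<lambda>k. f (x k)) \<circ> r) \<longlonglongrightarrow> l"
    using assms(5)[unfolded compact_def, rule_format, of "\<lambda>k. f (x k)"] by metis
  have "(\<lambda>k. 2 * (1 / real (Suc k))) \<longlonglongrightarrow> 2 * 0"
    by (intro tendsto_mult tendsto_const LIMSEQ_Suc[OF lim_1_over_n])
  then have "(\<lambda>k. f (x k) - x k) \<longlonglongrightarrow> 0"
    using x(2) by (intro Lim_null_comparison[of "\<lambda>k. f (x k) - x k"]) auto
  then have d: "(\<lambda>k. f (x (r k)) - x (r k)) \<longlonglongrightarrow> 0"
    using LIMSEQ_subseq_LIMSEQ[OF _ r(2)] by (auto simp: comp_def)
  have "(\<lambda>k. f (x (r k)) - (f (x (r k)) - x (r k))) \<longlonglongrightarrow> l - 0"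
    using r(3) by (intro tendsto_diff d) (simp add: comp_def)
  then have "(\<lambda>k. x (r k)) \<longlonglongrightarrow> l" by simp
  then have "(\<lambda>k. f (x (r k))) \<longlonglongrightarrow> f l"
    using r(1) assms(6) x(1) by (intro continuous_on_tendsto_compose[OF assms(3)]) auto
  then have "f l = l" using r(3) by (auto simp: comp_def intro: LIMSEQ_unique)
  then show ?thesis using r(1) assms(6) by blast
qed

text \<open>Apply Schauder's theorem to f followed by the radial retraction onto the ball of radius
  R. If f x left the ball at a fixed point x of this composition, then x = c f x with c = R / norm
  (f x) < 1 and norm x = R, which the a priori bound excludes.\<close>

theorem schaefer_fixed_point:
  fixes f :: "'a::real_normed_vector \<Rightarrow> 'a"
  assumes cont: "continuous_on UNIV f"
    and comp: "\<And>r. \<exists>K. compact K \<and> f ` cball 0 r \<subseteq> K"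
    and bdd: "\<And>x c. \<lbrakk>0 \<le> c; c \<le> 1; x = c *\<^sub>R f x\<rbrakk> \<Longrightarrow> norm x < R"
  shows "\<exists>x. f x = x"
proof -
  have R: "R > 0" using bdd[of 0 0] by simp
  obtain K where K: "compact K" "f ` cball 0 R \<subseteq> K" using comp by blast
  define \<rho> where "\<rho> x = (R / max R (norm x)) *\<^sub>R x" for x :: 'a
  have \<rho>c: "continuous_on A \<rho>" for A
    unfolding \<rho>_def using R by (intro continuous_intros) auto
  have \<rho>b: "norm (\<rho> x) \<le> R" for x
    using R by (auto simp: \<rho>_def max_def divide_simps)
  have "\<exists>x\<in>cball 0 R. (\<rho> \<circ> f) x = x"
  proof (rule schauder_fixed_point)
    show "continuous_on (cball 0 R) (\<rho> \<circ> f)"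
      using cont \<rho>c by (intro continuous_on_compose) (auto intro: continuous_on_subset)
    show "(\<rho> \<circ> f) ` cball 0 R \<subseteq> \<rho> ` K" using K(2) by auto
    show "compact (\<rho> ` K)" using K(1) \<rho>c by (intro compact_continuous_image)
    show "\<rho> ` K \<subseteq> cball 0 R" using \<rho>b by auto
  qed (use R in auto)
  then obtain x where x: "norm x \<le> R" "\<rho> (f x) = x" by auto
  have "norm (f x) \<le> R"
  proof (rule ccontr)
    assume "\<not> norm (f x) \<le> R"
    then have gt: "norm (f x) > R" by simp
    have e: "x = (R / norm (f x)) *\<^sub>R f x" using x(2) gt by (simp add: \<rho>_def max_def)
    have "norm x < R" using bdd[OF _ _ e] R gt by (simp add: divide_le_eq)
    moreover have "norm x = R" using arg_cong[OF e, of norm] gt R by auto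
    ultimately show False by simp
  qed
  then have "\<rho> (f x) = f x" using R by (simp add: \<rho>_def max_def)
  then show ?thesis using x(2) by metis
qed

section \<open>Compactness and adjoints in Hilbert spaces\<close>

lemma compact_closureI_subseq:
  fixes A :: "'a::metric_space set"
  assumes "\<And>x :: nat \<Rightarrow> 'a. (\<And>n. x n \<in> A) \<Longrightarrow> \<exists>r l. strict_mono r \<and> (\<lambda>n. x (r n)) \<longlonglongrightarrow> l"
  shows "compact (closure A)"
  unfolding compact_def
proof (intro allI impI)
  fix y :: "nat \<Rightarrow> 'a" assume y: "\<forall>n. y n \<in> closure A"
  have "\<exists>x\<in>A. dist x (y n) < 1 / real (Suc n)" for n
    using y unfolding closure_approachable by simp
  then obtain x where x: "\<And>n. x n \<in> A" "\<And>n. dist (x n) (y n) < 1 / real (Suc n)" by metis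
  obtain r l where r: "strict_mono r" "(\<lambda>n. x (r n)) \<longlonglongrightarrow> l" using assms[of x] x(1) by blast
  have "(\<lambda>n. dist (x n) (y n)) \<longlonglongrightarrow> 0"
  proof (rule tendsto_sandwich[OF _ _ tendsto_const LIMSEQ_Suc[OF lim_1_over_n]])
    show "\<forall>\<^sub>F n in sequentially. dist (x n) (y n) \<le> 1 / real (Suc n)"
      using x(2) by (intro always_eventually allI less_imp_le)
  qed auto
  from LIMSEQ_subseq_LIMSEQ[OF this r(1)] have "(\<lambda>n. dist (x (r n)) (y (r n))) \<longlonglongrightarrow> 0"
    by (simp add: comp_def)
  from tendsto_dist_iff[THEN iffD1, OF r(2)] this have "(\<lambda>n. dist (x (r n)) l + dist (x (r n)) (y (r n))) \<longlonglongrightarrow> 0 + 0"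
    by (rule tendsto_add)
  then have lim0: "(\<lambda>n. dist (x (r n)) l + dist (x (r n)) (y (r n))) \<longlonglongrightarrow> 0" by simp
  have "(\<lambda>n. dist (y (r n)) l) \<longlonglongrightarrow> 0"
  proof (rule tendsto_sandwich[OF _ _ tendsto_const lim0])
    show "\<forall>\<^sub>F n in sequentially. dist (y (r n)) l \<le> dist (x (r n)) l + dist (x (r n)) (y (r n))"
      by (intro always_eventually allI) (metis add.commute dist_triangle3)
  qed simp
  then have yl: "(\<lambda>n. y (r n)) \<longlonglongrightarrow> l" by (rule tendsto_dist_iff[THEN iffD2])
  have "l \<in> closure A" by (rule closed_sequentially[OF closed_closure _ yl]) (use y in auto)
  then show "\<exists>l\<in>closure A. \<exists>r. strict_mono r \<and> (y \<circ> r) \<longlonglongrightarrow> l"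
    using yl r(1) by (auto simp: comp_def)
qed

section \<open>Extraction of convergent subsequences\<close>

text \<open>The compact set may depend on \<open>e\<close>, since a convolution is only a small
  perturbation of a point in the image of a compact operator. Such a family is still totally
  bounded.\<close>

lemma subseq_Cauchy_if_near_compact:
  fixes x :: "nat \<Rightarrow> 'a::complete_space"
  assumes "\<And>e. e > 0 \<Longrightarrow> \<exists>K. compact K \<and> (\<forall>n. \<exists>k\<in>K. dist (x n) k < e)"
  shows "\<exists>r. strict_mono r \<and> Cauchy (\<lambda>n. x (r n))"
proof -
  have "compact (closure (range x))"
    unfolding compact_eq_totally_bounded
  proof (intro conjI allI impI)
    show "complete (closure (range x))" by (simp add: complete_eq_closed)
    fix e :: real assume "e > 0"
    then obtain K where K: "compact K" "\<And>n. \<exists>k\<in>K. dist (x n) k < e/3"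
      using assms[of "e/3"] by auto
    obtain k where k: "finite k" "K \<subseteq> (\<Union>x\<in>k. ball x (e/3))"
      using K(1)[unfolded compact_eq_totally_bounded, THEN conjunct2, rule_format, of "e/3"] \<open>e > 0\<close> by auto
    have "closure (range x) \<subseteq> (\<Union>x\<in>k. ball x e)"
    proof
      fix y assume "y \<in> closure (range x)"
      then obtain n where n: "dist (x n) y < e/3"
        using \<open>e > 0\<close> closure_approachable[THEN iffD1, rule_format, of y "range x" "e/3"] by auto
      obtain z where z: "z \<in> K" "dist (x n) z < e/3" using K(2) by blast
      obtain c where c: "c \<in> k" "dist c z < e/3" using k(2) z(1) by auto
      have "dist c y \<le> dist c z + dist (x n) z + dist (x n) y"
        using dist_triangle[of c y z] dist_triangle[of z y "x n"] by (simp add: dist_commute)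
      then have "dist c y < e" using n z(2) c(2) by linarith
      then show "y \<in> (\<Union>x\<in>k. ball x e)" using c(1) by auto
    qed
    then show "\<exists>k. finite k \<and> closure (range x) \<subseteq> (\<Union>x\<in>k. ball x e)" using k(1) by blast
  qed
  then obtain l r where "strict_mono r" "(x \<circ> r) \<longlonglongrightarrow> l"
    using closure_subset[of "range x"] unfolding compact_def by (meson rangeI subsetD)
  then show ?thesis using LIMSEQ_imp_Cauchy by (auto simp: comp_def)
qed

lemma arzela_ascoli_subseq:
  fixes f :: "nat \<Rightarrow> real \<Rightarrow> 'a::complete_space"
  assumes "0 \<le> T"
    and equi: "\<And>e. e > 0 \<Longrightarrow> \<exists>d>0. \<forall>n. \<forall>s\<in>{0..T}. \<forall>t\<in>{0..T}. \<bar>s - t\<bar> < d \<longrightarrow> dist (f n s) (f n t) < e"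
    and tb: "\<And>t e. \<lbrakk>t \<in> {0..T}; e > 0\<rbrakk> \<Longrightarrow> \<exists>K. compact K \<and> (\<forall>n. \<exists>k\<in>K. dist (f n t) k < e)"
  obtains r g where "strict_mono r" "uniform_limit {0..T} (\<lambda>n. f (r n)) g sequentially"
proof -
  \<comment> \<open>The index decodes to (i, j) and names the grid point i of mesh T / (j + 1),
    clipped to the interval. All meshes are enumerated at once, and each single mesh uses only the
    indices with i \<le> j + 1.\<close>
  define q where "q k = (case prod_decode k of (i, j) \<Rightarrow> min T (T * real i / real (Suc j)))" for k
  have q: "q k \<in> {0..T}" for k using assms(1) by (auto simp: q_def split: prod.split)
  interpret sub: subseqs "\<lambda>n s. Cauchy (\<lambda>k. f (s k) (q n))"
  proof
    fix n and s :: "nat \<Rightarrow> nat" assume "strict_mono s"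
    have "\<exists>r. strict_mono r \<and> Cauchy (\<lambda>k. f (s (r k)) (q n))"
    proof (rule subseq_Cauchy_if_near_compact)
      fix e :: real assume "e > 0"
      with tb[OF q] obtain K where "compact K" "\<forall>k. \<exists>z\<in>K. dist (f k (q n)) z < e" by metis
      then show "\<exists>K. compact K \<and> (\<forall>k. \<exists>z\<in>K. dist (f (s k) (q n)) z < e)"
        by (intro exI[of _ K]) simp
    qed
    then show "\<exists>r'. strict_mono r' \<and> Cauchy (\<lambda>k. f ((s \<circ> r') k) (q n))" by (simp add: comp_def)
  qed
  define r where "r = sub.diagseq"
  have Cq: "Cauchy (\<lambda>k. f (r k) (q n))" for n
  proof -
    \<comment> \<open>The diagonal sequence is a subsequence of the n-th extracted one only after
      the first n + 1 terms; the shift is removed afterwards.\<close>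
    have "Cauchy (\<lambda>k. f ((sub.diagseq \<circ> ((+) (Suc n))) k) (q n))"
    proof (rule sub.diagseq_holds)
      fix r s :: "nat \<Rightarrow> nat" and n assume "strict_mono r" "Cauchy (\<lambda>k. f (s k) (q n))"
      then show "Cauchy (\<lambda>k. f ((s \<circ> r) k) (q n))"
        using Cauchy_subseq_Cauchy[of "\<lambda>k. f (s k) (q n)" r] by (simp add: comp_def)
    qed
    then have "Cauchy (\<lambda>k. f (r (k + Suc n)) (q n))" by (simp add: r_def add.commute comp_def)
    then have "convergent (\<lambda>k. f (r (k + Suc n)) (q n))" by (simp add: Cauchy_convergent_iff)
    then have "convergent (\<lambda>k. f (r k) (q n))"
      using convergent_ignore_initial_segment[of "\<lambda>k. f (r k) (q n)" "Suc n"] by simp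
    then show ?thesis by (rule convergent_Cauchy)
  qed
  have "\<forall>e>0. \<exists>N. \<forall>m n x. N \<le> m \<and> N \<le> n \<and> x \<in> {0..T} \<longrightarrow> dist (f (r m) x) (f (r n) x) < e"
  proof (intro allI impI)
    fix e :: real assume e: "e > 0"
    obtain d where d: "d > 0" "\<And>n s t. \<lbrakk>s \<in> {0..T}; t \<in> {0..T}; \<bar>s - t\<bar> < d\<rbrakk> \<Longrightarrow> dist (f n s) (f n t) < e/3"
      using equi[of "e/3"] e by auto
    obtain j :: nat where j: "T / d < real (Suc j)"
    proof -
      obtain n :: nat where "T / d < real n" using reals_Archimedean2 by blast
      then show thesis by (intro that[of n]) simp
    qed
    then have jd: "T / real (Suc j) < d" using d(1) by (simp add: field_simps)
    have "\<exists>N. \<forall>m\<ge>N. \<forall>n\<ge>N. dist (f (r m) (q k)) (f (r n) (q k)) < e/3" for k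
      using Cq[of k, unfolded Cauchy_def, rule_format, of "e/3"] e by simp
    then obtain N where N: "\<And>k m n. \<lbrakk>m \<ge> N k; n \<ge> N k\<rbrakk> \<Longrightarrow> dist (f (r m) (q k)) (f (r n) (q k)) < e/3"
      by metis
    define NN where "NN = Max ((\<lambda>i. N (prod_encode (i, j))) ` {..Suc j})"
    show "\<exists>N. \<forall>m n x. N \<le> m \<and> N \<le> n \<and> x \<in> {0..T} \<longrightarrow> dist (f (r m) x) (f (r n) x) < e"
    proof (intro exI[of _ NN] allI impI)
      fix m n x assume a: "NN \<le> m \<and> NN \<le> n \<and> x \<in> {0..T}"
      have "\<exists>i\<le>Suc j. \<bar>x - q (prod_encode (i, j))\<bar> < d"
      proof (cases "T = 0")
        case True
        then show ?thesis using a d(1) by (intro exI[of _ 0]) (auto simp: q_def)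
      next
        case False
        then have Tp: "T > 0" using assms(1) by simp
        define i where "i = nat \<lfloor>x * real (Suc j) / T\<rfloor>"
        have x0: "0 \<le> x * real (Suc j) / T" using a Tp by simp
        have i1: "real i \<le> x * real (Suc j) / T" "x * real (Suc j) / T < real i + 1"
          unfolding i_def using x0 by linarith+
        have x1: "x * real (Suc j) / T \<le> real (Suc j)" using a Tp by (simp add: divide_le_eq mult.commute)
        have il: "i \<le> Suc j" using i1(1) x1 by linarith
        define c where "c = real (Suc j)"
        have c: "c > 0" by (simp add: c_def)
        have "T * real i \<le> x * c" "x * c < T * real i + T"
          using i1 Tp unfolding c_def[symmetric] by (simp_all add: pos_le_divide_eq pos_divide_less_eq algebra_simps)
        then have "T * real i / real (Suc j) \<le> x" "x < (T * real i + T) / real (Suc j)"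
          using c unfolding c_def[symmetric] by (simp_all add: pos_divide_le_eq pos_less_divide_eq)
        moreover have "(T * real i + T) / real (Suc j) = T * real i / real (Suc j) + T / real (Suc j)"
          by (rule add_divide_distrib)
        ultimately have "\<bar>x - T * real i / real (Suc j)\<bar> < d" "T * real i / real (Suc j) \<le> T" using jd a by auto
        then show ?thesis using il by (intro exI[of _ i]) (simp add: q_def)
      qed
      then obtain i where i: "i \<le> Suc j" "\<bar>x - q (prod_encode (i, j))\<bar> < d" by blast
      define k where "k = prod_encode (i, j)"
      have "N k \<le> NN" unfolding NN_def k_def using i(1) by (intro Max_ge) auto
      then have 1: "dist (f (r m) (q k)) (f (r n) (q k)) < e/3" using a by (intro N) auto
      have 2: "dist (f (r m) x) (f (r m) (q k)) < e/3" "dist (f (r n) x) (f (r n) (q k)) < e/3"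
        using a i(2) unfolding k_def by (intro d(2)[OF _ q]; simp)+
      have "dist (f (r m) x) (f (r n) x) \<le> dist (f (r m) x) (f (r m) (q k)) + dist (f (r m) (q k)) (f (r n) (q k)) + dist (f (r n) x) (f (r n) (q k))"
        using dist_triangle[of "f (r m) x" "f (r n) x" "f (r m) (q k)"] dist_triangle[of "f (r m) (q k)" "f (r n) x" "f (r n) (q k)"]
        by (simp add: dist_commute)
      then show "dist (f (r m) x) (f (r n) x) < e" using 1 2 by linarith
    qed
  qed
  then obtain g where "\<forall>e>0. \<exists>N. \<forall>n x. N \<le> n \<and> x \<in> {0..T} \<longrightarrow> dist (f (r n) x) (g x) < e"
    using uniformly_convergent_eq_cauchy[of "\<lambda>x. x \<in> {0..T}" "\<lambda>n. f (r n)"] by blast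
  then have "uniform_limit {0..T} (\<lambda>n. f (r n)) g sequentially"
    unfolding uniform_limit_iff eventually_sequentially by meson
  moreover have "strict_mono r" unfolding r_def by (rule sub.subseq_diagseq)
  ultimately show thesis by (rule that[rotated])
qed

text \<open>The midpoint defect of the functional controls the distance in the applications,
  where it is a squared norm plus a linear term.\<close>

lemma minimizing_sequence_midpoint_defect:
  fixes J :: "'a \<Rightarrow> real" and A :: "nat \<Rightarrow> 'a set" and mid :: "'a \<Rightarrow> 'a \<Rightarrow> 'a"
  assumes dec: "\<And>m n. m \<le> n \<Longrightarrow> A n \<subseteq> A m"
    and mid: "\<And>n a b. \<lbrakk>a \<in> A n; b \<in> A n\<rbrakk> \<Longrightarrow> mid a b \<in> A n"
    and lower: "\<And>a. a \<in> A 0 \<Longrightarrow> b \<le> J a"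
    and upper: "\<And>n. \<exists>a\<in>A n. J a \<le> B"
  obtains x where "\<And>n. x n \<in> A n" "\<And>n a. a \<in> A n \<Longrightarrow> J (x n) \<le> J a + 1 / real (Suc n)"
    "\<And>e. e > 0 \<Longrightarrow> \<exists>N. \<forall>m\<ge>N. \<forall>n\<ge>N. J (x m) + J (x n) - 2 * J (mid (x m) (x n)) < e"
proof -
  define d where "d n = Inf (J ` A n)" for n
  have bb: "bdd_below (J ` A n)" for n
    using lower dec[of 0 n] by (intro bdd_belowI[of _ b]) auto
  have ne: "J ` A n \<noteq> {}" for n using upper[of n] by blast
  have dle: "d n \<le> J a" if "a \<in> A n" for a n
    unfolding d_def using that bb by (intro cInf_lower) auto
  have "\<exists>a\<in>A n. J a < d n + 1 / real (Suc n)" for n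
    using cInf_lessD[OF ne[of n], of "d n + 1 / real (Suc n)"] by (auto simp: d_def)
  then obtain x where x: "\<And>n. x n \<in> A n" "\<And>n. J (x n) < d n + 1 / real (Suc n)" by metis
  have inc: "incseq d"
    unfolding incseq_def d_def using dec ne bb by (auto intro!: cInf_superset_mono)
  have "d n \<le> B" for n using upper[of n] dle order.trans by blast
  then obtain D where D: "d \<longlonglongrightarrow> D" using incseq_convergent[OF inc] by metis
  show thesis
  proof (rule that[of x])
    show "x n \<in> A n" for n by (rule x)
    show "J (x n) \<le> J a + 1 / real (Suc n)" if "a \<in> A n" for n a
      using x(2)[of n] dle[OF that] by linarith
    fix e :: real assume e: "e > 0"
    have "Cauchy d" using D LIMSEQ_imp_Cauchy by blast
    then obtain N1 where N1: "\<And>m n. \<lbrakk>m \<ge> N1; n \<ge> N1\<rbrakk> \<Longrightarrow> \<bar>d m - d n\<bar> < e/3"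
      using e \<open>Cauchy d\<close>[unfolded Cauchy_def dist_real_def, rule_format, of "e/3"] by auto
    obtain N2 where N2: "1 / real (Suc N2) < e/3"
      using reals_Archimedean[of "e/3"] e by (auto simp: inverse_eq_divide)
    have N2': "1 / real (Suc n) < e/3" if "n \<ge> N2" for n
      using N2 that by (smt (verit) Suc_le_mono frac_le of_nat_0_less_iff of_nat_mono zero_less_Suc)
    \<comment> \<open>For m \<le> n both points lie in \<open>A m\<close>, so J at either midpoint
      is at least \<open>d m\<close>, while J (x m) and J (x n) are close to \<open>d m\<close> and
      \<open>d n\<close>. Both orders are treated because \<open>mid\<close> need not be
      symmetric.\<close>
    have main: "J (x m) + J (x n) - 2 * J (mid (x m) (x n)) < e" "J (x n) + J (x m) - 2 * J (mid (x n) (x m)) < e"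
      if "m \<ge> N1" "m \<ge> N2" "n \<ge> m" for m n
    proof -
      have nm: "x n \<in> A m" using x(1) dec[OF that(3)] by blast
      have "d m \<le> J (mid (x m) (x n))" "d m \<le> J (mid (x n) (x m))"
        using nm x(1) by (auto intro!: dle mid)
      then show "J (x m) + J (x n) - 2 * J (mid (x m) (x n)) < e" "J (x n) + J (x m) - 2 * J (mid (x n) (x m)) < e"
        using x(2)[of m] x(2)[of n] N1[of n m] N2'[of m] N2'[of n] that by linarith+
    qed
    show "\<exists>N. \<forall>m\<ge>N. \<forall>n\<ge>N. J (x m) + J (x n) - 2 * J (mid (x m) (x n)) < e"
    proof (intro exI[of _ "max N1 N2"] allI impI)
      fix m n assume "max N1 N2 \<le> m" "max N1 N2 \<le> n"
      then show "J (x m) + J (x n) - 2 * J (mid (x m) (x n)) < e"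
        using main[of m n] main[of n m] by (cases "m \<le> n") auto
    qed
  qed
qed

section \<open>Riesz representation and Hilbert space adjoints\<close>

text \<open>The representing vector minimizes norm x squared / 2 - l x. The linear part drops out of
  the midpoint defect, which is then a squared distance, so a minimizing sequence is Cauchy. The
  first-order condition at the minimizer is the representation.\<close>

theorem riesz_representation:
  fixes l :: "'a::{real_inner,complete_space} \<Rightarrow>\<^sub>L real"
  shows "\<exists>r. \<forall>x. l x = inner x r"
proof -
  define J where "J x = (norm x)\<^sup>2 / 2 - l x" for x
  have low: "- (norm l)\<^sup>2 / 2 \<le> J x" for x
  proof -
    have "l x \<le> norm l * norm x" using norm_blinfun[of l x] by simp
    moreover have "0 \<le> (norm x)\<^sup>2 + (norm l)\<^sup>2 - 2 * norm x * norm l"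
      using zero_le_power2[of "norm x - norm l"] by (simp add: power2_diff)
    ultimately show ?thesis unfolding J_def by (simp add: algebra_simps)
  qed
  have defect: "J a + J b - 2 * J ((1/2) *\<^sub>R (a + b)) = (norm (a - b))\<^sup>2 / 4" for a b
    by (simp add: J_def blinfun.add_right blinfun.scaleR_right power2_norm_eq_inner inner_simps inner_commute algebra_simps)
  obtain x where x: "\<And>n a. J (x n) \<le> J a + 1 / real (Suc n)"
    "\<And>e. e > 0 \<Longrightarrow> \<exists>N. \<forall>m\<ge>N. \<forall>n\<ge>N. J (x m) + J (x n) - 2 * J ((1/2) *\<^sub>R (x m + x n)) < e"
    by (rule minimizing_sequence_midpoint_defect[of "\<lambda>_. UNIV" "\<lambda>a b. (1/2) *\<^sub>R (a + b)" "- (norm l)\<^sup>2 / 2" J "J 0"])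
      (use low in auto)
  have "Cauchy x"
    unfolding Cauchy_def
  proof (intro allI impI)
    fix e :: real assume e: "e > 0"
    then obtain N where N: "\<And>m n. \<lbrakk>m \<ge> N; n \<ge> N\<rbrakk> \<Longrightarrow> (norm (x m - x n))\<^sup>2 / 4 < e\<^sup>2 / 4"
      using x(2)[of "e\<^sup>2 / 4"] unfolding defect by auto
    have "dist (x m) (x n) < e" if "m \<ge> N" "n \<ge> N" for m n
      using N[OF that] e power_less_imp_less_base[of "norm (x m - x n)" 2 e] by (simp add: dist_norm)
    then show "\<exists>M. \<forall>m\<ge>M. \<forall>n\<ge>M. dist (x m) (x n) < e" by blast
  qed
  then obtain r where r: "x \<longlonglongrightarrow> r" by (meson Cauchy_convergent_iff convergent_def)
  have "(\<lambda>n. J (x n)) \<longlonglongrightarrow> J r" unfolding J_def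
    by (intro tendsto_diff tendsto_divide tendsto_power tendsto_norm blinfun.tendsto r tendsto_const) auto
  then have "J r \<le> J a + 0" for a
  proof (rule LIMSEQ_le)
    show "(\<lambda>n. J a + 1 / real (Suc n)) \<longlonglongrightarrow> J a + 0"
      by (intro tendsto_add tendsto_const LIMSEQ_Suc[OF lim_1_over_n])
    show "\<exists>N. \<forall>n\<ge>N. J (x n) \<le> J a + 1 / real (Suc n)" using x(1) by blast
  qed
  then have min: "J r \<le> J a" for a by simp
  have "l h = inner h r" for h
  proof -
    define c where "c = inner h r - l h"
    have q: "0 \<le> t * c + t\<^sup>2 * (norm h)\<^sup>2 / 2" for t
    proof -
      have "(norm (r + t *\<^sub>R h))\<^sup>2 = (norm r)\<^sup>2 + 2 * (t * inner h r) + t\<^sup>2 * (norm h)\<^sup>2"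
        unfolding power2_norm_eq_inner by (simp add: inner_simps inner_commute power2_eq_square algebra_simps)
      then show ?thesis using min[of "r + t *\<^sub>R h"]
        by (simp add: J_def c_def blinfun.add_right blinfun.scaleR_right right_diff_distrib add_divide_distrib)
    qed
    have "c = 0"
    proof (rule ccontr)
      assume "c \<noteq> 0"
      \<comment> \<open>t = - c / s almost minimizes the quadratic in t; adding 1 keeps
        \<open>s\<close> positive when h = 0.\<close>
      define s where "s = (norm h)\<^sup>2 + 1"
      have s: "(norm h)\<^sup>2 \<le> s" "s > 0" unfolding s_def by (simp, rule add_nonneg_pos) auto
      have "0 \<le> (- c / s) * c + (- c / s)\<^sup>2 * (norm h)\<^sup>2 / 2" by (rule q)
      also have "\<dots> \<le> (- c / s) * c + (- c / s)\<^sup>2 * s / 2"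
        using s by (intro add_left_mono divide_right_mono mult_left_mono) simp_all
      also have "\<dots> = - (c\<^sup>2 / (2 * s))" using s(2) by (simp add: power2_eq_square)
      also have "\<dots> < 0" using s(2) \<open>c \<noteq> 0\<close> by simp
      finally show False by simp
    qed
    then show ?thesis by (simp add: c_def)
  qed
  then show ?thesis by blast
qed

text \<open>\<open>Blinfun\<close> is meaningful only on bounded linear maps; that the chosen
  representers form one is part of the lemma that follows.\<close>

definition hilbert_adjoint :: "('a::{real_inner,complete_space} \<Rightarrow>\<^sub>L 'b::real_inner) \<Rightarrow> ('b \<Rightarrow>\<^sub>L 'a)" where
  "hilbert_adjoint T = Blinfun (\<lambda>y. SOME r. \<forall>x. inner (T x) y = inner x r)"

lemma hilbert_adjoint:
  fixes T :: "'a::{real_inner,complete_space} \<Rightarrow>\<^sub>L 'b::real_inner"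
  shows "inner (T x) y = inner x (hilbert_adjoint T y)"
proof -
  define a where "a y = (SOME r. \<forall>x. inner (T x) y = inner x r)" for y
  have a: "inner (T x) y = inner x (a y)" for x y
  proof -
    have bl: "bounded_linear (\<lambda>x. inner (T x) y)"
      by (intro bounded_linear_intros blinfun.bounded_linear_right)
    obtain r where "\<forall>x. Blinfun (\<lambda>x. inner (T x) y) x = inner x r" using riesz_representation by blast
    then have "\<exists>r. \<forall>x. inner (T x) y = inner x r" by (auto simp: bounded_linear_Blinfun_apply[OF bl])
    then have "\<forall>x. inner (T x) y = inner x (a y)" unfolding a_def by (rule someI_ex)
    then show ?thesis by blast
  qed
  have "bounded_linear a"
  proof (rule bounded_linear_intro[where K = "norm T"])
    show "a (x + y) = a x + a y" for x y
      by (rule vector_eq_ldot[THEN iffD1]) (simp add: inner_add_right a[symmetric])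
    show "a (c *\<^sub>R x) = c *\<^sub>R a x" for c x
      by (rule vector_eq_ldot[THEN iffD1]) (simp add: a[symmetric])
    show "norm (a y) \<le> norm y * norm T" for y
    proof (cases "a y = 0")
      case False
      have "norm (a y) * norm (a y) = inner (T (a y)) y" by (simp add: a power2_norm_eq_inner[symmetric] power2_eq_square)
      also have "\<dots> \<le> norm (T (a y)) * norm y" by (rule norm_cauchy_schwarz)
      also have "\<dots> \<le> norm T * norm (a y) * norm y" by (intro mult_right_mono norm_blinfun) auto
      finally show ?thesis using False by (simp add: mult.commute mult.left_commute)
    qed auto
  qed
  then have "hilbert_adjoint T y = a y"
    unfolding hilbert_adjoint_def a_def[abs_def] by (simp add: bounded_linear_Blinfun_apply)
  then show ?thesis using a by simp
qed

lemma hilbert_adjoint_unique: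
  fixes R :: "'b::real_inner \<Rightarrow>\<^sub>L 'a::{real_inner,complete_space}" and T :: "'a \<Rightarrow>\<^sub>L 'b"
  assumes "\<And>x y. inner (T x) y = inner x (R y)"
  shows "hilbert_adjoint T = R"
proof (rule blinfun_eqI)
  fix y
  show "hilbert_adjoint T y = R y"
    by (rule vector_eq_ldot[THEN iffD1]) (simp add: hilbert_adjoint[symmetric] assms)
qed

lemma hilbert_adjoint_compose:
  fixes T :: "'b::{real_inner,complete_space} \<Rightarrow>\<^sub>L 'c::real_inner" and R :: "'a::{real_inner,complete_space} \<Rightarrow>\<^sub>L 'b"
  shows "hilbert_adjoint (T o\<^sub>L R) = hilbert_adjoint R o\<^sub>L hilbert_adjoint T"
  by (rule hilbert_adjoint_unique) (simp add: hilbert_adjoint)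

lemma hilbert_adjoint_diff:
  fixes T :: "'a::{real_inner,complete_space} \<Rightarrow>\<^sub>L 'b::real_inner"
  shows "hilbert_adjoint (T - R) = hilbert_adjoint T - hilbert_adjoint R"
  by (rule hilbert_adjoint_unique) (simp add: hilbert_adjoint blinfun.diff_left inner_diff_left inner_diff_right)

lemma norm_hilbert_adjoint_le:
  fixes T :: "'a::{real_inner,complete_space} \<Rightarrow>\<^sub>L 'b::real_inner"
  shows "norm (hilbert_adjoint T) \<le> norm T"
proof (rule norm_blinfun_bound)
  fix y
  let ?a = "hilbert_adjoint T y"
  show "norm ?a \<le> norm T * norm y"
  proof (cases "?a = 0")
    case False
    have "norm ?a * norm ?a = inner (T ?a) y" by (simp add: hilbert_adjoint power2_norm_eq_inner[symmetric] power2_eq_square)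
    also have "\<dots> \<le> norm (T ?a) * norm y" by (rule norm_cauchy_schwarz)
    also have "\<dots> \<le> norm T * norm ?a * norm y" by (intro mult_right_mono norm_blinfun) auto
    finally show ?thesis using False by (simp add: mult.commute mult.left_commute)
  qed auto
qed auto

lemma compact_operator_image:
  fixes K :: "'a::real_normed_vector \<Rightarrow>\<^sub>L 'b::real_normed_vector"
  assumes "compact_operator K"
  obtains C where "compact C" "K ` cball 0 r \<subseteq> C"
proof
  let ?C = "closure (K ` cball 0 1)"
  show "compact ((\<lambda>x. (\<bar>r\<bar> + 1) *\<^sub>R x) ` ?C)"
    using assms unfolding compact_operator_def by (intro compact_scaling)
  show "K ` cball 0 r \<subseteq> (\<lambda>x. (\<bar>r\<bar> + 1) *\<^sub>R x) ` ?C"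
  proof clarify
    fix x :: 'a assume x: "x \<in> cball 0 r"
    have r1: "\<bar>r\<bar> + 1 > 0" by linarith
    have "(1 / (\<bar>r\<bar> + 1)) *\<^sub>R x \<in> cball 0 1" using x r1 by (simp add: divide_le_eq)
    then have "K ((1 / (\<bar>r\<bar> + 1)) *\<^sub>R x) \<in> ?C" by (rule closure_subset[THEN subsetD, OF imageI])
    moreover have "K x = (\<bar>r\<bar> + 1) *\<^sub>R K ((1 / (\<bar>r\<bar> + 1)) *\<^sub>R x)" using r1 by (simp add: blinfun.scaleR_right)
    ultimately show "K x \<in> (\<lambda>x. (\<bar>r\<bar> + 1) *\<^sub>R x) ` ?C" by (simp only: imageI)
  qed
qed

lemma compact_operator_subseq:
  fixes K :: "'a::real_normed_vector \<Rightarrow>\<^sub>L 'b::real_normed_vector"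
  assumes "compact_operator K" "\<And>n::nat. norm (x n) \<le> c"
  obtains r l where "strict_mono r" "(\<lambda>n. K (x (r n))) \<longlonglongrightarrow> l"
proof -
  obtain C where C: "compact C" "K ` cball 0 c \<subseteq> C" using compact_operator_image[OF assms(1)] .
  have "\<forall>n. K (x n) \<in> C" using C(2) assms(2) by auto
  with C(1)[unfolded compact_def, rule_format, of "\<lambda>n. K (x n)"] obtain r l
    where "strict_mono r" "((\<lambda>n. K (x n)) \<circ> r) \<longlonglongrightarrow> l" by metis
  then show thesis by (intro that) (auto simp: comp_def)
qed

lemma compact_operatorI_subseq:
  fixes K :: "'a::real_normed_vector \<Rightarrow>\<^sub>L 'b::real_normed_vector"
  assumes "\<And>x. (\<And>n::nat. norm (x n) \<le> 1) \<Longrightarrow> \<exists>r l. strict_mono (r :: nat \<Rightarrow> nat) \<and> (\<lambda>n. K (x (r n))) \<longlonglongrightarrow> l"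
  shows "compact_operator K"
  unfolding compact_operator_def
proof (rule compact_closureI_subseq)
  fix y :: "nat \<Rightarrow> 'b" assume "\<And>n. y n \<in> K ` cball 0 1"
  then have "\<forall>n. \<exists>x. norm x \<le> 1 \<and> y n = K x" by force
  then obtain x where "\<And>n. norm (x n) \<le> 1" "\<And>n. y n = K (x n)" by metis
  then show "\<exists>r l. strict_mono r \<and> (\<lambda>n. y (r n)) \<longlonglongrightarrow> l" using assms[of x] by auto
qed

text \<open>Schauder's theorem in Hilbert space: the squared norm of the adjoint at d is the inner
  product of \<open>K (hilbert_adjoint K d)\<close> with d, so the Cauchy property passes from the
  compact composition to the adjoint.\<close>

lemma compact_operator_hilbert_adjoint:
  fixes K :: "'a::{real_inner,complete_space} \<Rightarrow>\<^sub>L 'b::real_inner"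
  assumes "compact_operator K"
  shows "compact_operator (hilbert_adjoint K)"
proof (rule compact_operatorI_subseq)
  fix y :: "nat \<Rightarrow> 'b" assume y: "\<And>n. norm (y n) \<le> 1"
  let ?A = "hilbert_adjoint K"
  have "norm (?A (y n)) \<le> norm ?A * 1" for n
    by (rule order.trans[OF norm_blinfun mult_left_mono[OF y]]) simp
  from compact_operator_subseq[OF assms this] obtain r l
    where r: "strict_mono r" "(\<lambda>n. K (?A (y (r n)))) \<longlonglongrightarrow> l" .
  have Cz: "Cauchy (\<lambda>n. K (?A (y (r n))))" using r(2) LIMSEQ_imp_Cauchy by blast
  have "Cauchy (\<lambda>n. ?A (y (r n)))"
    unfolding Cauchy_def
  proof (intro allI impI)
    fix e :: real assume e: "e > 0"
    obtain N where N: "\<And>m n. \<lbrakk>m \<ge> N; n \<ge> N\<rbrakk> \<Longrightarrow> dist (K (?A (y (r m)))) (K (?A (y (r n)))) < e\<^sup>2 / 2"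
      using Cz[unfolded Cauchy_def, rule_format, of "e\<^sup>2 / 2"] e by auto
    have "dist (?A (y (r m))) (?A (y (r n))) < e" if "m \<ge> N" "n \<ge> N" for m n
    proof -
      let ?d = "y (r m) - y (r n)"
      have "norm ?d \<le> 2" using norm_triangle_ineq4[of "y (r m)" "y (r n)"] y[of "r m"] y[of "r n"] by linarith
      have "(norm (?A ?d))\<^sup>2 = inner (K (?A ?d)) ?d" by (simp add: hilbert_adjoint power2_norm_eq_inner)
      also have "\<dots> \<le> norm (K (?A ?d)) * norm ?d" by (rule norm_cauchy_schwarz)
      also have "\<dots> \<le> norm (K (?A ?d)) * 2" by (intro mult_left_mono \<open>norm ?d \<le> 2\<close>) auto
      also have "\<dots> < e\<^sup>2 / 2 * 2" using N[OF that] by (simp add: dist_norm blinfun.diff_right)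
      finally have "norm (?A ?d) < e" using e power_less_imp_less_base[of "norm (?A ?d)" 2 e] by simp
      then show ?thesis by (simp add: dist_norm blinfun.diff_right)
    qed
    then show "\<exists>M. \<forall>m\<ge>M. \<forall>n\<ge>M. dist (?A (y (r m))) (?A (y (r n))) < e" by blast
  qed
  then show "\<exists>r l. strict_mono r \<and> (\<lambda>n. ?A (y (r n))) \<longlonglongrightarrow> l"
    using r(1) by (meson Cauchy_convergent_iff convergent_def)
qed

section \<open>Bochner integrals without the class banach\<close>

text \<open>The sort \<open>{real_normed_vector, complete_space}\<close> is not a subsort of \<open>banach\<close>, which many
  facts on Bochner integrals require. They are transported from an isometric copy of the
  type that is an instance of \<open>banach\<close>.\<close>

typedef (overloaded) 'a banach_copy = "UNIV :: 'a set"
  morphisms of_copy to_copy by simp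

setup_lifting type_definition_banach_copy

instantiation banach_copy :: (real_normed_vector) real_normed_vector
begin

lift_definition zero_banach_copy :: "'a banach_copy" is 0 .
lift_definition plus_banach_copy :: "'a banach_copy \<Rightarrow> 'a banach_copy \<Rightarrow> 'a banach_copy" is "(+)" .
lift_definition minus_banach_copy :: "'a banach_copy \<Rightarrow> 'a banach_copy \<Rightarrow> 'a banach_copy" is "(-)" .
lift_definition uminus_banach_copy :: "'a banach_copy \<Rightarrow> 'a banach_copy" is uminus .
lift_definition scaleR_banach_copy :: "real \<Rightarrow> 'a banach_copy \<Rightarrow> 'a banach_copy" is scaleR .
lift_definition norm_banach_copy :: "'a banach_copy \<Rightarrow> real" is norm .
lift_definition sgn_banach_copy :: "'a banach_copy \<Rightarrow> 'a banach_copy" is sgn .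
lift_definition dist_banach_copy :: "'a banach_copy \<Rightarrow> 'a banach_copy \<Rightarrow> real" is dist .

definition uniformity_banach_copy :: "('a banach_copy \<times> 'a banach_copy) filter" where
  "uniformity_banach_copy = (INF e\<in>{0<..}. principal {(x, y). dist x y < e})"

definition open_banach_copy :: "'a banach_copy set \<Rightarrow> bool" where
  "open_banach_copy U = (\<forall>x\<in>U. \<forall>\<^sub>F (x', y) in uniformity. x' = x \<longrightarrow> y \<in> U)"

instance
proof
  fix a b c :: "'a banach_copy" and r s :: real
  show "a + b + c = a + (b + c)" by transfer (simp add: add.assoc)
  show "a + b = b + a" by transfer (simp add: add.commute)
  show "0 + a = a" by transfer simp
  show "- a + a = 0" by transfer simp
  show "a - b = a + - b" by transfer simp
  show "r *\<^sub>R (a + b) = r *\<^sub>R a + r *\<^sub>R b" by transfer (simp add: scaleR_add_right)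
  show "(r + s) *\<^sub>R a = r *\<^sub>R a + s *\<^sub>R a" by transfer (simp add: scaleR_add_left)
  show "r *\<^sub>R s *\<^sub>R a = (r * s) *\<^sub>R a" by transfer simp
  show "1 *\<^sub>R a = a" by transfer simp
  show "dist a b = norm (a - b)" by transfer (simp add: dist_norm)
  show "sgn a = inverse (norm a) *\<^sub>R a" by transfer (simp add: sgn_div_norm)
  show "(norm a = 0) = (a = 0)" by transfer simp
  show "norm (a + b) \<le> norm a + norm b" by transfer (rule norm_triangle_ineq)
  show "norm (r *\<^sub>R a) = \<bar>r\<bar> * norm a" by transfer simp
qed (rule uniformity_banach_copy_def open_banach_copy_def)+

end

lemma bounded_linear_to_copy: "bounded_linear (to_copy :: 'a::real_normed_vector \<Rightarrow> 'a banach_copy)"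
  by (rule bounded_linear_intro[where K = 1])
    (simp_all add: plus_banach_copy.abs_eq scaleR_banach_copy.abs_eq norm_banach_copy.abs_eq)

lemma bounded_linear_of_copy: "bounded_linear (of_copy :: 'a banach_copy \<Rightarrow> 'a::real_normed_vector)"
  by (rule bounded_linear_intro[where K = 1])
    (simp_all add: plus_banach_copy.rep_eq scaleR_banach_copy.rep_eq norm_banach_copy.rep_eq)

lemma of_copy_to_copy [simp]: "of_copy (to_copy x) = x" "to_copy (of_copy y) = y"
  by (simp_all add: to_copy_inverse of_copy_inverse)

instance banach_copy :: ("{real_normed_vector, complete_space}") banach
proof
  fix X :: "nat \<Rightarrow> 'a banach_copy" assume "Cauchy X"
  then have "Cauchy (\<lambda>n. of_copy (X n))" by (simp add: Cauchy_def dist_banach_copy.rep_eq)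
  then obtain l where "(\<lambda>n. of_copy (X n)) \<longlonglongrightarrow> l" by (meson Cauchy_convergent_iff convergent_def)
  from bounded_linear.tendsto[OF bounded_linear_to_copy this] show "convergent X"
    by (auto simp: convergent_def)
qed

instance banach_copy :: ("{real_normed_vector, second_countable_topology}") second_countable_topology
proof
  obtain B :: "'a set set" where B: "countable B" "topological_basis B" using ex_countable_basis by blast
  have cont: "continuous_on UNIV (to_copy :: 'a \<Rightarrow> 'a banach_copy)" "continuous_on UNIV (of_copy :: 'a banach_copy \<Rightarrow> 'a)"
    using bounded_linear_to_copy bounded_linear_of_copy linear_continuous_on by blast+
  have im: "to_copy ` U = of_copy -` U" for U :: "'a set"
    by (auto simp: image_iff) (metis of_copy_to_copy(2))
  have "topological_basis ((`) to_copy ` B)"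
  proof (rule topological_basisI)
    fix B' :: "'a banach_copy set" assume "B' \<in> (`) to_copy ` B"
    then show "open B'"
      using topological_basis_open[OF B(2)] cont(2) by (auto simp: im intro: open_vimage)
  next
    fix U :: "'a banach_copy set" and x assume U: "open U" "x \<in> U"
    have "open (to_copy -` U)" "of_copy x \<in> to_copy -` U" using U cont(1) by (auto intro: open_vimage)
    then obtain V where V: "V \<in> B" "of_copy x \<in> V" "V \<subseteq> to_copy -` U" using topological_basisE[OF B(2)] by metis
    have "to_copy ` V \<subseteq> U" using V(3) by auto
    with V(1,2) show "\<exists>B'\<in>(`) to_copy ` B. x \<in> B' \<and> B' \<subseteq> U"
      by (intro bexI[of _ "to_copy ` V"] conjI imageI) (simp_all add: im)
  qed
  then show "\<exists>B :: 'a banach_copy set set. countable B \<and> open = generate_topology B"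
    using B(1) topological_basis_imp_subbasis by blast
qed

context
  fixes M :: "'b measure" and f :: "'b \<Rightarrow> 'a::{real_normed_vector,complete_space,second_countable_topology}"
begin

lemma integrable_copy_iff: "integrable M (\<lambda>x. to_copy (f x)) \<longleftrightarrow> integrable M f"
  using integrable_bounded_linear[OF bounded_linear_to_copy, of M f]
    integrable_bounded_linear[OF bounded_linear_of_copy, of M "\<lambda>x. to_copy (f x)"] by auto

lemma integral_copy: "integral\<^sup>L M f = of_copy (integral\<^sup>L M (\<lambda>x. to_copy (f x)))"
proof (cases "integrable M f")
  case True
  from integral_bounded_linear[OF bounded_linear_to_copy this] show ?thesis by simp
next
  case False
  then show ?thesis
    by (simp add: not_integrable_integral_eq integrable_copy_iff zero_banach_copy.rep_eq)
qed

lemma borel_measurable_copy: "f \<in> borel_measurable M \<Longrightarrow> (\<lambda>x. to_copy (f x)) \<in> borel_measurable M"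
  by (rule borel_measurable_continuous_onI[OF linear_continuous_on[OF bounded_linear_to_copy], THEN measurable_compose_rev])

lemma norm_copy: "norm (to_copy (f x)) = norm (f x)"
  by (simp add: norm_banach_copy.abs_eq)

lemma integrable_norm_iff_complete:
  "f \<in> borel_measurable M \<Longrightarrow> integrable M (\<lambda>x. norm (f x)) \<longleftrightarrow> integrable M f"
  using integrable_norm_iff[OF borel_measurable_copy] by (simp add: norm_copy integrable_copy_iff)

lemma integral_norm_bound_complete: "norm (integral\<^sup>L M f) \<le> (LINT x|M. norm (f x))"
  unfolding integral_copy using integral_norm_bound[of M "\<lambda>x. to_copy (f x)"]
  by (simp add: norm_banach_copy.abs_eq norm_banach_copy.rep_eq)

lemma integrable_bound_complete:
  fixes g :: "'b \<Rightarrow> real"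
  assumes "integrable M g" "f \<in> borel_measurable M" "AE x in M. norm (f x) \<le> g x"
  shows "integrable M f"
proof (subst integrable_norm_iff_complete[OF assms(2), symmetric], rule Bochner_Integration.integrable_bound[OF assms(1)])
  show "(\<lambda>x. norm (f x)) \<in> borel_measurable M" using assms(2) by measurable
  show "AE x in M. norm (norm (f x)) \<le> norm (g x)" using assms(3) by eventually_elim auto
qed

lemma integrable_restrict_space_complete:
  assumes "\<Omega> \<inter> space M \<in> sets M"
  shows "integrable (restrict_space M \<Omega>) f \<longleftrightarrow> integrable M (\<lambda>x. indicat_real \<Omega> x *\<^sub>R f x)"
proof -
  have "integrable (restrict_space M \<Omega>) f \<longleftrightarrow> integrable (restrict_space M \<Omega>) (\<lambda>x. to_copy (f x))"
    using integrable_bounded_linear[OF bounded_linear_to_copy, of "restrict_space M \<Omega>" f]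
      integrable_bounded_linear[OF bounded_linear_of_copy, of "restrict_space M \<Omega>" "\<lambda>x. to_copy (f x)"] by auto
  also have "\<dots> \<longleftrightarrow> integrable M (\<lambda>x. to_copy (indicat_real \<Omega> x *\<^sub>R f x))"
    using integrable_restrict_space[OF assms, of "\<lambda>x. to_copy (f x)"]
    by (simp add: linear_scale[OF bounded_linear.linear[OF bounded_linear_to_copy]])
  also have "\<dots> \<longleftrightarrow> integrable M (\<lambda>x. indicat_real \<Omega> x *\<^sub>R f x)"
    using integrable_bounded_linear[OF bounded_linear_to_copy, of M "\<lambda>x. indicat_real \<Omega> x *\<^sub>R f x"]
      integrable_bounded_linear[OF bounded_linear_of_copy, of M "\<lambda>x. to_copy (indicat_real \<Omega> x *\<^sub>R f x)"] by auto
  finally show ?thesis .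
qed

end

lemma integral_restrict_space_complete:
  fixes f :: "'b \<Rightarrow> 'a::{real_normed_vector,complete_space,second_countable_topology}"
  assumes "\<Omega> \<inter> space M \<in> sets M"
  shows "integral\<^sup>L (restrict_space M \<Omega>) f = (LINT x|M. indicat_real \<Omega> x *\<^sub>R f x)"
  unfolding integral_copy[of "restrict_space M \<Omega>" f] integral_copy[of M "\<lambda>x. indicat_real \<Omega> x *\<^sub>R f x"]
  by (simp add: integral_restrict_space[OF assms] linear_scale[OF bounded_linear.linear[OF bounded_linear_to_copy]])

lemma cauchy_L1_AE_cauchy_subseq_complete:
  fixes s :: "nat \<Rightarrow> 'b \<Rightarrow> 'a::{real_normed_vector,complete_space,second_countable_topology}"
  assumes "\<And>n. integrable M (s n)"
    and "\<And>e. 0 < e \<Longrightarrow> \<exists>N. \<forall>i\<ge>N. \<forall>j\<ge>N. (LINT x|M. norm (s i x - s j x)) < e"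
  obtains r where "strict_mono r" "AE x in M. Cauchy (\<lambda>i. s (r i) x)"
proof (rule cauchy_L1_AE_cauchy_subseq[of M "\<lambda>n x. to_copy (s n x)"])
  show "integrable M (\<lambda>x. to_copy (s n x))" for n using assms(1) by (simp add: integrable_copy_iff)
  have eq: "norm (to_copy a - to_copy b) = norm (a - b)" for a b :: 'a
    by (simp add: minus_banach_copy.abs_eq norm_banach_copy.abs_eq)
  show "\<exists>N. \<forall>i\<ge>N. \<forall>j\<ge>N. (LINT x|M. norm (to_copy (s i x) - to_copy (s j x))) < e" if "0 < e" for e
    unfolding eq by (rule assms(2)[OF that])
  fix r :: "nat \<Rightarrow> nat" assume r: "strict_mono r" "AE x in M. Cauchy (\<lambda>i. to_copy (s (r i) x))"
  have "Cauchy (\<lambda>i. to_copy (s (r i) x)) \<longleftrightarrow> Cauchy (\<lambda>i. s (r i) x)" for x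
    by (simp add: Cauchy_def dist_banach_copy.abs_eq)
  then show thesis using r by (intro that[OF r(1)]) simp
qed

section \<open>Uniform boundedness and finite-dimensional projections\<close>

text \<open>Strong continuity of a semigroup at 0 controls only individual orbits; this principle
  makes it a norm bound near 0. A point with unbounded images is built by steps of length at most 4
  to the power -n.\<close>

lemma uniform_boundedness_seq:
  fixes A :: "nat \<Rightarrow> ('a::{real_normed_vector,complete_space} \<Rightarrow>\<^sub>L 'b::real_normed_vector)"
  assumes "\<And>x. Bseq (\<lambda>n. A n x)"
  shows "Bseq A"
proof (rule ccontr)
  assume "\<not> Bseq A"
  then have "\<exists>k. norm (A k) > 12 * 4 ^ n * real (Suc n)" for n
    unfolding Bseq_def using not_le by (metis (no_types, opaque_lifting) mult_pos_pos of_nat_0_less_iff zero_less_Suc zero_less_numeral zero_less_power)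
  then obtain k where k: "\<And>n. norm (A (k n)) > 12 * 4 ^ n * real (Suc n)" by metis
  text \<open>Gliding hump: among \<open>x + \<xi>\<close> and \<open>x - \<xi>\<close> one has an image of norm at least \<open>norm (T \<xi>)\<close>.\<close>
  have step: "\<exists>x'. norm (x' - x) \<le> r \<and> norm (T x') \<ge> r * norm T / 2" if "r > 0" for r x and T :: "'a \<Rightarrow>\<^sub>L 'b"
  proof -
    have "\<exists>\<xi>. norm \<xi> \<le> r \<and> norm (T \<xi>) \<ge> r * norm T / 2"
    proof (rule ccontr)
      assume n: "\<not> ?thesis"
      have "norm T \<le> norm T / 2"
      proof (rule norm_blinfun_bound)
        fix x
        show "norm (T x) \<le> norm T / 2 * norm x"
        proof (cases "x = 0")
          case False
          have "norm ((r / norm x) *\<^sub>R x) \<le> r" using that False by simp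
          then have "norm (T ((r / norm x) *\<^sub>R x)) < r * norm T / 2" using n not_le by blast
          then have "r * norm (T x) < norm T / 2 * norm x * r" using that False
            by (simp add: blinfun.scaleR_right field_simps)
          then show ?thesis using that by (simp add: mult.commute)
        qed simp
      qed simp
      then have "T = 0" by simp
      moreover have "norm (0::'a) \<le> r" using that by simp
      ultimately show False using n by (metis mult_zero_right norm_zero order_refl div_0 blinfun.zero_right)
    qed
    then obtain \<xi> where \<xi>: "norm \<xi> \<le> r" "norm (T \<xi>) \<ge> r * norm T / 2" by blast
    have "2 * norm (T \<xi>) \<le> norm (T (x + \<xi>)) + norm (T (x - \<xi>))"
      using norm_triangle_ineq4[of "T (x + \<xi>)" "T (x - \<xi>)"]
      by (simp add: blinfun.add_right blinfun.diff_right flip: scaleR_2)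
    then have "norm (T (x + \<xi>)) \<ge> r * norm T / 2 \<or> norm (T (x - \<xi>)) \<ge> r * norm T / 2" using \<xi>(2) by linarith
    then show ?thesis using \<xi>(1) by (elim disjE) (force intro: exI[of _ "x + \<xi>"] exI[of _ "x - \<xi>"])+
  qed
  have "\<exists>x. \<forall>n. True \<and> (norm (x (Suc n) - x n) \<le> (1/4) ^ n \<and> norm (A (k n) (x (Suc n))) \<ge> (1/4) ^ n * norm (A (k n)) / 2)"
    by (rule dependent_nat_choice) (use step in auto)
  then obtain x where x: "\<And>n. norm (x (Suc n) - x n) \<le> (1/4) ^ n"
    "\<And>n. norm (A (k n) (x (Suc n))) \<ge> (1/4) ^ n * norm (A (k n)) / 2" by blast
  have dist: "norm (x (m + n) - x m) \<le> (4/3) * (1/4) ^ m" for m n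
  proof -
    have "norm (x (m + n) - x m) \<le> (4/3) * (1/4) ^ m - (4/3) * (1/4) ^ (m + n)" for n
    proof (induction n)
      case (Suc n)
      have "norm (x (m + Suc n) - x m) \<le> norm (x (Suc (m + n)) - x (m + n)) + norm (x (m + n) - x m)"
        using norm_triangle_ineq[of "x (Suc (m + n)) - x (m + n)" "x (m + n) - x m"] by simp
      then show ?case using Suc x(1)[of "m + n"] by (simp add: power_add)
    qed simp
    moreover have "(0::real) \<le> (4/3) * (1/4) ^ (m + n)" by simp
    ultimately show ?thesis by (smt (verit))
  qed
  have "Cauchy x"
  proof (rule metric_CauchyI)
    fix e :: real assume e: "e > 0"
    have "(\<lambda>m. (8/3) * (1/4) ^ m :: real) \<longlonglongrightarrow> (8/3) * 0"
      by (intro tendsto_mult tendsto_const LIMSEQ_realpow_zero) auto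
    then obtain m where "(8/3) * (1/4) ^ m < e"
      using order_tendstoD(2)[of _ "(8/3) * (0::real)" sequentially e] e
      by (metis (no_types, lifting) eventually_sequentially mult_zero_right order_refl)
    have b: "norm (x i - x m) \<le> (4/3) * (1/4) ^ m" if "i \<ge> m" for i
      using dist[where m = m and n = "i - m"] that by simp
    have "dist (x i) (x j) < e" if "i \<ge> m" "j \<ge> m" for i j
      using b[OF that(1)] b[OF that(2)] \<open>(8/3) * (1/4) ^ m < e\<close> norm_triangle_ineq4[of "x i - x m" "x j - x m"]
      by (simp add: dist_norm)
    then show "\<exists>M. \<forall>m\<ge>M. \<forall>n\<ge>M. dist (x m) (x n) < e" by blast
  qed
  then obtain l where l: "x \<longlonglongrightarrow> l" by (meson Cauchy_convergent_iff convergent_def)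
  have lm: "norm (l - x m) \<le> (4/3) * (1/4) ^ m" for m
  proof (rule Lim_bounded[where M = 0])
    show "(\<lambda>n. norm (x (n + m) - x m)) \<longlonglongrightarrow> norm (l - x m)"
      by (intro tendsto_intros LIMSEQ_ignore_initial_segment l)
    show "\<forall>n\<ge>0. norm (x (n + m) - x m) \<le> (4/3) * (1/4) ^ m" by (intro allI impI) (metis add.commute dist)
  qed
  \<comment> \<open>Let P be \<open>(1/4) ^ n * norm (A (k n))\<close>. The hump gives P/2 and the
    later steps move the image by at most P/3, so P/6 survives; the factor 12 in the choice of
    \<open>k\<close> makes this at least 2 (n + 1).\<close>
  have big: "norm (A (k n) l) \<ge> real (Suc n)" for n
  proof -
    have "norm (A (k n) (x (Suc n) - l)) \<le> norm (A (k n)) * ((4/3) * (1/4) ^ Suc n)"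
      using lm[of "Suc n"] by (intro order.trans[OF norm_blinfun] mult_left_mono) (auto simp: norm_minus_commute)
    moreover have "norm (A (k n) (x (Suc n))) \<le> norm (A (k n) l) + norm (A (k n) (x (Suc n) - l))"
      using norm_triangle_ineq[of "A (k n) l" "A (k n) (x (Suc n) - l)"] by (simp add: blinfun.diff_right)
    ultimately have *: "norm (A (k n) (x (Suc n))) \<le> norm (A (k n) l) + norm (A (k n)) * ((4/3) * (1/4) ^ Suc n)" by linarith
    have "norm (A (k n) l) \<ge> (1/4) ^ n * norm (A (k n)) / 6"
    proof -
      define P where "P = (1/4) ^ n * norm (A (k n))"
      have "norm (A (k n)) * ((4/3) * (1/4) ^ Suc n) = P / 3" by (simp add: P_def)
      moreover note * x(2)[of n, folded P_def]
      ultimately show ?thesis unfolding P_def[symmetric] by linarith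
    qed
    moreover have "(1/4) ^ n * (12 * 4 ^ n * real (Suc n)) / 6 \<le> (1/4) ^ n * norm (A (k n)) / 6"
      using k[of n] by (intro divide_right_mono mult_left_mono) auto
    ultimately have "(1/4) ^ n * (12 * 4 ^ n * real (Suc n)) / 6 \<le> norm (A (k n) l)" by (rule order.trans[rotated])
    moreover have "(1/4) ^ n * (12 * 4 ^ n * real (Suc n)) / 6 = 2 * real (Suc n)"
      by (simp add: power_one_over)
    ultimately show ?thesis by simp
  qed
  obtain c where c: "\<And>n. norm (A n l) \<le> c" using assms[of l] by (auto simp: Bseq_def)
  obtain n where "c < real n" using reals_Archimedean2 by blast
  then show False using big[of n] c[of "k n"] by simp
qed

lemma compact_operatorI_compact:
  fixes K :: "'a::real_normed_vector \<Rightarrow>\<^sub>L 'b::real_normed_vector"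
  assumes "compact C" "K ` cball 0 1 \<subseteq> C"
  shows "compact_operator K"
proof -
  have "closure (K ` cball 0 1) \<subseteq> C" using assms compact_imp_closed by (intro closure_minimal) auto
  then have "closure (K ` cball 0 1) = C \<inter> closure (K ` cball 0 1)" by blast
  then show ?thesis unfolding compact_operator_def using assms(1) by (metis closed_closure compact_Int_closed)
qed

section \<open>Orthogonal projections of finite rank\<close>

lemma finite_dim_subspace_projection:
  fixes M :: "'a::real_inner set"
  assumes "finite_dim_subspace M"
  obtains P :: "'a \<Rightarrow>\<^sub>L 'a" where "\<And>x. P x \<in> M" "\<And>x m. m \<in> M \<Longrightarrow> inner (x - P x) m = 0"
    "compact_operator P" "\<And>x. orth_proj M x = P x"
proof -
  obtain E where E: "finite E" "M = span E" using assms by (auto simp: finite_dim_subspace_def)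
  obtain C where C: "finite C" "span C = M" "pairwise orthogonal C" using basis_orthogonal[OF E(1)] E(2) by blast
  \<comment> \<open>The orthogonal family \<open>C\<close> may contain 0. Since division by 0 gives
    0 and the vector itself is 0, that summand vanishes, and the identities below hold for it as
    well.\<close>
  define p where "p x = (\<Sum>c\<in>C. (inner x c / (norm c)\<^sup>2) *\<^sub>R c)" for x
  have "bounded_linear p"
    unfolding p_def divide_inverse by (intro bounded_linear_intros bounded_linear_sum)
  then have P: "Blinfun p x = p x" for x by (simp add: bounded_linear_Blinfun_apply)
  have pM: "p x \<in> M" for x
    unfolding p_def C(2)[symmetric] by (intro span_sum span_scale span_base)
  have pC: "inner (x - p x) d = 0" if "d \<in> C" for x d
  proof -
    have "inner (p x) d = (\<Sum>c\<in>C. if c = d then inner x d else 0)"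
      unfolding p_def inner_sum_left
    proof (rule sum.cong)
      fix c assume "c \<in> C"
      then show "inner ((inner x c / (norm c)\<^sup>2) *\<^sub>R c) d = (if c = d then inner x d else 0)"
        using C(3) that by (auto simp: pairwise_def orthogonal_def power2_norm_eq_inner)
    qed simp
    also have "\<dots> = inner x d" using C(1) that by simp
    finally show ?thesis by (simp add: inner_diff_left)
  qed
  have perp: "inner (x - p x) m = 0" if "m \<in> M" for x m
    using that unfolding C(2)[symmetric]
    by (induction rule: span_induct_alt) (simp_all add: inner_add_right pC)
  have op: "orth_proj M x = p x" for x
    unfolding orth_proj_def
  proof (rule the_equality)
    fix y assume y: "y \<in> M \<and> (\<forall>m\<in>M. inner (x - y) m = 0)"
    have "y - p x \<in> M" using y pM unfolding E(2) by (intro span_diff) auto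
    then have "inner (x - p x) (y - p x) = 0" "inner (x - y) (y - p x) = 0" using y perp by auto
    then have "inner (y - p x) (y - p x) = 0" by (simp add: inner_diff_left)
    then show "y = p x" by simp
  qed (use pM perp in auto)
  \<comment> \<open>Combinations with coefficients in a box form a compact set, by adding one
    segment at a time. The coefficients of p x for x in the unit ball are bounded by
    Cauchy-Schwarz.\<close>
  have "\<exists>K. compact K \<and> (\<forall>a. (\<forall>c\<in>C. \<bar>a c\<bar> \<le> b) \<longrightarrow> (\<Sum>c\<in>C. a c *\<^sub>R c) \<in> K)" for b :: real
    using C(1)
  proof (induction C)
    case empty
    show ?case by (intro exI[of _ "{0}"]) auto
  next
    case (insert d C)
    then obtain K where K: "compact K" "\<And>a. (\<forall>c\<in>C. \<bar>a c\<bar> \<le> b) \<Longrightarrow> (\<Sum>c\<in>C. a c *\<^sub>R c) \<in> K" by blast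
    have "compact ((\<lambda>s. s *\<^sub>R d) ` {-b..b})" by (intro compact_continuous_image continuous_intros) auto
    from compact_sums[OF this K(1)] show ?case
    proof (intro exI conjI allI impI)
      fix a assume a: "\<forall>c\<in>insert d C. \<bar>a c\<bar> \<le> b"
      have "a d \<in> {-b..b}" using a by (auto simp: abs_le_iff)
      moreover have "(\<Sum>c\<in>C. a c *\<^sub>R c) \<in> K" using a by (intro K(2)) auto
      ultimately show "(\<Sum>c\<in>insert d C. a c *\<^sub>R c) \<in> {x + y |x y. x \<in> (\<lambda>s. s *\<^sub>R d) ` {-b..b} \<and> y \<in> K}"
        using insert(1,2) by (intro CollectI exI[of _ "a d *\<^sub>R d"] exI[of _ "\<Sum>c\<in>C. a c *\<^sub>R c"]) auto
    qed
  qed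
  then obtain K where K: "compact K" "\<And>a. (\<forall>c\<in>C. \<bar>a c\<bar> \<le> (\<Sum>c\<in>C. 1 / norm c)) \<Longrightarrow> (\<Sum>c\<in>C. a c *\<^sub>R c) \<in> K"
    by blast
  have "compact_operator (Blinfun p)"
  proof (rule compact_operatorI_compact[OF K(1)], clarsimp simp: P)
    fix x :: 'a assume x: "norm x \<le> 1"
    show "p x \<in> K"
      unfolding p_def
    proof (rule K(2), intro ballI)
      fix c assume c: "c \<in> C"
      have "\<bar>inner x c\<bar> \<le> norm x * norm c" by (rule Cauchy_Schwarz_ineq2)
      also have "\<dots> \<le> 1 * norm c" by (intro mult_right_mono x) auto
      finally have "\<bar>inner x c\<bar> \<le> norm c" by simp
      then have "\<bar>inner x c / (norm c)\<^sup>2\<bar> \<le> norm c / (norm c)\<^sup>2" by (simp add: divide_right_mono)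
      also have "\<dots> = 1 / norm c" by (simp add: power2_eq_square)
      also have "\<dots> \<le> (\<Sum>c\<in>C. 1 / norm c)" using C(1) c by (intro member_le_sum) auto
      finally show "\<bar>inner x c / (norm c)\<^sup>2\<bar> \<le> (\<Sum>c\<in>C. 1 / norm c)" .
    qed
  qed
  then show thesis using pM perp op by (intro that[of "Blinfun p"]) (auto simp: P)
qed

section \<open>Compact semigroups and convolutions\<close>

lemma C0_semigroup_add:
  "C0_semigroup S \<Longrightarrow> 0 \<le> s \<Longrightarrow> 0 \<le> t \<Longrightarrow> S (s + t) = S s o\<^sub>L S t"
  by (simp add: C0_semigroup_def)

lemma C0_semigroup_tendsto:
  fixes S :: "real \<Rightarrow> 'x::real_normed_vector \<Rightarrow>\<^sub>L 'x"
  assumes "C0_semigroup S" "\<And>n. 0 \<le> h n" "h \<longlonglongrightarrow> 0"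
  shows "(\<lambda>n. S (h n) x) \<longlonglongrightarrow> x"
proof -
  have "((\<lambda>t. S t x) \<longlongrightarrow> S 0 x) (at 0 within {0..})"
    using assms(1) by (simp add: C0_semigroup_def at_within_Ici_at_right)
  then have "continuous (at 0 within {0..}) (\<lambda>t. S t x)" by (simp add: continuous_within)
  then have "(\<lambda>n. S (h n) x) \<longlonglongrightarrow> S 0 x"
    using assms(2,3) by (intro continuous_within_tendsto_compose[of 0 "{0..}" "\<lambda>t. S t x"]) (auto intro: always_eventually)
  then show ?thesis using assms(1) by (simp add: C0_semigroup_def)
qed

text \<open>Without a bound near 0 there would be times \<open>h n\<close> tending to 0 with norm (S
  (h n)) > n, although \<open>S (h n) x\<close> converges for every x. The semigroup law then
  spreads the bound from [0, d] to [0, T].\<close>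

lemma C0_semigroup_bounded:
  fixes S :: "real \<Rightarrow> 'x::{real_normed_vector,complete_space} \<Rightarrow>\<^sub>L 'x"
  assumes "C0_semigroup S"
  obtains M where "M \<ge> 1" "\<And>t. 0 \<le> t \<Longrightarrow> t \<le> T \<Longrightarrow> norm (S t) \<le> M"
proof -
  have "\<exists>N. \<forall>t. 0 \<le> t \<and> t \<le> 1 / real (Suc N) \<longrightarrow> norm (S t) \<le> real N"
  proof (rule ccontr)
    assume "\<not> ?thesis"
    then have "\<exists>t. 0 \<le> t \<and> t \<le> 1 / real (Suc N) \<and> norm (S t) > real N" for N
      using not_le by blast
    then obtain h where h: "\<And>n. 0 \<le> h n" "\<And>n. h n \<le> 1 / real (Suc n)" "\<And>n. norm (S (h n)) > real n" by metis
    have "h \<longlonglongrightarrow> 0"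
      by (rule tendsto_sandwich[OF _ _ tendsto_const LIMSEQ_Suc[OF lim_1_over_n]])
        (intro always_eventually allI h(1), intro always_eventually allI h(2))
    from C0_semigroup_tendsto[OF assms h(1) this] have "Bseq (\<lambda>n. S (h n) x)" for x
      by (intro convergent_imp_Bseq convergentI)
    then have "Bseq (\<lambda>n. S (h n))" by (rule uniform_boundedness_seq)
    then obtain c where c: "\<And>n. norm (S (h n)) \<le> c" by (auto simp: Bseq_def)
    obtain n where "c < real n" using reals_Archimedean2 by blast
    then show False using c[of n] h(3)[of n] by simp
  qed
  then obtain N where N: "\<And>t. 0 \<le> t \<Longrightarrow> t \<le> 1 / real (Suc N) \<Longrightarrow> norm (S t) \<le> real N" by blast
  define d where "d = 1 / real (Suc N)"
  have d: "d > 0" by (simp add: d_def)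
  define C where "C = max 1 (real N)"
  have C: "C \<ge> 1" "\<And>t. 0 \<le> t \<Longrightarrow> t \<le> d \<Longrightarrow> norm (S t) \<le> C"
    using N by (auto simp: C_def d_def intro: le_max_iff_disj[THEN iffD2])
  have pw: "norm (S t) \<le> C ^ Suc k" if "0 \<le> t" "t \<le> real (Suc k) * d" for t k
    using that
  proof (induction k arbitrary: t)
    case 0
    then show ?case using C by simp
  next
    case (Suc k)
    show ?case
    proof (cases "t \<le> d")
      case True
      have "norm (S t) \<le> C" using C Suc True by simp
      also have "\<dots> \<le> C ^ Suc (Suc k)" using C(1) by (intro self_le_power) auto
      finally show ?thesis .
    next
      case False
      have "S t = S d o\<^sub>L S (t - d)" using C0_semigroup_add[OF assms, of d "t - d"] d False by simp
      then have "norm (S t) \<le> norm (S d) * norm (S (t - d))" by (simp add: norm_blinfun_compose)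
      also have "\<dots> \<le> C * C ^ Suc k"
        using C d False Suc.prems by (intro mult_mono Suc.IH) (auto simp: algebra_simps)
      finally show ?thesis by simp
    qed
  qed
  obtain k :: nat where k: "T / d < real k" using reals_Archimedean2 by blast
  show thesis
  proof (rule that[of "C ^ Suc k"])
    show "1 \<le> C ^ Suc k" using C(1) by (rule one_le_power)
    show "norm (S t) \<le> C ^ Suc k" if "0 \<le> t" "t \<le> T" for t
    proof (rule pw[OF that(1)])
      have "T < real k * d" using k d by (simp add: field_simps)
      also have "\<dots> \<le> real (Suc k) * d" using d by (intro mult_right_mono) auto
      finally show "t \<le> real (Suc k) * d" using that by simp
    qed
  qed
qed

text \<open>Strong convergence of a norm-bounded family is uniform on compact sets; a sequence
  violating this would accumulate at a point \<open>l\<close> where strong continuity fails.\<close>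

lemma C0_semigroup_uniform_on_compact:
  fixes S :: "real \<Rightarrow> 'x::{real_normed_vector,complete_space} \<Rightarrow>\<^sub>L 'x"
  assumes "C0_semigroup S" "compact K" "e > 0"
  shows "\<exists>d>0. \<forall>h x. 0 \<le> h \<longrightarrow> h < d \<longrightarrow> x \<in> K \<longrightarrow> norm (S h x - x) < e"
proof (rule ccontr)
  assume "\<not> ?thesis"
  then have "\<exists>h x. 0 \<le> h \<and> h < 1 / real (Suc n) \<and> x \<in> K \<and> e \<le> norm (S h x - x)" for n
    by (metis not_le of_nat_0_less_iff zero_less_Suc zero_less_divide_1_iff)
  then obtain h x where hx: "\<And>n. 0 \<le> h n" "\<And>n. h n < 1 / real (Suc n)" "\<And>n. x n \<in> K" "\<And>n. e \<le> norm (S (h n) (x n) - x n)"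
    by metis
  obtain M where M: "M \<ge> 1" "\<And>t. 0 \<le> t \<Longrightarrow> t \<le> 1 \<Longrightarrow> norm (S t) \<le> M" using C0_semigroup_bounded[OF assms(1), of 1] by blast
  obtain r l where r: "strict_mono r" "(x \<circ> r) \<longlonglongrightarrow> l"
    using assms(2)[unfolded compact_def, rule_format, of x] hx(3) by metis
  have xl: "(\<lambda>n. x (r n)) \<longlonglongrightarrow> l" using r(2) by (simp add: comp_def)
  have "h \<longlonglongrightarrow> 0"
    by (rule tendsto_sandwich[OF _ _ tendsto_const LIMSEQ_Suc[OF lim_1_over_n]])
      (intro always_eventually allI hx(1), intro always_eventually allI less_imp_le[OF hx(2)])
  then have "(\<lambda>n. h (r n)) \<longlonglongrightarrow> 0" using LIMSEQ_subseq_LIMSEQ[OF _ r(1)] by (auto simp: comp_def)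
  from C0_semigroup_tendsto[OF assms(1) hx(1) this] have Sl: "(\<lambda>n. S (h (r n)) l) \<longlonglongrightarrow> l" .
  have "(\<lambda>n. (M + 1) * norm (x (r n) - l) + norm (S (h (r n)) l - l)) \<longlonglongrightarrow> (M + 1) * norm (l - l) + norm (l - l)"
    by (intro tendsto_intros xl Sl)
  then have "eventually (\<lambda>n. (M + 1) * norm (x (r n) - l) + norm (S (h (r n)) l - l) < e) sequentially"
    using assms(3) by (intro order_tendstoD) auto
  then obtain n where n: "(M + 1) * norm (x (r n) - l) + norm (S (h (r n)) l - l) < e"
    by (meson eventually_happens' sequentially_bot)
  have h1: "h (r n) \<le> 1" using hx(2)[of "r n"] by (smt (verit) divide_le_eq_1 of_nat_0_less_iff of_nat_Suc of_nat_0_le_iff zero_less_Suc)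
  have "S (h (r n)) (x (r n)) - x (r n) = S (h (r n)) (x (r n) - l) + (S (h (r n)) l - l) - (x (r n) - l)"
    by (simp add: blinfun.diff_right)
  also have "norm \<dots> \<le> norm (S (h (r n)) (x (r n) - l)) + norm (S (h (r n)) l - l) + norm (x (r n) - l)"
    by (intro order.trans[OF norm_triangle_ineq4] add_mono norm_triangle_ineq order_refl)
  also have "\<dots> \<le> M * norm (x (r n) - l) + norm (S (h (r n)) l - l) + norm (x (r n) - l)"
    using M(2)[OF hx(1) h1] by (intro add_mono order.trans[OF norm_blinfun] mult_right_mono) auto
  also have "\<dots> < e" using n by (simp add: algebra_simps)
  finally show False using hx(4)[of "r n"] by simp
qed

lemma C0_semigroup_strongly_continuous:
  fixes S :: "real \<Rightarrow> 'x::{real_normed_vector,complete_space} \<Rightarrow>\<^sub>L 'x"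
  assumes "C0_semigroup S"
  shows "continuous_on {0..T} (\<lambda>t. S t x)"
  unfolding continuous_on_iff
proof (intro ballI allI impI)
  fix t e :: real assume t: "t \<in> {0..T}" and e: "e > 0"
  obtain M where M: "M \<ge> 1" "\<And>t. 0 \<le> t \<Longrightarrow> t \<le> T \<Longrightarrow> norm (S t) \<le> M" using C0_semigroup_bounded[OF assms] by blast
  obtain d where d: "d > 0" "\<And>h. 0 \<le> h \<Longrightarrow> h < d \<Longrightarrow> norm (S h x - x) < e / M"
    using C0_semigroup_uniform_on_compact[OF assms, of "{x}" "e / M"] e M(1) by auto
  have main: "norm (S q x - S p x) < e" if "0 \<le> p" "p \<le> q" "q \<le> T" "q - p < d" for p q
  proof -
    have "S q x - S p x = S p (S (q - p) x - x)"
      using C0_semigroup_add[OF assms, of p "q - p"] that by (simp add: blinfun.diff_right)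
    also have "norm \<dots> \<le> M * norm (S (q - p) x - x)"
      using M(2)[of p] that by (intro order.trans[OF norm_blinfun] mult_right_mono) auto
    also have "\<dots> < M * (e / M)" using d(2)[of "q - p"] that M(1) by (intro mult_strict_left_mono) auto
    finally show ?thesis using M(1) by simp
  qed
  show "\<exists>d>0. \<forall>x'\<in>{0..T}. dist x' t < d \<longrightarrow> dist (S x' x) (S t x) < e"
  proof (intro exI[of _ d] conjI ballI impI d(1))
    fix s assume "s \<in> {0..T}" "dist s t < d"
    then show "dist (S s x) (S t x) < e"
      using main[of s t] main[of t s] t by (cases "s \<le> t") (auto simp: dist_norm norm_minus_commute)
  qed
qed

text \<open>With a = t/2, the factor \<open>S a\<close> maps the unit ball into a compact set, on
  which strong continuity at 0 is uniform. Factoring S q as S (p - a) S (q - p) S a turns this into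
  continuity in operator norm.\<close>

lemma C0_semigroup_norm_continuous:
  fixes S :: "real \<Rightarrow> 'x::{real_normed_vector,complete_space} \<Rightarrow>\<^sub>L 'x"
  assumes "C0_semigroup S" "\<forall>t>0. compact_operator (S t)"
  shows "continuous_on {0<..} S"
  unfolding continuous_on_iff
proof (intro ballI allI impI)
  fix t e :: real assume t: "t \<in> {0<..}" and e: "e > 0"
  define a where "a = t / 2"
  have a: "a > 0" "a < t" using t by (auto simp: a_def)
  obtain M where M: "M \<ge> 1" "\<And>s. 0 \<le> s \<Longrightarrow> s \<le> t + 1 \<Longrightarrow> norm (S s) \<le> M" using C0_semigroup_bounded[OF assms(1)] by blast
  obtain C where C: "compact C" "S a ` cball 0 1 \<subseteq> C"
    using compact_operator_image[of "S a" 1] assms(2) a(1) by blast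
  obtain d where d: "d > 0" "\<And>h x. 0 \<le> h \<Longrightarrow> h < d \<Longrightarrow> x \<in> C \<Longrightarrow> norm (S h x - x) < e / (2 * M)"
    using C0_semigroup_uniform_on_compact[OF assms(1) C(1), of "e / (2 * M)"] e M(1) by auto
  have main: "norm (S q - S p) < e" if "a \<le> p" "p \<le> q" "q \<le> t + 1" "q - p < d" for p q
  proof -
    have "norm (S q - S p) \<le> e / 2"
    proof (rule norm_blinfun_bound)
      fix x
      show "norm ((S q - S p) x) \<le> e / 2 * norm x"
      proof (cases "x = 0")
        case False
        define y where "y = (1 / norm x) *\<^sub>R x"
        have y: "S a y \<in> C" using C(2) False by (auto simp: y_def)
        have "S q = S (p - a) o\<^sub>L (S (q - p) o\<^sub>L S a)" "S p = S (p - a) o\<^sub>L S a"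
          using C0_semigroup_add[OF assms(1), of "p - a" "q - p + a"] C0_semigroup_add[OF assms(1), of "q - p" a]
            C0_semigroup_add[OF assms(1), of "p - a" a] that a by (auto simp: algebra_simps)
        then have "norm ((S q - S p) y) = norm (S (p - a) (S (q - p) (S a y) - S a y))"
          by (simp add: blinfun.diff_left blinfun.diff_right)
        also have "\<dots> \<le> M * norm (S (q - p) (S a y) - S a y)"
          using M(2)[of "p - a"] that a by (intro order.trans[OF norm_blinfun] mult_right_mono) auto
        also have "\<dots> \<le> M * (e / (2 * M))"
          using d(2)[of "q - p" "S a y"] y that M(1) by (intro mult_left_mono) auto
        also have "\<dots> = e / 2" using M(1) by simp
        finally have "norm ((S q - S p) y) * norm x \<le> e / 2 * norm x" by (intro mult_right_mono) auto
        moreover have "norm ((S q - S p) y) * norm x = norm ((S q - S p) x)"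
          using False by (simp add: y_def blinfun.scaleR_right)
        ultimately show ?thesis by simp
      qed simp
    qed (use e in simp)
    then show ?thesis using e by simp
  qed
  show "\<exists>d>0. \<forall>x'\<in>{0<..}. dist x' t < d \<longrightarrow> dist (S x') (S t) < e"
  proof (intro exI[of _ "min d (min a 1)"] conjI ballI impI)
    fix s assume "s \<in> {0<..}" "dist s t < min d (min a 1)"
    then have "\<bar>s - t\<bar> < d" "\<bar>s - t\<bar> < a" "\<bar>s - t\<bar> < 1" by (auto simp: dist_real_def)
    moreover have "t = a + a" by (simp add: a_def)
    ultimately have "a \<le> s" "s \<le> t + 1" "\<bar>s - t\<bar> < d" by linarith+
    then show "dist (S s) (S t) < e"
      using main[of s t] main[of t s] a by (cases "s \<le> t") (auto simp: dist_norm norm_minus_commute)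
  qed (use a d in auto)
qed

text \<open>The assumptions are those inherited by the family of adjoints, so that forward and
  backward convolutions share one theory. Norm continuity away from 0 takes the place of strong
  continuity at 0.\<close>

locale compact_semigroup =
  fixes R :: "real \<Rightarrow> 'x::{real_inner,complete_space,second_countable_topology} \<Rightarrow>\<^sub>L 'x" and T M :: real
  assumes T_pos: "0 < T"
    and bound: "\<And>t. 0 \<le> t \<Longrightarrow> t \<le> T \<Longrightarrow> norm (R t) \<le> M"
    and semigroup: "\<And>s t. 0 \<le> s \<Longrightarrow> 0 \<le> t \<Longrightarrow> R (s + t) = R s o\<^sub>L R t"
    and norm_cont: "continuous_on {0<..} R"
    and cpt: "\<And>t. 0 < t \<Longrightarrow> compact_operator (R t)"

lemma C0_compact_semigroup:
  fixes S :: "real \<Rightarrow> 'x::{real_inner,complete_space,second_countable_topology} \<Rightarrow>\<^sub>L 'x"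
  assumes "C0_semigroup S" "\<forall>t>0. compact_operator (S t)" "0 < T"
  obtains M where "compact_semigroup S T M"
proof -
  obtain M where M: "M \<ge> 1" "\<And>t. 0 \<le> t \<Longrightarrow> t \<le> T \<Longrightarrow> norm (S t) \<le> M" using C0_semigroup_bounded[OF assms(1)] by blast
  have "compact_semigroup S T M"
    using assms M C0_semigroup_add[OF assms(1)] C0_semigroup_norm_continuous[OF assms(1,2)] by unfold_locales auto
  then show thesis by (rule that)
qed

lemma compact_semigroup_adjoint:
  assumes "compact_semigroup S T M"
  shows "compact_semigroup (\<lambda>t. hilbert_adjoint (S t)) T M"
proof -
  interpret compact_semigroup S T M by fact
  show ?thesis
  proof
    show "norm (hilbert_adjoint (S t)) \<le> M" if "0 \<le> t" "t \<le> T" for t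
      using bound[OF that] norm_hilbert_adjoint_le order.trans by blast
    show "hilbert_adjoint (S (s + t)) = hilbert_adjoint (S s) o\<^sub>L hilbert_adjoint (S t)" if "0 \<le> s" "0 \<le> t" for s t
      using semigroup[OF that(2,1)] by (simp add: add.commute hilbert_adjoint_compose)
    show "continuous_on {0<..} (\<lambda>t. hilbert_adjoint (S t))"
      unfolding continuous_on_iff
    proof (intro ballI allI impI)
      fix t e :: real assume "t \<in> {0<..}" "e > 0"
      then obtain d where d: "d > 0" "\<And>s. s \<in> {0<..} \<Longrightarrow> dist s t < d \<Longrightarrow> dist (S s) (S t) < e"
        using norm_cont unfolding continuous_on_iff by metis
      have "dist (hilbert_adjoint (S s)) (hilbert_adjoint (S t)) \<le> dist (S s) (S t)" for s
        by (simp add: dist_norm norm_hilbert_adjoint_le flip: hilbert_adjoint_diff)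
      then show "\<exists>d>0. \<forall>x'\<in>{0<..}. dist x' t < d \<longrightarrow> dist (hilbert_adjoint (S x')) (hilbert_adjoint (S t)) < e"
        using d by (meson le_less_trans)
    qed
  qed (use T_pos cpt compact_operator_hilbert_adjoint in auto)
qed

lemma integrable_norm_complete:
  fixes f :: "'b \<Rightarrow> 'a::{real_normed_vector,complete_space,second_countable_topology}"
  shows "integrable M f \<Longrightarrow> integrable M (\<lambda>x. norm (f x))"
  using integrable_norm_iff_complete[of f M] by auto

lemma borel_measurable_blinfun_apply:
  fixes A :: "'a::real_normed_vector \<Rightarrow>\<^sub>L 'b::real_normed_vector"
  shows "blinfun_apply A \<in> borel_measurable borel"
  by (rule borel_measurable_continuous_onI[OF linear_continuous_on[OF blinfun.bounded_linear_right]])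

text \<open>Cutting off at t \<le> 0 makes forward and backward convolutions integrals over the same
  fixed interval. The value 0 at t = 0 alters integrands at one point only, but it also makes an
  adjoint orbit vanish at the final time.\<close>

definition kern :: "(real \<Rightarrow> 'x::real_normed_vector \<Rightarrow>\<^sub>L 'x) \<Rightarrow> real \<Rightarrow> 'x \<Rightarrow>\<^sub>L 'x" where
  "kern R t = (if t > 0 then R t else 0)"

text \<open>For \<open>a = 1\<close> this is the convolution \<open>\<integral>\<^sub>0\<^sup>t R (t - s) w s ds\<close>, for \<open>a = -1\<close> the backward
  convolution \<open>\<integral>\<^sub>t\<^sup>T R (s - t) w s ds\<close>.\<close>

definition conv :: "(real \<Rightarrow> 'x::{real_inner,complete_space,second_countable_topology} \<Rightarrow>\<^sub>L 'x) \<Rightarrow> real \<Rightarrow> real \<Rightarrow> (real \<Rightarrow> 'x) \<Rightarrow> real \<Rightarrow> 'x" where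
  "conv R T a w t = (LINT s|lebesgue_on {0..T}. kern R (a * (t - s)) (w s))"

lemma finite_measure_lebesgue_on_interval: "finite_measure (lebesgue_on {0..T::real})"
  by (rule finite_measure_lebesgue_on) simp

lemma integrable_const_lebesgue_on: "integrable (lebesgue_on {0..T::real}) (\<lambda>_. c :: real)"
  by (rule finite_measure.integrable_const[OF finite_measure_lebesgue_on_interval])

lemma integrable_bounded_lebesgue_on:
  fixes f :: "real \<Rightarrow> 'a::{real_normed_vector,complete_space,second_countable_topology}"
  assumes "f \<in> borel_measurable (lebesgue_on {0..T})" "\<And>s. s \<in> {0..T} \<Longrightarrow> norm (f s) \<le> C"
  shows "integrable (lebesgue_on {0..T}) f"
proof (rule integrable_bound_complete[where g = "\<lambda>_. C"])
  show "integrable (lebesgue_on {0..T}) (\<lambda>_. C)"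
    using integrable_const_lebesgue_on by blast
  show "AE x in lebesgue_on {0..T}. norm (f x) \<le> C" using assms(2) by (intro AE_I2) simp
qed (rule assms(1))

lemma integral_const_lebesgue_on: "0 \<le> T \<Longrightarrow> (LINT s|lebesgue_on {0..T::real}. c) = T * (c::real)"
  by (simp add: measure_restrict_space)

lemma integral_mono_lebesgue_on:
  fixes f g :: "real \<Rightarrow> real"
  assumes "integrable (lebesgue_on {0..T}) f" "integrable (lebesgue_on {0..T}) g"
    "\<And>s. s \<in> {0..T} \<Longrightarrow> f s \<le> g s"
  shows "(LINT s|lebesgue_on {0..T}. f s) \<le> (LINT s|lebesgue_on {0..T}. g s)"
  by (rule Bochner_Integration.integral_mono[OF assms(1,2)]) (use assms(3) in simp)

lemma integral_indicator_lebesgue_on_le: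
  assumes "c \<le> d"
  shows "(LINT s|lebesgue_on {0..T}. indicat_real {c..d} s) \<le> d - c"
    and "integrable (lebesgue_on {0..T}) (indicat_real {c..d})"
proof -
  have m: "{c..d} \<inter> {0..T} \<in> lmeasurable" by (intro fmeasurable_Int_fmeasurable) auto
  have "(LINT s|lebesgue_on {0..T}. indicat_real {c..d} s) = measure (lebesgue_on {0..T}) ({c..d} \<inter> {0..T})"
    by (subst Bochner_Integration.integral_indicator) (simp add: space_restrict_space)
  also have "\<dots> = measure lebesgue ({c..d} \<inter> {0..T})" by (subst measure_restrict_space) auto
  also have "\<dots> \<le> measure lebesgue {c..d}" by (intro measure_mono_fmeasurable) auto
  finally show "(LINT s|lebesgue_on {0..T}. indicat_real {c..d} s) \<le> d - c" using assms by simp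
  show "integrable (lebesgue_on {0..T}) (indicat_real {c..d})"
  proof (rule integrable_bounded_lebesgue_on[where C = 1])
    have "indicat_real {c..d} \<in> borel_measurable lebesgue" by (intro borel_measurable_indicator) auto
    then show "indicat_real {c..d} \<in> borel_measurable (lebesgue_on {0..T})" by (rule measurable_restrict_space1)
  qed (simp add: indicator_def)
qed

section \<open>Compactness properties of convolutions and orbits\<close>

context compact_semigroup
begin

abbreviation "\<mu> \<equiv> lebesgue_on {0..T}"

lemma M_nonneg: "0 \<le> M"
  using order.trans[OF norm_ge_zero bound[of 0]] T_pos by simp

lemma norm_kern_le: "t \<le> T \<Longrightarrow> norm (kern R t) \<le> M"
  using bound[of t] M_nonneg by (simp add: kern_def)

lemma norm_kern_apply_le: "t \<le> T \<Longrightarrow> norm (kern R t x) \<le> M * norm x"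
  by (rule order.trans[OF norm_blinfun mult_right_mono[OF norm_kern_le]]) auto

text \<open>Norm continuity makes (t, x) \<mapsto> R t x jointly continuous on the open set t > 0,
  and the kernel is 0 elsewhere.\<close>

lemma borel_measurable_kern:
  assumes "f \<in> borel_measurable N" "g \<in> borel_measurable N"
  shows "(\<lambda>s. kern R (f s) (g s)) \<in> borel_measurable N"
proof -
  have "(\<lambda>p. if p \<in> {0<..} \<times> UNIV then R (fst p) (snd p) else 0) \<in> borel_measurable (borel :: (real \<times> 'x) measure)"
  proof (rule borel_measurable_continuous_on_if)
    show "{0<..} \<times> UNIV \<in> sets (borel :: (real \<times> 'x) measure)" by (intro borel_open open_Times) auto
    show "continuous_on ({0<..} \<times> (UNIV :: 'x set)) (\<lambda>p. R (fst p) (snd p))"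
      by (intro continuous_intros continuous_on_compose2[OF norm_cont continuous_on_fst[OF continuous_on_id]]) auto
  qed auto
  moreover have "(\<lambda>s. (f s, g s)) \<in> N \<rightarrow>\<^sub>M borel"
    using assms by (simp add: borel_prod[symmetric])
  ultimately have "(\<lambda>s. if (f s, g s) \<in> {0<..} \<times> UNIV then R (fst (f s, g s)) (snd (f s, g s)) else 0) \<in> borel_measurable N"
    by (rule measurable_compose_rev)
  also have "(\<lambda>s. if (f s, g s) \<in> {0<..} \<times> UNIV then R (fst (f s, g s)) (snd (f s, g s)) else 0) = (\<lambda>s. kern R (f s) (g s))"
    by (auto simp: kern_def fun_eq_iff)
  finally show ?thesis .
qed

lemma borel_measurable_id_lebesgue_on: "(\<lambda>s::real. s) \<in> borel_measurable (lebesgue_on A)"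
  by (intro measurable_restrict_space1 measurable_completion) simp

lemma borel_measurable_kern_shift:
  "w \<in> borel_measurable \<mu> \<Longrightarrow> (\<lambda>s. kern R (a * (t - s) - c) (w s)) \<in> borel_measurable \<mu>"
  using borel_measurable_id_lebesgue_on[of "{0..T}"]
  by (intro borel_measurable_kern borel_measurable_diff borel_measurable_times borel_measurable_const) auto

lemma shift_le: "\<bar>a\<bar> = 1 \<Longrightarrow> t \<in> {0..T} \<Longrightarrow> s \<in> {0..T} \<Longrightarrow> a * (t - s) \<le> T"
  by (auto simp: abs_if split: if_splits)

lemma integrable_kern_shift:
  assumes "\<bar>a\<bar> = 1" "t \<in> {0..T}" "integrable \<mu> w" "0 \<le> c"
  shows "integrable \<mu> (\<lambda>s. kern R (a * (t - s) - c) (w s))"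
proof (rule integrable_bound_complete)
  show "integrable \<mu> (\<lambda>s. M * norm (w s))" using assms(3) by (intro integrable_mult_right integrable_norm_complete)
  show "AE s in \<mu>. norm (kern R (a * (t - s) - c) (w s)) \<le> M * norm (w s)"
  proof (rule AE_I2)
    fix s assume "s \<in> space \<mu>"
    then have "a * (t - s) - c \<le> T" using shift_le[OF assms(1,2), of s] assms(4) by simp
    then show "norm (kern R (a * (t - s) - c) (w s)) \<le> M * norm (w s)" by (rule norm_kern_apply_le)
  qed
qed (use assms(3) in \<open>auto intro!: borel_measurable_kern_shift\<close>)

lemma integrable_kern:
  "\<bar>a\<bar> = 1 \<Longrightarrow> t \<in> {0..T} \<Longrightarrow> integrable \<mu> w \<Longrightarrow> integrable \<mu> (\<lambda>s. kern R (a * (t - s)) (w s))"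
  using integrable_kern_shift[where c = 0] by simp

lemma norm_conv_le:
  assumes "\<bar>a\<bar> = 1" "t \<in> {0..T}" "integrable \<mu> w"
  shows "norm (conv R T a w t) \<le> M * (LINT s|\<mu>. norm (w s))"
proof -
  have "norm (conv R T a w t) \<le> (LINT s|\<mu>. norm (kern R (a * (t - s)) (w s)))"
    unfolding conv_def by (rule integral_norm_bound_complete)
  also have "\<dots> \<le> (LINT s|\<mu>. M * norm (w s))"
    using integrable_kern[OF assms] assms
    by (intro integral_mono_lebesgue_on norm_kern_apply_le shift_le integrable_mult_right integrable_norm_complete) auto
  finally show ?thesis using assms(3) by simp
qed

lemma conv_diff:
  assumes "\<bar>a\<bar> = 1" "t \<in> {0..T}" "integrable \<mu> w" "integrable \<mu> v"
  shows "conv R T a (\<lambda>s. w s - v s) t = conv R T a w t - conv R T a v t"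
  unfolding conv_def blinfun.diff_right
  by (intro Bochner_Integration.integral_diff integrable_kern assms)

lemma conv_add:
  assumes "\<bar>a\<bar> = 1" "t \<in> {0..T}" "integrable \<mu> w" "integrable \<mu> v"
  shows "conv R T a (\<lambda>s. w s + v s) t = conv R T a w t + conv R T a v t"
  unfolding conv_def blinfun.add_right
  by (intro Bochner_Integration.integral_add integrable_kern assms)

lemma conv_scaleR: "conv R T a (\<lambda>s. c *\<^sub>R w s) t = c *\<^sub>R conv R T a w t"
  unfolding conv_def blinfun.scaleR_right by (rule Bochner_Integration.integral_scaleR_right)

text \<open>Where the time lag exceeds \<open>\<eta>\<close> the factor \<open>R \<eta>\<close> can
  be pulled out of the integral, leaving a point in the compact image of a ball. The lags below
  \<open>\<eta>\<close> contribute little.\<close>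

lemma conv_near_compact:
  assumes a: "\<bar>a\<bar> = 1" and t: "t \<in> {0..T}" and e: "e > 0"
  shows "\<exists>K. compact K \<and> (\<forall>w. w \<in> borel_measurable \<mu> \<longrightarrow> (\<forall>s\<in>{0..T}. norm (w s) \<le> C) \<longrightarrow>
           (\<exists>k\<in>K. dist (conv R T a w t) k < e))"
proof -
  define C' where "C' = \<bar>C\<bar> + 1"
  have C': "C' > 0" by (simp add: C'_def)
  have half: "(e / 2) * (M / (M + 1)) \<le> e / 2"
    using M_nonneg e mult_left_mono[of "M / (M + 1)" 1 "e / 2"] by simp
  \<comment> \<open>The omitted lags occupy an interval of length at most 2 \<open>\<eta>\<close>,
    with integrand at most M * C'; the choice makes their integral at most e/2. Using M + 1 avoids
    division by 0.\<close>
  define \<eta> where "\<eta> = min T (e / (4 * (M + 1) * C'))"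
  have \<eta>: "\<eta> > 0" "\<eta> \<le> T" "\<eta> \<le> e / (4 * (M + 1) * C')" using T_pos e M_nonneg C' by (auto simp: \<eta>_def)
  obtain K where K: "compact K" "R \<eta> ` cball 0 (M * (T * C')) \<subseteq> K"
    using compact_operator_image[OF cpt[OF \<eta>(1)]] .
  show ?thesis
  proof (intro exI[of _ K] conjI K(1) allI impI)
    fix w :: "real \<Rightarrow> 'x" assume w: "w \<in> borel_measurable \<mu>" "\<forall>s\<in>{0..T}. norm (w s) \<le> C"
    have wC: "norm (w s) \<le> C'" if "s \<in> {0..T}" for s using w(2) that by (force simp: C'_def)
    have wi: "integrable \<mu> w" using w by (intro integrable_bounded_lebesgue_on[where C = C]) auto
    define z where "z = (LINT s|\<mu>. kern R (a * (t - s) - \<eta>) (w s))"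
    have iz: "integrable \<mu> (\<lambda>s. kern R (a * (t - s) - \<eta>) (w s))" using \<eta> by (intro integrable_kern_shift a t wi) auto
    have "norm z \<le> (LINT s|\<mu>. norm (kern R (a * (t - s) - \<eta>) (w s)))"
      unfolding z_def by (rule integral_norm_bound_complete)
    also have "\<dots> \<le> (LINT s|\<mu>. M * C')"
    proof (rule integral_mono_lebesgue_on)
      fix s assume s: "s \<in> {0..T}"
      have "norm (kern R (a * (t - s) - \<eta>) (w s)) \<le> M * norm (w s)"
        using shift_le[OF a t s] \<eta>(1) by (intro norm_kern_apply_le) auto
      also have "\<dots> \<le> M * C'" using wC[OF s] M_nonneg by (intro mult_left_mono)
      finally show "norm (kern R (a * (t - s) - \<eta>) (w s)) \<le> M * C'" .
    qed (use iz integrable_norm_complete[OF iz] integrable_const_lebesgue_on in auto)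
    also have "\<dots> = M * (T * C')" using T_pos by (subst integral_const_lebesgue_on) auto
    finally have zK: "R \<eta> z \<in> K" using K(2) by auto
    have Rz: "R \<eta> z = (LINT s|\<mu>. R \<eta> (kern R (a * (t - s) - \<eta>) (w s)))"
      unfolding z_def by (rule integral_bounded_linear[OF blinfun.bounded_linear_right iz, symmetric])
    have iRz: "integrable \<mu> (\<lambda>s. R \<eta> (kern R (a * (t - s) - \<eta>) (w s)))"
      by (rule integrable_bounded_linear[OF blinfun.bounded_linear_right iz])
    have eq: "conv R T a w t - R \<eta> z = (LINT s|\<mu>. kern R (a * (t - s)) (w s) - R \<eta> (kern R (a * (t - s) - \<eta>) (w s)))"
      by (simp only: Bochner_Integration.integral_diff[OF integrable_kern[OF a t wi] iRz] Rz conv_def)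
    have "norm (conv R T a w t - R \<eta> z) \<le> (LINT s|\<mu>. norm (kern R (a * (t - s)) (w s) - R \<eta> (kern R (a * (t - s) - \<eta>) (w s))))"
      unfolding eq by (rule integral_norm_bound_complete)
    also have "\<dots> \<le> (LINT s|\<mu>. (M * C') * indicat_real {t - \<eta>..t + \<eta>} s)"
    proof (rule integral_mono_lebesgue_on)
      have d: "integrable \<mu> (\<lambda>s. kern R (a * (t - s)) (w s) - R \<eta> (kern R (a * (t - s) - \<eta>) (w s)))"
        by (rule Bochner_Integration.integrable_diff[OF integrable_kern[OF a t wi] iRz])
      show "integrable \<mu> (\<lambda>s. norm (kern R (a * (t - s)) (w s) - R \<eta> (kern R (a * (t - s) - \<eta>) (w s))))"
        by (rule integrable_norm_complete[OF d])
      have le: "t - \<eta> \<le> t + \<eta>" using \<eta> by simp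
      show "integrable \<mu> (\<lambda>s. (M * C') * indicat_real {t - \<eta>..t + \<eta>} s)"
        by (rule integrable_mult_right[OF integral_indicator_lebesgue_on_le(2)[OF le]])
      fix s assume s: "s \<in> {0..T}"
      let ?\<tau> = "a * (t - s)"
      consider "?\<tau> \<le> 0" | "?\<tau> > \<eta>" | "0 < ?\<tau>" "?\<tau> \<le> \<eta>" by linarith
      then show "norm (kern R ?\<tau> (w s) - R \<eta> (kern R (?\<tau> - \<eta>) (w s))) \<le> (M * C') * indicat_real {t - \<eta>..t + \<eta>} s"
      proof cases
        case 1
        then show ?thesis using \<eta> M_nonneg C' by (simp add: kern_def)
      next
        case 2
        then have "R ?\<tau> = R \<eta> o\<^sub>L R (?\<tau> - \<eta>)" using semigroup[of \<eta> "?\<tau> - \<eta>"] \<eta> by simp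
        then show ?thesis using 2 \<eta> M_nonneg C' by (simp add: kern_def)
      next
        case 3
        have "norm (kern R ?\<tau> (w s)) \<le> M * norm (w s)" using shift_le[OF a t s] by (rule norm_kern_apply_le)
        also have "\<dots> \<le> M * C'" using wC[OF s] M_nonneg by (intro mult_left_mono)
        finally have "norm (kern R ?\<tau> (w s)) \<le> M * C'" .
        moreover have "s \<in> {t - \<eta>..t + \<eta>}" using 3 a \<eta>(1) by (auto simp: abs_if split: if_splits)
        ultimately show ?thesis using 3 by (simp add: kern_def)
      qed
    qed
    also have "\<dots> \<le> (M * C') * (2 * \<eta>)"
      using integral_indicator_lebesgue_on_le(1)[of "t - \<eta>" "t + \<eta>" T] \<eta> M_nonneg C'
      by (simp add: mult_left_mono)
    also have "\<dots> \<le> (M * C') * (2 * (e / (4 * (M + 1) * C')))"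
      using \<eta> M_nonneg C' by (intro mult_left_mono) auto
    also have "\<dots> = (e / 2) * (M / (M + 1))"
    proof -
      have "(M * C') * (2 * (e / (4 * x * C'))) = (e / 2) * (M / x)" if "x > 0" for x
        using that C' by (simp add: field_simps)
      from this[of "M + 1"] show ?thesis using M_nonneg by simp
    qed
    also have "\<dots> < e"
      by (rule le_less_trans[OF half]) (use e in simp)
    finally have "dist (conv R T a w t) (R \<eta> z) < e" by (simp add: dist_norm)
    then show "\<exists>k\<in>K. dist (conv R T a w t) k < e" using zK by blast
  qed
qed

text \<open>If both lags exceed \<open>\<eta>\<close>, uniform continuity of R on
  [\<open>\<eta>\<close>, T] applies; if both are nonpositive, the kernel is 0. Otherwise s lies
  within 2 \<open>\<eta>\<close> of t, an interval of small length.\<close>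

lemma conv_equicontinuous:
  assumes a: "\<bar>a\<bar> = 1" and e: "e > 0"
  shows "\<exists>d>0. \<forall>w. w \<in> borel_measurable \<mu> \<longrightarrow> (\<forall>s\<in>{0..T}. norm (w s) \<le> C) \<longrightarrow>
     (\<forall>t\<in>{0..T}. \<forall>t'\<in>{0..T}. \<bar>t - t'\<bar> < d \<longrightarrow> dist (conv R T a w t) (conv R T a w t') < e)"
proof -
  define C' where "C' = \<bar>C\<bar> + 1"
  have C': "C' > 0" by (simp add: C'_def)
  have half: "(e / 2) * (M / (M + 1)) \<le> e / 2"
    using M_nonneg e mult_left_mono[of "M / (M + 1)" 1 "e / 2"] by simp
  \<comment> \<open>The short lags cost 2 M C' on length 4 \<open>\<eta>\<close>, hence at most e/2;
    \<open>\<omega>\<close> is chosen so that the long lags cost T C' \<open>\<omega>\<close> =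
    e/4.\<close>
  define \<eta> where "\<eta> = e / (16 * (M + 1) * C')"
  have \<eta>: "\<eta> > 0" using e M_nonneg C' by (auto simp: \<eta>_def)
  define \<omega> where "\<omega> = e / (4 * T * C')"
  have \<omega>: "\<omega> > 0" using e T_pos C' by (auto simp: \<omega>_def)
  have "uniformly_continuous_on {\<eta>..T} R"
    using \<eta> by (intro compact_uniformly_continuous continuous_on_subset[OF norm_cont]) auto
  then obtain d where d: "d > 0" "\<And>p q. \<lbrakk>p \<in> {\<eta>..T}; q \<in> {\<eta>..T}; \<bar>p - q\<bar> < d\<rbrakk> \<Longrightarrow> norm (R p - R q) < \<omega>"
    using \<omega> unfolding uniformly_continuous_on_def dist_norm real_norm_def by metis
  show ?thesis
  proof (intro exI[of _ "min d \<eta>"] conjI allI impI ballI)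
    show "0 < min d \<eta>" using d \<eta> by simp
    fix w :: "real \<Rightarrow> 'x" and t t' assume w: "w \<in> borel_measurable \<mu>" "\<forall>s\<in>{0..T}. norm (w s) \<le> C"
      and t: "t \<in> {0..T}" and t': "t' \<in> {0..T}" and tt: "\<bar>t - t'\<bar> < min d \<eta>"
    have wC: "norm (w s) \<le> C'" if "s \<in> {0..T}" for s using w(2) that by (force simp: C'_def)
    have wi: "integrable \<mu> w" using w by (intro integrable_bounded_lebesgue_on[where C = C]) auto
    note ik = integrable_kern[OF a t wi] integrable_kern[OF a t' wi]
    have eq: "conv R T a w t - conv R T a w t' = (LINT s|\<mu>. kern R (a * (t - s)) (w s) - kern R (a * (t' - s)) (w s))"
      by (simp only: Bochner_Integration.integral_diff[OF ik] conv_def)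
    have "norm (conv R T a w t - conv R T a w t') \<le> (LINT s|\<mu>. norm (kern R (a * (t - s)) (w s) - kern R (a * (t' - s)) (w s)))"
      unfolding eq by (rule integral_norm_bound_complete)
    also have "\<dots> \<le> (LINT s|\<mu>. C' * \<omega> + (2 * M * C') * indicat_real {t - 2 * \<eta>..t + 2 * \<eta>} s)"
    proof (rule integral_mono_lebesgue_on)
      show "integrable \<mu> (\<lambda>s. norm (kern R (a * (t - s)) (w s) - kern R (a * (t' - s)) (w s)))"
        by (rule integrable_norm_complete[OF Bochner_Integration.integrable_diff[OF ik]])
      show "integrable \<mu> (\<lambda>s. C' * \<omega> + (2 * M * C') * indicat_real {t - 2 * \<eta>..t + 2 * \<eta>} s)"
        using \<eta> by (intro Bochner_Integration.integrable_add[OF integrable_const_lebesgue_on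
              integrable_mult_right[OF integral_indicator_lebesgue_on_le(2)]]) auto
      fix s assume s: "s \<in> {0..T}"
      define p where "p = a * (t - s)"
      define q where "q = a * (t' - s)"
      have pq: "\<bar>p - q\<bar> < d" "\<bar>p - q\<bar> < \<eta>" "p \<le> T" "q \<le> T"
        using tt a shift_le[OF a t s] shift_le[OF a t' s] by (auto simp: p_def q_def abs_if algebra_simps split: if_splits)
      have nn: "0 \<le> C' * \<omega>" "0 \<le> 2 * M * C'" using C' \<omega> M_nonneg by auto
      consider "p > \<eta>" "q > \<eta>" | "p \<le> 0" "q \<le> 0" | "\<bar>p\<bar> \<le> 2 * \<eta>" using pq \<eta> by linarith
      then show "norm (kern R (a * (t - s)) (w s) - kern R (a * (t' - s)) (w s)) \<le> C' * \<omega> + (2 * M * C') * indicat_real {t - 2 * \<eta>..t + 2 * \<eta>} s"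
        unfolding p_def[symmetric] q_def[symmetric]
      proof cases
        case 1
        have "norm ((R p - R q) (w s)) \<le> norm (R p - R q) * norm (w s)" by (rule norm_blinfun)
        also have "\<dots> \<le> \<omega> * C'"
          using d(2)[of p q] 1 pq wC[OF s] \<omega> by (intro mult_mono) auto
        finally have "norm (kern R p (w s) - kern R q (w s)) \<le> C' * \<omega>"
          using 1 \<eta> by (simp add: kern_def blinfun.diff_left mult.commute)
        moreover have "0 \<le> (2 * M * C') * indicat_real {t - 2 * \<eta>..t + 2 * \<eta>} s" using C' M_nonneg by simp
        ultimately show "norm (kern R p (w s) - kern R q (w s)) \<le> C' * \<omega> + (2 * M * C') * indicat_real {t - 2 * \<eta>..t + 2 * \<eta>} s"
          by linarith
      next
        case 2
        then show "norm (kern R p (w s) - kern R q (w s)) \<le> C' * \<omega> + (2 * M * C') * indicat_real {t - 2 * \<eta>..t + 2 * \<eta>} s"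
          using nn by (simp add: kern_def)
      next
        case 3
        have "s \<in> {t - 2 * \<eta>..t + 2 * \<eta>}" using 3 a by (auto simp: p_def abs_if split: if_splits)
        moreover have "norm (kern R p (w s) - kern R q (w s)) \<le> M * norm (w s) + M * norm (w s)"
          using pq by (intro order.trans[OF norm_triangle_ineq4] add_mono norm_kern_apply_le)
        moreover have "M * norm (w s) \<le> M * C'" using wC[OF s] M_nonneg by (intro mult_left_mono)
        ultimately show "norm (kern R p (w s) - kern R q (w s)) \<le> C' * \<omega> + (2 * M * C') * indicat_real {t - 2 * \<eta>..t + 2 * \<eta>} s"
          using nn by simp
      qed
    qed
    also have "\<dots> = T * (C' * \<omega>) + (2 * M * C') * (LINT s|\<mu>. indicat_real {t - 2 * \<eta>..t + 2 * \<eta>} s)"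
    proof -
      have "t - 2 * \<eta> \<le> t + 2 * \<eta>" using \<eta> by simp
      from integrable_mult_right[OF integral_indicator_lebesgue_on_le(2)[OF this]]
      have i: "integrable \<mu> (\<lambda>s. (2 * M * C') * indicat_real {t - 2 * \<eta>..t + 2 * \<eta>} s)" .
      show ?thesis
        unfolding Bochner_Integration.integral_add[OF integrable_const_lebesgue_on i]
        using T_pos by (subst integral_const_lebesgue_on) simp_all
    qed
    also have "\<dots> \<le> T * (C' * \<omega>) + (2 * M * C') * (4 * \<eta>)"
      using integral_indicator_lebesgue_on_le(1)[of "t - 2 * \<eta>" "t + 2 * \<eta>" T] \<eta> M_nonneg C'
      by (intro add_left_mono mult_left_mono) auto
    also have "\<dots> = e / 4 + (e / 2) * (M / (M + 1))"
    proof -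
      have "T * (C' * (e / (4 * T * C'))) + (2 * M * C') * (4 * (e / (16 * x * C'))) = e / 4 + (e / 2) * (M / x)" if "x > 0" for x
        using that C' T_pos by (simp add: field_simps)
      from this[of "M + 1"] show ?thesis using M_nonneg by (simp add: \<omega>_def \<eta>_def)
    qed
    also have "\<dots> < e"
      by (rule le_less_trans[OF add_left_mono[OF half]]) (use e in simp)
    finally show "dist (conv R T a w t) (conv R T a w t') < e" by (simp add: dist_norm)
  qed
qed

lemma continuous_on_conv:
  assumes "\<bar>a\<bar> = 1" "w \<in> borel_measurable \<mu>" "\<And>s. s \<in> {0..T} \<Longrightarrow> norm (w s) \<le> C"
  shows "continuous_on {0..T} (conv R T a w)"
  unfolding continuous_on_iff
proof (intro ballI allI impI)
  fix t e :: real assume t: "t \<in> {0..T}" and e: "0 < e"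
  obtain d where "d > 0" "\<And>t t'. t \<in> {0..T} \<Longrightarrow> t' \<in> {0..T} \<Longrightarrow> \<bar>t - t'\<bar> < d \<Longrightarrow> dist (conv R T a w t) (conv R T a w t') < e"
    using conv_equicontinuous[OF assms(1) e, of C] assms(2,3) by blast
  then show "\<exists>d>0. \<forall>x'\<in>{0..T}. dist x' t < d \<longrightarrow> dist (conv R T a w x') (conv R T a w t) < e"
    using t by (metis dist_real_def)
qed

lemma conv_subseq:
  assumes a: "\<bar>a\<bar> = 1" and w: "\<And>n::nat. w n \<in> borel_measurable \<mu>" "\<And>n s. s \<in> {0..T} \<Longrightarrow> norm (w n s) \<le> C"
  obtains r g where "strict_mono r" "uniform_limit {0..T} (\<lambda>n. conv R T a (w (r n))) g sequentially"
proof (rule arzela_ascoli_subseq[of T "\<lambda>n. conv R T a (w n)"])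
  show "0 \<le> T" using T_pos by simp
  show "\<exists>d>0. \<forall>n. \<forall>s\<in>{0..T}. \<forall>t\<in>{0..T}. \<bar>s - t\<bar> < d \<longrightarrow> dist (conv R T a (w n) s) (conv R T a (w n) t) < e" if "e > 0" for e
    using conv_equicontinuous[OF a that, of C] w by (elim exE conjE) (intro exI conjI allI, assumption, blast)
  show "\<exists>K. compact K \<and> (\<forall>n. \<exists>k\<in>K. dist (conv R T a (w n) t) k < e)" if "t \<in> {0..T}" "e > 0" for t e
    using conv_near_compact[OF a that, of C] w by (elim exE conjE) (intro exI conjI allI, assumption, blast)
qed (rule that)

text \<open>R may fail to be norm continuous at 0. The weight t repairs this, so that orbits of
  varying vectors fit the closed interval required by the Arzela-Ascoli argument.\<close>

lemma continuous_on_weighted: "continuous_on {0..T} (\<lambda>t. t *\<^sub>R R t)"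
  unfolding continuous_on_def
proof
  fix t assume t: "t \<in> {0..T}"
  show "((\<lambda>t. t *\<^sub>R R t) \<longlongrightarrow> t *\<^sub>R R t) (at t within {0..T})"
  proof (cases "t = 0")
    case True
    have "((\<lambda>t. t *\<^sub>R R t) \<longlongrightarrow> 0) (at 0 within {0..T})"
    proof (rule Lim_null_comparison)
      show "\<forall>\<^sub>F x in at 0 within {0..T}. norm (x *\<^sub>R R x) \<le> x * M"
        unfolding eventually_at_filter
        by (intro always_eventually allI impI) (auto intro!: mult_left_mono bound)
      show "((\<lambda>x. x * M) \<longlongrightarrow> 0) (at 0 within {0..T})" by (auto intro!: tendsto_eq_intros)
    qed
    then show ?thesis using True by simp
  next
    case False
    then have "continuous (at t) R" using norm_cont t by (simp add: continuous_on_eq_continuous_at)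
    then have "(R \<longlongrightarrow> R t) (at t within {0..T})"
      by (metis continuous_at continuous_at_imp_continuous_at_within continuous_within)
    then show ?thesis by (intro tendsto_intros)
  qed
qed

text \<open>Arzela-Ascoli applies to the weighted orbits, and the weight is divided out afterwards.
  Time 0 is left out because a bounded sequence of initial vectors need not have a convergent
  subsequence.\<close>

lemma orbit_subseq:
  assumes "\<And>n::nat. norm (\<phi> n) \<le> C"
  obtains r g where "strict_mono r" "\<And>t. 0 < t \<Longrightarrow> t \<le> T \<Longrightarrow> (\<lambda>n. R t (\<phi> (r n))) \<longlonglongrightarrow> g t"
proof -
  have C: "0 \<le> C" using order.trans[OF norm_ge_zero assms] .
  obtain r g where r: "strict_mono r" "uniform_limit {0..T} (\<lambda>n t. (t *\<^sub>R R t) (\<phi> (r n))) g sequentially"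
  proof (rule arzela_ascoli_subseq[of T "\<lambda>n t. (t *\<^sub>R R t) (\<phi> n)"])
    show "0 \<le> T" using T_pos by simp
    fix e :: real assume e: "e > 0"
    have "uniformly_continuous_on {0..T} (\<lambda>t. t *\<^sub>R R t)"
      by (intro compact_uniformly_continuous continuous_on_weighted) auto
    then obtain d where d: "d > 0" "\<And>s t. \<lbrakk>s \<in> {0..T}; t \<in> {0..T}; \<bar>s - t\<bar> < d\<rbrakk> \<Longrightarrow> norm (s *\<^sub>R R s - t *\<^sub>R R t) < e / (C + 1)"
      using e C unfolding uniformly_continuous_on_def dist_norm real_norm_def by (metis add_nonneg_pos divide_pos_pos zero_less_one)
    show "\<exists>d>0. \<forall>n. \<forall>s\<in>{0..T}. \<forall>t\<in>{0..T}. \<bar>s - t\<bar> < d \<longrightarrow> dist ((s *\<^sub>R R s) (\<phi> n)) ((t *\<^sub>R R t) (\<phi> n)) < e"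
    proof (intro exI[of _ d] conjI d(1) allI ballI impI)
      fix n s t assume st: "s \<in> {0..T}" "t \<in> {0..T}" "\<bar>s - t\<bar> < d"
      have "dist ((s *\<^sub>R R s) (\<phi> n)) ((t *\<^sub>R R t) (\<phi> n)) = norm ((s *\<^sub>R R s - t *\<^sub>R R t) (\<phi> n))"
        by (simp add: dist_norm blinfun.diff_left)
      also have "\<dots> \<le> norm (s *\<^sub>R R s - t *\<^sub>R R t) * norm (\<phi> n)" by (rule norm_blinfun)
      also have "\<dots> \<le> e / (C + 1) * C" using d(2)[OF st] assms[of n] e C by (intro mult_mono) auto
      also have "\<dots> = e * (C / (C + 1))" by simp
      also have "\<dots> < e * 1" using e C by (intro mult_strict_left_mono) auto
      finally show "dist ((s *\<^sub>R R s) (\<phi> n)) ((t *\<^sub>R R t) (\<phi> n)) < e" by simp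
    qed
  next
    fix t e :: real assume t: "t \<in> {0..T}" and e: "e > 0"
    show "\<exists>K. compact K \<and> (\<forall>n. \<exists>k\<in>K. dist ((t *\<^sub>R R t) (\<phi> n)) k < e)"
    proof (cases "t = 0")
      case True
      then show ?thesis using e by (intro exI[of _ "{0}"]) simp
    next
      case False
      obtain K where K: "compact K" "R t ` cball 0 C \<subseteq> K" using compact_operator_image[OF cpt[of t]] t False by auto
      have "(t *\<^sub>R R t) (\<phi> n) \<in> (\<lambda>x. t *\<^sub>R x) ` K" for n
      proof -
        have "R t (\<phi> n) \<in> K" using K(2) assms[of n] by auto
        then show ?thesis unfolding blinfun.scaleR_left by (rule imageI)
      qed
      then show ?thesis using e compact_scaling[OF K(1), of t] by (metis dist_self)
    qed
  qed (rule that)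
  show thesis
  proof (rule that[OF r(1)])
    fix t assume t: "0 < t" "t \<le> T"
    from tendsto_uniform_limitI[OF r(2), of t] t have "(\<lambda>n. (t *\<^sub>R R t) (\<phi> (r n))) \<longlonglongrightarrow> g t" by simp
    then have "(\<lambda>n. (1/t) *\<^sub>R (t *\<^sub>R R t) (\<phi> (r n))) \<longlonglongrightarrow> (1/t) *\<^sub>R g t" by (intro tendsto_intros)
    then show "(\<lambda>n. R t (\<phi> (r n))) \<longlonglongrightarrow> (1/t) *\<^sub>R g t" using t by (simp add: blinfun.scaleR_left)
  qed
qed

end

text \<open>Fubini on the square. Moving \<open>kern S (r - s)\<close> to the second argument turns
  the forward convolution at r into the backward one at s, as r - s = -1 * (s - r). Boundedness of
  \<open>v\<close> gives the integrable majorant M C norm (w s).\<close>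

lemma conv_duality:
  fixes S :: "real \<Rightarrow> 'x::{real_inner,complete_space,second_countable_topology} \<Rightarrow>\<^sub>L 'x"
  assumes S: "compact_semigroup S T M"
    and w: "integrable (lebesgue_on {0..T}) w"
    and v: "v \<in> borel_measurable (lebesgue_on {0..T})" "\<And>s. s \<in> {0..T} \<Longrightarrow> norm (v s) \<le> C"
  shows "(LINT r|lebesgue_on {0..T}. inner (conv S T 1 w r) (v r)) =
         (LINT s|lebesgue_on {0..T}. inner (w s) (conv (\<lambda>t. hilbert_adjoint (S t)) T (-1) v s))"
proof -
  interpret compact_semigroup S T M by fact
  interpret adj: compact_semigroup "\<lambda>t. hilbert_adjoint (S t)" T M by (rule compact_semigroup_adjoint[OF S])
  have fin: "finite_measure \<mu>" by (rule finite_measure_lebesgue_on_interval)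
  interpret pair_sigma_finite \<mu> \<mu>
    unfolding pair_sigma_finite_def using fin by (simp add: finite_measure_def)
  have vi: "integrable \<mu> v" using v by (rule integrable_bounded_lebesgue_on)
  have C0: "0 \<le> C" using order.trans[OF norm_ge_zero v(2)[of 0]] T_pos by simp
  have wm: "w \<in> borel_measurable \<mu>" using w by auto
  have kadj: "inner (kern S t x) y = inner x (kern (\<lambda>t. hilbert_adjoint (S t)) t y)" for t x y
    unfolding kern_def using hilbert_adjoint[of "S t"] by auto
  define F where "F r s = inner (kern S (r - s) (w s)) (v r)" for r s
  have idm: "(\<lambda>s::real. s) \<in> borel_measurable \<mu>" by (rule borel_measurable_id_lebesgue_on)
  have 1: "(\<lambda>p. fst p - snd p) \<in> borel_measurable (\<mu> \<Otimes>\<^sub>M \<mu>)"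
    using measurable_compose[OF measurable_fst idm] measurable_compose[OF measurable_snd idm] by (intro borel_measurable_diff) auto
  have Fm: "(\<lambda>p. F (fst p) (snd p)) \<in> borel_measurable (\<mu> \<Otimes>\<^sub>M \<mu>)"
    unfolding F_def
    by (intro borel_measurable_inner borel_measurable_kern 1 measurable_compose[OF measurable_snd wm] measurable_compose[OF measurable_fst v(1)])
  have Fb: "\<bar>F r s\<bar> \<le> M * C * norm (w s)" if "r \<in> {0..T}" "s \<in> {0..T}" for r s
  proof -
    have "\<bar>F r s\<bar> \<le> norm (kern S (r - s) (w s)) * norm (v r)" unfolding F_def by (rule Cauchy_Schwarz_ineq2)
    also have "\<dots> \<le> (M * norm (w s)) * C"
      using that v(2) M_nonneg C0 by (intro mult_mono norm_kern_apply_le) auto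
    finally show ?thesis by (simp add: mult_ac)
  qed
  have Fi: "integrable \<mu> (F r)" if "r \<in> {0..T}" for r
    unfolding F_def using integrable_kern[of 1 r w] that w by (intro integrable_inner_left) auto
  have Ii: "integrable (\<mu> \<Otimes>\<^sub>M \<mu>) (\<lambda>p. F (fst p) (snd p))"
  proof (rule Fubini_integrable[OF Fm])
    show "AE r in \<mu>. integrable \<mu> (\<lambda>s. F (fst (r, s)) (snd (r, s)))" using Fi by (intro AE_I2) auto
    show "integrable \<mu> (\<lambda>r. LINT s|\<mu>. norm (F (fst (r, s)) (snd (r, s))))"
    proof (rule integrable_bounded_lebesgue_on)
      have "(\<lambda>p. norm (F (fst p) (snd p))) \<in> borel_measurable (\<mu> \<Otimes>\<^sub>M \<mu>)" using Fm by measurable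
      then show "(\<lambda>r. LINT s|\<mu>. norm (F (fst (r, s)) (snd (r, s)))) \<in> borel_measurable \<mu>"
        by (intro sigma_finite_measure.borel_measurable_lebesgue_integral) (use fin in \<open>auto simp: finite_measure_def case_prod_beta'\<close>)
      fix r assume r: "r \<in> {0..T}"
      have "(LINT s|\<mu>. norm (F r s)) \<le> (LINT s|\<mu>. M * C * norm (w s))"
        using Fi[OF r] Fb[OF r] integrable_norm_complete[OF w] by (intro integral_mono_lebesgue_on) auto
      moreover have "0 \<le> (LINT s|\<mu>. norm (F r s))" by (intro integral_nonneg_AE) auto
      ultimately show "norm (LINT s|\<mu>. norm (F (fst (r, s)) (snd (r, s)))) \<le> (LINT s|\<mu>. M * C * norm (w s))" by simp
    qed
  qed
  have "(LINT r|\<mu>. inner (conv S T 1 w r) (v r)) = (LINT r|\<mu>. LINT s|\<mu>. F r s)"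
  proof (rule Bochner_Integration.integral_cong)
    fix r assume "r \<in> space \<mu>"
    then show "inner (conv S T 1 w r) (v r) = (LINT s|\<mu>. F r s)"
      unfolding F_def conv_def using integrable_kern[of 1 r w] w by (subst integral_inner_left) auto
  qed simp
  also have "\<dots> = (LINT s|\<mu>. LINT r|\<mu>. F r s)"
    using Fubini_integral[of F] Ii by (simp add: case_prod_beta')
  also have "\<dots> = (LINT s|\<mu>. inner (w s) (conv (\<lambda>t. hilbert_adjoint (S t)) T (-1) v s))"
  proof (rule Bochner_Integration.integral_cong)
    fix s assume "s \<in> space \<mu>"
    then show "(LINT r|\<mu>. F r s) = inner (w s) (conv (\<lambda>t. hilbert_adjoint (S t)) T (-1) v s)"
      unfolding F_def conv_def kadj using adj.integrable_kern[of "-1" s v] vi by (subst integral_inner_right[symmetric]) auto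
  qed simp
  finally show ?thesis .
qed

section \<open>The adjoint equation and unique continuation\<close>

lemma integral_exp_lebesgue_on:
  assumes "u \<le> v" "k \<noteq> 0"
  shows "(LINT s|lebesgue_on {u..v}. exp (k * s)) = (exp (k * v) - exp (k * u)) / (k::real)"
proof -
  have "((\<lambda>s. exp (k * s)) has_integral exp (k * v) / k - exp (k * u) / k) {u..v}"
  proof (rule fundamental_theorem_of_calculus[OF assms(1)])
    fix x assume "x \<in> {u..v}"
    have "((\<lambda>s. exp (k * s) / k) has_real_derivative exp (k * x)) (at x within {u..v})"
      using assms(2) by (auto intro!: derivative_eq_intros)
    then show "((\<lambda>s. exp (k * s) / k) has_vector_derivative exp (k * x)) (at x within {u..v})"
      by (simp add: has_real_derivative_iff_has_vector_derivative)
  qed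
  moreover have "integrable (lebesgue_on {u..v}) (\<lambda>s. exp (k * s))"
    by (intro continuous_imp_integrable_real continuous_intros)
  ultimately show ?thesis
    by (simp add: lebesgue_integral_eq_integral integral_unique diff_divide_distrib)
qed

lemma borel_measurable_indicator_halfline:
  fixes \<alpha> t :: real
  shows "(\<lambda>s. indicat_real {s. 0 < \<alpha> * (t - s)} s) \<in> borel_measurable (lebesgue_on A)"
proof -
  have "open {s. 0 < \<alpha> * (t - s)}"
    by (rule open_Collect_less) (intro continuous_intros)+
  then have "{s. 0 < \<alpha> * (t - s)} \<in> sets lebesgue" by (simp add: borel_open sets_completionI_sets)
  then show ?thesis by (intro measurable_restrict_space1 borel_measurable_indicator)
qed

lemma integrable_indicator_halfline:
  fixes f :: "real \<Rightarrow> real"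
  assumes "integrable (lebesgue_on {0..T}) f"
  shows "integrable (lebesgue_on {0..T}) (\<lambda>s. indicat_real {s. 0 < \<alpha> * (t - s)} s * f s)"
proof (rule Bochner_Integration.integrable_bound[OF assms])
  show "(\<lambda>s. indicat_real {s. 0 < \<alpha> * (t - s)} s * f s) \<in> borel_measurable (lebesgue_on {0..T})"
    using assms by (intro borel_measurable_times borel_measurable_indicator_halfline) auto
qed (simp add: indicator_def)

text \<open>The half-line cuts out [0, t) or (t, T] according to the sign of
  \<open>\<alpha>\<close>, and the dropped endpoint term has the favourable sign. The rate 2 D
  yields 1 / (2 D), hence a contraction factor 1/2 against the Gronwall constant D.\<close>

lemma integral_exp_halfline_le:
  fixes D :: real
  assumes "\<bar>\<alpha>\<bar> = 1" "D > 0" "t \<in> {0..T}"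
  shows "(LINT s|lebesgue_on {0..T}. indicat_real {s. 0 < \<alpha> * (t - s)} s * exp (2 * D * \<alpha> * s)) \<le> exp (2 * D * \<alpha> * t) / (2 * D)"
proof -
  define u v where "u = (if \<alpha> = 1 then 0 else t)" and "v = (if \<alpha> = 1 then t else T)"
  have uv: "u \<le> v" "{u..v} \<subseteq> {0..T}" using assms(3) by (auto simp: u_def v_def)
  have al: "\<alpha> = 1 \<or> \<alpha> = -1" using assms(1) by auto
  have int: "integrable (lebesgue_on {0..T}) (\<lambda>s. exp (2 * D * \<alpha> * s))"
    by (intro continuous_imp_integrable_real continuous_intros)
  have r: "restrict_space (lebesgue_on {0..T}) {u..v} = lebesgue_on {u..v}"
    using uv by (subst restrict_restrict_space) (auto simp: Int_absorb1)
  have Om: "{u..v} \<inter> space (lebesgue_on {0..T}) \<in> sets (lebesgue_on {0..T})"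
    using uv by (auto simp: sets_restrict_space_iff Int_absorb2)
  have i2: "integrable (lebesgue_on {0..T}) (\<lambda>s. indicat_real {u..v} s *\<^sub>R exp (2 * D * \<alpha> * s))"
    unfolding integrable_restrict_space[OF Om, symmetric] r by (intro continuous_imp_integrable_real continuous_intros)
  have "(LINT s|lebesgue_on {0..T}. indicat_real {s. 0 < \<alpha> * (t - s)} s * exp (2 * D * \<alpha> * s)) \<le>
      (LINT s|lebesgue_on {0..T}. indicat_real {u..v} s *\<^sub>R exp (2 * D * \<alpha> * s))"
  proof (rule integral_mono_lebesgue_on[OF integrable_indicator_halfline[OF int] i2])
    fix s assume "s \<in> {0..T}"
    then have "0 < \<alpha> * (t - s) \<Longrightarrow> s \<in> {u..v}" using al by (auto simp: u_def v_def)
    then show "indicat_real {s. 0 < \<alpha> * (t - s)} s * exp (2 * D * \<alpha> * s) \<le> indicat_real {u..v} s *\<^sub>R exp (2 * D * \<alpha> * s)"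
      by (auto simp: indicator_def)
  qed
  also have "\<dots> = (LINT s|lebesgue_on {u..v}. exp (2 * D * \<alpha> * s))"
    unfolding integral_restrict_space[OF Om, symmetric] r ..
  also have "\<dots> = (exp (2 * D * \<alpha> * v) - exp (2 * D * \<alpha> * u)) / (2 * D * \<alpha>)"
    using assms(2) al by (intro integral_exp_lebesgue_on uv(1)) auto
  also have "\<dots> \<le> exp (2 * D * \<alpha> * t) / (2 * D)"
    using al assms(2) by (auto simp: u_def v_def divide_right_mono minus_divide_left[symmetric] diff_divide_distrib)
  finally show ?thesis .
qed

text \<open>The supremum of the weighted function \<open>a t * exp (- 2 D \<alpha> t)\<close> is at most half of itself plus a constant.\<close>

lemma gronwall_bounded:
  fixes a :: "real \<Rightarrow> real" and D c :: real
  assumes \<alpha>: "\<bar>\<alpha>\<bar> = 1" and D: "D > 0" and c: "0 \<le> c"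
    and a: "a \<in> borel_measurable (lebesgue_on {0..T})" "\<And>s. s \<in> {0..T} \<Longrightarrow> 0 \<le> a s" "\<And>s. s \<in> {0..T} \<Longrightarrow> a s \<le> b"
    and le: "\<And>t. t \<in> {0..T} \<Longrightarrow> a t \<le> c + D * (LINT s|lebesgue_on {0..T}. indicat_real {s. 0 < \<alpha> * (t - s)} s * a s)"
    and t: "t \<in> {0..T}"
  shows "a t \<le> 2 * c * exp (4 * D * T)"
proof -
  define h where "h s = a s * exp (- (2 * D * \<alpha> * s))" for s
  define N where "N = (SUP s\<in>{0..T}. h s)"
  have ex: "exp (- (2 * D * \<alpha> * s)) \<le> exp (2 * D * T)" "exp (2 * D * \<alpha> * s) \<le> exp (2 * D * T)" if "s \<in> {0..T}" for s
  proof -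
    have "\<bar>2 * D * \<alpha> * s\<bar> \<le> 2 * D * T" using D \<alpha> that by (simp add: abs_mult)
    then show "exp (- (2 * D * \<alpha> * s)) \<le> exp (2 * D * T)" "exp (2 * D * \<alpha> * s) \<le> exp (2 * D * T)"
      by (simp_all add: abs_le_iff)
  qed
  have "h s \<le> b * exp (2 * D * T)" if "s \<in> {0..T}" for s
    unfolding h_def using a(2,3)[OF that] ex(1)[OF that] by (intro mult_mono) auto
  then have bd: "bdd_above (h ` {0..T})" by (intro bdd_aboveI2)
  have hN: "h s \<le> N" if "s \<in> {0..T}" for s unfolding N_def by (intro cSUP_upper bd that)
  have ha: "a s = h s * exp (2 * D * \<alpha> * s)" for s by (simp add: h_def mult.assoc flip: exp_add)
  have N0: "0 \<le> N" using order.trans[OF _ hN[OF t]] a(2)[OF t] by (simp add: h_def)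
  have ai: "integrable (lebesgue_on {0..T}) a"
    using a by (intro integrable_bounded_lebesgue_on[where C = b]) auto
  have ei: "integrable (lebesgue_on {0..T}) (\<lambda>s. exp (2 * D * \<alpha> * s))"
    by (intro continuous_imp_integrable_real continuous_intros)
  have "h s \<le> c * exp (2 * D * T) + N / 2" if s: "s \<in> {0..T}" for s
  proof -
    have "(LINT r|lebesgue_on {0..T}. indicat_real {r. 0 < \<alpha> * (s - r)} r * a r) \<le>
       (LINT r|lebesgue_on {0..T}. N * (indicat_real {r. 0 < \<alpha> * (s - r)} r * exp (2 * D * \<alpha> * r)))"
    proof (rule integral_mono_lebesgue_on)
      fix r assume r: "r \<in> {0..T}"
      have "a r \<le> N * exp (2 * D * \<alpha> * r)" unfolding ha[of r] using hN[OF r] by (intro mult_right_mono) auto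
      then show "indicat_real {r. 0 < \<alpha> * (s - r)} r * a r \<le> N * (indicat_real {r. 0 < \<alpha> * (s - r)} r * exp (2 * D * \<alpha> * r))"
        by (auto simp: indicator_def)
    qed (intro integrable_indicator_halfline ai integrable_mult_right ei)+
    also have "\<dots> = N * (LINT r|lebesgue_on {0..T}. indicat_real {r. 0 < \<alpha> * (s - r)} r * exp (2 * D * \<alpha> * r))" by simp
    also have "\<dots> \<le> N * (exp (2 * D * \<alpha> * s) / (2 * D))"
      by (intro mult_left_mono integral_exp_halfline_le \<alpha> D s N0)
    finally have "D * (LINT r|lebesgue_on {0..T}. indicat_real {r. 0 < \<alpha> * (s - r)} r * a r) \<le> D * (N * (exp (2 * D * \<alpha> * s) / (2 * D)))"
      using D by (intro mult_left_mono) auto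
    also have "\<dots> = N / 2 * exp (2 * D * \<alpha> * s)" using D by simp
    finally have "a s \<le> c + N / 2 * exp (2 * D * \<alpha> * s)" using le[OF s] by linarith
    then have "h s \<le> (c + N / 2 * exp (2 * D * \<alpha> * s)) * exp (- (2 * D * \<alpha> * s))"
      unfolding h_def by (intro mult_right_mono) auto
    also have "\<dots> = c * exp (- (2 * D * \<alpha> * s)) + N / 2" by (simp add: distrib_right mult.assoc flip: exp_add)
    also have "\<dots> \<le> c * exp (2 * D * T) + N / 2" using ex(1)[OF s] c by (intro add_right_mono mult_left_mono) auto
    finally show ?thesis .
  qed
  \<comment> \<open>N / 2 can be absorbed because \<open>N\<close> is finite, thanks to the bound
    \<open>b\<close>, which leaves no trace in the result. One factor exp (2 D T) bounds the weight,
    the other undoes it.\<close>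
  then have "N \<le> c * exp (2 * D * T) + N / 2" unfolding N_def using t by (intro cSUP_least) auto
  then have N2: "N \<le> 2 * c * exp (2 * D * T)" by simp
  have "a t \<le> N * exp (2 * D * \<alpha> * t)" unfolding ha[of t] using hN[OF t] by (intro mult_right_mono) auto
  also have "\<dots> \<le> (2 * c * exp (2 * D * T)) * exp (2 * D * T)" using N2 N0 ex(2)[OF t] c by (intro mult_mono) auto
  also have "\<dots> = 2 * c * exp (4 * D * T)" by (simp add: mult.assoc flip: exp_add)
  finally show ?thesis .
qed

lemma borel_measurable_continuous_lebesgue_on:
  fixes y :: "real \<Rightarrow> 'a::{metric_space,second_countable_topology}"
  shows "continuous_on {0..T} y \<Longrightarrow> y \<in> borel_measurable (lebesgue_on {0..T})"
  by (rule continuous_imp_measurable_on_sets_lebesgue) auto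

context compact_semigroup
begin

lemma norm_conv_halfline_le:
  assumes "\<bar>a\<bar> = 1" "t \<in> {0..T}" "integrable \<mu> w"
  shows "norm (conv R T a w t) \<le> M * (LINT s|\<mu>. indicat_real {s. 0 < a * (t - s)} s * norm (w s))"
proof -
  have "norm (conv R T a w t) \<le> (LINT s|\<mu>. norm (kern R (a * (t - s)) (w s)))"
    unfolding conv_def by (rule integral_norm_bound_complete)
  also have "\<dots> \<le> (LINT s|\<mu>. M * (indicat_real {s. 0 < a * (t - s)} s * norm (w s)))"
  proof (rule integral_mono_lebesgue_on)
    show "integrable \<mu> (\<lambda>s. norm (kern R (a * (t - s)) (w s)))"
      by (rule integrable_norm_complete[OF integrable_kern[OF assms]])
    show "integrable \<mu> (\<lambda>s. M * (indicat_real {s. 0 < a * (t - s)} s * norm (w s)))"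
      by (intro integrable_mult_right integrable_indicator_halfline integrable_norm_complete assms)
    fix s assume s: "s \<in> {0..T}"
    show "norm (kern R (a * (t - s)) (w s)) \<le> M * (indicat_real {s. 0 < a * (t - s)} s * norm (w s))"
      using norm_kern_apply_le[OF shift_le[OF assms(1,2) s]] by (auto simp: indicator_def kern_def)
  qed
  finally show ?thesis by simp
qed

text \<open>The two integrands, extended by 0, differ only at s = t, where the mild formula has
  \<open>R 0 (w t)\<close> and the cut-off kernel has 0.\<close>

lemma mild_integral_iff_conv:
  assumes t: "t \<in> {0..T}" and w: "w \<in> borel_measurable \<mu>"
  shows "integrable (lebesgue_on {0..t}) (\<lambda>s. R (t - s) (w s)) \<longleftrightarrow> integrable \<mu> (\<lambda>s. kern R (t - s) (w s))"
    and "integral\<^sup>L (lebesgue_on {0..t}) (\<lambda>s. R (t - s) (w s)) = conv R T 1 w t"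
proof -
  let ?f = "\<lambda>s. indicat_real {0..t} s *\<^sub>R R (t - s) (w s)"
  let ?g = "\<lambda>s. indicat_real {0..T} s *\<^sub>R kern R (t - s) (w s)"
  have km: "(\<lambda>s. kern R (t - s) (w s)) \<in> borel_measurable \<mu>"
    using borel_measurable_kern_shift[OF w, of 1 t 0] by simp
  have g: "?g \<in> borel_measurable lebesgue"
    by (rule borel_measurable_restrict_space_iff[THEN iffD1, OF _ km]) simp
  \<comment> \<open>\<open>w\<close> is known to be measurable on [0, T] with respect to the
    restricted measure; the integrand over [0, t] inherits measurability as the sum of the cut-off
    one and a one-point term.\<close>
  have fg: "?f = (\<lambda>s. ?g s + indicat_real {t} s *\<^sub>R R 0 (w t))"
    using t by (auto simp: fun_eq_iff kern_def indicator_def)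
  have f: "?f \<in> borel_measurable lebesgue"
    unfolding fg by (intro borel_measurable_add[OF g] borel_measurable_scaleR borel_measurable_indicator) auto
  have "AE s in lebesgue. s \<noteq> t" using AE_lborel_singleton[of t] AE_completion by blast
  then have ae: "AE s in lebesgue. ?f s = ?g s" by eventually_elim (use t in \<open>auto simp: kern_def indicator_def\<close>)
  show "integrable (lebesgue_on {0..t}) (\<lambda>s. R (t - s) (w s)) \<longleftrightarrow> integrable \<mu> (\<lambda>s. kern R (t - s) (w s))"
    using integrable_cong_AE[OF f g ae] by (simp add: integrable_restrict_space_complete)
  show "integral\<^sup>L (lebesgue_on {0..t}) (\<lambda>s. R (t - s) (w s)) = conv R T 1 w t"
    using integral_cong_AE[OF f g ae] by (simp add: integral_restrict_space_complete conv_def)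
qed

end

section \<open>Adjoint states and unique continuation\<close>

locale control_system = compact_semigroup S T M
  for S :: "real \<Rightarrow> 'x::{real_inner,complete_space,second_countable_topology} \<Rightarrow>\<^sub>L 'x" and T M :: real +
  fixes B :: "'u::{real_inner,complete_space,second_countable_topology} \<Rightarrow>\<^sub>L 'x"
  assumes approximately_controllable: "\<And>(G :: real \<Rightarrow> 'x \<Rightarrow>\<^sub>L 'x) y0 yf \<epsilon>. L2_on T G \<Longrightarrow> \<epsilon> > 0 \<Longrightarrow>
     \<exists>u y. L2_on T u \<and> mild_solution S B (\<lambda>s z. blinfun_apply (G s) z) T y0 u y \<and> norm (y T - yf) < \<epsilon>"
begin

abbreviation "S_adj \<equiv> \<lambda>t. hilbert_adjoint (S t)"
abbreviation "B_adj \<equiv> hilbert_adjoint B"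

sublocale adj: compact_semigroup S_adj T M
  by (rule compact_semigroup_adjoint) (rule compact_semigroup_axioms)

text \<open>The solution \<open>p t = S(T - t)* \<phi> + \<integral>\<^sub>t\<^sup>T S(s - t)* q s ds\<close> of the backward adjoint equation,
  with the value \<open>0\<close> at \<open>t = T\<close>.\<close>

definition adjoint_state :: "'x \<Rightarrow> (real \<Rightarrow> 'x) \<Rightarrow> real \<Rightarrow> 'x" where
  "adjoint_state \<phi> q t = kern S_adj (T - t) \<phi> + conv S_adj T (-1) q t"

lemma borel_measurable_adjoint_state:
  assumes "q \<in> borel_measurable \<mu>" "\<And>s. s \<in> {0..T} \<Longrightarrow> norm (q s) \<le> C"
  shows "adjoint_state \<phi> q \<in> borel_measurable \<mu>"
  unfolding adjoint_state_def
proof (intro borel_measurable_add adj.borel_measurable_kern)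
  show "conv S_adj T (-1) q \<in> borel_measurable \<mu>"
    by (rule borel_measurable_continuous_lebesgue_on[OF adj.continuous_on_conv[OF _ assms]]) auto
qed (use borel_measurable_id_lebesgue_on in auto)

lemma norm_adjoint_state_le:
  assumes "q \<in> borel_measurable \<mu>" "\<And>s. s \<in> {0..T} \<Longrightarrow> norm (q s) \<le> C" "t \<in> {0..T}"
  shows "norm (adjoint_state \<phi> q t) \<le> M * norm \<phi> + M * (T * C)"
proof -
  have qi: "integrable \<mu> q" using assms by (intro integrable_bounded_lebesgue_on)
  have "norm (conv S_adj T (-1) q t) \<le> M * (LINT s|\<mu>. norm (q s))"
    using qi assms(3) by (intro adj.norm_conv_le) auto
  also have "\<dots> \<le> M * (LINT s|\<mu>. C)"
    using assms(2) qi integrable_const_lebesgue_on M_nonneg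
    by (intro mult_left_mono integral_mono_lebesgue_on integrable_norm_complete) auto
  also have "(LINT s|\<mu>. C) = T * C" using T_pos by (subst integral_const_lebesgue_on) auto
  finally show ?thesis
    unfolding adjoint_state_def using adj.norm_kern_apply_le[of "T - t" \<phi>] assms(3)
    by (intro order.trans[OF norm_triangle_ineq] add_mono) auto
qed

text \<open>This is the integrated form of the derivative of <y, p> for a state y with source w and
  zero initial value. Duality of convolutions replaces differentiation, which mild solutions need
  not allow.\<close>

lemma state_adjoint_pairing:
  assumes w: "integrable \<mu> w" and q: "q \<in> borel_measurable \<mu>" "\<And>s. s \<in> {0..T} \<Longrightarrow> norm (q s) \<le> C"
  shows "inner (conv S T 1 w T) \<phi> =
    (LINT s|\<mu>. inner (w s) (adjoint_state \<phi> q s)) - (LINT s|\<mu>. inner (conv S T 1 w s) (q s))"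
proof -
  have Tm: "T \<in> {0..T}" using T_pos by simp
  have kadj: "inner (kern S t x) y = inner x (kern S_adj t y)" for t x y
    unfolding kern_def using hilbert_adjoint[of "S t"] by auto
  have wm: "w \<in> borel_measurable \<mu>" using w by auto
  have bounded_inner: "integrable \<mu> (\<lambda>s. inner (w s) (z s))"
    if "z \<in> borel_measurable \<mu>" "\<And>s. s \<in> {0..T} \<Longrightarrow> norm (z s) \<le> K" for z K
  proof (rule integrable_bound_complete)
    show "integrable \<mu> (\<lambda>s. K * norm (w s))" by (intro integrable_mult_right integrable_norm_complete w)
    show "(\<lambda>s. inner (w s) (z s)) \<in> borel_measurable \<mu>" using wm that(1) by (intro borel_measurable_inner)
    show "AE s in \<mu>. norm (inner (w s) (z s)) \<le> K * norm (w s)"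
    proof (rule AE_I2)
      fix s assume "s \<in> space \<mu>"
      then have "norm (z s) \<le> K" using that(2) by simp
      then have "norm (w s) * norm (z s) \<le> norm (w s) * K" by (intro mult_left_mono) auto
      then show "norm (inner (w s) (z s)) \<le> K * norm (w s)"
        using Cauchy_Schwarz_ineq2[of "w s" "z s"] by (simp add: mult.commute)
    qed
  qed
  have cm: "conv S_adj T (-1) q \<in> borel_measurable \<mu>"
    by (rule borel_measurable_continuous_lebesgue_on[OF adj.continuous_on_conv[OF _ q]]) auto
  have cb: "norm (conv S_adj T (-1) q s) \<le> M * (T * C)" if "s \<in> {0..T}" for s
    using norm_adjoint_state_le[OF q that, of 0] by (simp add: adjoint_state_def)
  have i1: "integrable \<mu> (\<lambda>s. inner (w s) (adjoint_state \<phi> q s))"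
    by (rule bounded_inner[OF borel_measurable_adjoint_state[OF q] norm_adjoint_state_le[OF q]])
  have i2: "integrable \<mu> (\<lambda>s. inner (w s) (conv S_adj T (-1) q s))"
    by (rule bounded_inner[OF cm cb])
  have "inner (conv S T 1 w T) \<phi> = (LINT s|\<mu>. inner (kern S (T - s) (w s)) \<phi>)"
    unfolding conv_def using integrable_kern[of 1 T w] Tm w by (subst integral_inner_left) auto
  also have "\<dots> = (LINT s|\<mu>. inner (w s) (adjoint_state \<phi> q s) - inner (w s) (conv S_adj T (-1) q s))"
    by (simp add: kadj adjoint_state_def inner_add_right)
  also have "\<dots> = (LINT s|\<mu>. inner (w s) (adjoint_state \<phi> q s)) - (LINT s|\<mu>. inner (w s) (conv S_adj T (-1) q s))"
    by (rule Bochner_Integration.integral_diff[OF i1 i2])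
  also have "(LINT s|\<mu>. inner (w s) (conv S_adj T (-1) q s)) = (LINT s|\<mu>. inner (conv S T 1 w s) (q s))"
    by (rule conv_duality[OF compact_semigroup_axioms w q, symmetric])
  finally show ?thesis .
qed

text \<open>A pair is admissible if \<open>q = G* p\<close> could hold along the adjoint state \<open>p\<close> for some potential \<open>G\<close> with \<open>norm G \<le> K\<close>.\<close>

definition admissible :: "real \<Rightarrow> 'x \<Rightarrow> (real \<Rightarrow> 'x) \<Rightarrow> bool" where
  "admissible K \<phi> q \<longleftrightarrow> q \<in> borel_measurable \<mu> \<and> (\<exists>C. \<forall>s\<in>{0..T}. norm (q s) \<le> C) \<and>
     (\<forall>s\<in>{0..T}. norm (q s) \<le> K * norm (adjoint_state \<phi> q s))"

text \<open>The rank-one potential \<open>G s x = \<langle>x, q s\<rangle> p s / norm (p s)\<^sup>2\<close> satisfies \<open>G(s)* p s = q s\<close>, and pairing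
  the state of the corresponding linear system with \<open>p\<close> shows that every point reachable from \<open>0\<close> is orthogonal to \<open>\<phi>\<close>.\<close>

lemma unique_continuation:
  assumes adm: "admissible K \<phi> q" and K: "0 \<le> K"
    and Bp: "AE s in \<mu>. B_adj (adjoint_state \<phi> q s) = 0"
  shows "\<phi> = 0"
proof (rule ccontr)
  assume "\<phi> \<noteq> 0"
  define p where "p = adjoint_state \<phi> q"
  obtain C where qm: "q \<in> borel_measurable \<mu>" and qC: "\<And>s. s \<in> {0..T} \<Longrightarrow> norm (q s) \<le> C"
    and qK: "\<And>s. s \<in> {0..T} \<Longrightarrow> norm (q s) \<le> K * norm (p s)"
    using adm unfolding admissible_def p_def by blast
  have pm: "p \<in> borel_measurable \<mu>" unfolding p_def by (rule borel_measurable_adjoint_state[OF qm qC])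
  \<comment> \<open>As a function of the pair (p, q) the rank-one operator is continuous in operator
    norm on the open set p \<noteq> 0, so \<open>G\<close> is Borel measurable as an operator-valued
    function. Where p = 0, admissibility forces q = 0 and the value 0 is the right one.\<close>
  define rk :: "'x \<times> 'x \<Rightarrow> 'x \<Rightarrow>\<^sub>L 'x" where
    "rk z = (if z \<in> (- {0}) \<times> UNIV then (1 / (norm (fst z))\<^sup>2) *\<^sub>R (blinfun_scaleR_left (fst z) o\<^sub>L blinfun_inner_left (snd z)) else 0)" for z
  define G where "G s = rk (p s, q s)" for s
  have Gapp: "G s x = (inner x (q s) / (norm (p s))\<^sup>2) *\<^sub>R p s" for s x
    by (simp add: G_def rk_def blinfun.scaleR_left)
  have Gnorm: "norm (G s) \<le> K" if s: "s \<in> {0..T}" for s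
  proof (rule norm_blinfun_bound[OF K])
    fix x
    have "norm (G s x) = \<bar>inner x (q s)\<bar> / norm (p s)" by (simp add: Gapp power2_eq_square)
    also have "\<dots> \<le> (norm x * (K * norm (p s))) / norm (p s)"
      using order.trans[OF Cauchy_Schwarz_ineq2[of x "q s"] mult_left_mono[OF qK[OF s], of "norm x"]]
      by (intro divide_right_mono) auto
    also have "\<dots> \<le> K * norm x" using K by simp
    finally show "norm (G s x) \<le> K * norm x" .
  qed
  have Gm: "G \<in> borel_measurable \<mu>"
  proof -
    have "rk \<in> borel_measurable borel"
      unfolding rk_def[abs_def]
    proof (rule borel_measurable_continuous_on_if)
      show "(- {0}) \<times> UNIV \<in> sets (borel :: ('x \<times> 'x) measure)" by (intro borel_open open_Times) auto
      show "continuous_on ((- {0}) \<times> UNIV) (\<lambda>z :: 'x \<times> 'x. (1 / (norm (fst z))\<^sup>2) *\<^sub>R (blinfun_scaleR_left (fst z) o\<^sub>L blinfun_inner_left (snd z)))"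
        by (intro continuous_intros bounded_linear.continuous_on[OF bounded_linear_blinfun_scaleR_left]
             bounded_linear.continuous_on[OF bounded_linear_blinfun_inner_left]
             bounded_bilinear.continuous_on[OF bounded_bilinear_blinfun_compose]) auto
    qed auto
    moreover have "(\<lambda>s. (p s, q s)) \<in> \<mu> \<rightarrow>\<^sub>M borel" using pm qm by (simp add: borel_prod[symmetric])
    ultimately show ?thesis unfolding G_def[abs_def] by (rule measurable_compose_rev)
  qed
  have "L2_on T G"
    unfolding L2_on_def
  proof (intro conjI Gm integrable_bounded_lebesgue_on)
    show "(\<lambda>t. (norm (G t))\<^sup>2) \<in> borel_measurable \<mu>"
    proof -
      have "(\<lambda>L :: 'x \<Rightarrow>\<^sub>L 'x. (norm L)\<^sup>2) \<in> borel_measurable borel"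
        by (intro borel_measurable_continuous_onI continuous_intros)
      from measurable_compose[OF Gm this] show ?thesis .
    qed
    show "norm ((norm (G s))\<^sup>2) \<le> K\<^sup>2" if "s \<in> {0..T}" for s using power_mono[OF Gnorm[OF that] norm_ge_zero, of 2] by simp
  qed
  \<comment> \<open>The target is \<open>\<phi>\<close> itself with tolerance norm
    \<open>\<phi>\<close> / 2; a reachable point orthogonal to \<open>\<phi>\<close> cannot be that
    close.\<close>
  from approximately_controllable[OF this, of "norm \<phi> / 2" 0 \<phi>] \<open>\<phi> \<noteq> 0\<close> obtain u y
    where u: "L2_on T u" and y: "mild_solution S B (\<lambda>s z. G s z) T 0 u y" and yT: "norm (y T - \<phi>) < norm \<phi> / 2" by auto
  define w where "w s = B (u s) + G s (y s)" for s
  have yc: "continuous_on {0..T} y" using y by (simp add: mild_solution_def)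
  have ym: "y \<in> borel_measurable \<mu>" by (rule borel_measurable_continuous_lebesgue_on[OF yc])
  have um: "u \<in> borel_measurable \<mu>" using u by (simp add: L2_on_def)
  have Bum: "(\<lambda>s. B (u s)) \<in> borel_measurable \<mu>"
    by (rule measurable_compose[OF um borel_measurable_continuous_onI]) (intro linear_continuous_on blinfun.bounded_linear_right)
  have Gym: "(\<lambda>s. G s (y s)) \<in> borel_measurable \<mu>"
    unfolding Gapp using pm qm ym
    by (intro borel_measurable_scaleR borel_measurable_divide borel_measurable_inner borel_measurable_power borel_measurable_norm) auto
  have wm: "w \<in> borel_measurable \<mu>" unfolding w_def[abs_def] by (intro borel_measurable_add Bum Gym)
  obtain Y where Y: "\<And>s. s \<in> {0..T} \<Longrightarrow> norm (y s) \<le> Y"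
    using compact_imp_bounded[OF compact_continuous_image[OF yc compact_Icc]] unfolding bounded_iff by (metis imageI)
  have Bui: "integrable \<mu> (\<lambda>s. B (u s))"
  proof (rule integrable_bound_complete[OF _ Bum])
    show "integrable \<mu> (\<lambda>s. norm B * (1 + (norm (u s))\<^sup>2))"
      using u integrable_const_lebesgue_on
      by (intro integrable_mult_right Bochner_Integration.integrable_add) (auto simp: L2_on_def)
    have "norm (B (u s)) \<le> norm B * (1 + (norm (u s))\<^sup>2)" for s
    proof -
      have "0 \<le> (norm (u s) - 1/2)\<^sup>2" by simp
      then have "norm (u s) \<le> 1 + (norm (u s))\<^sup>2" by (simp add: power2_diff power_divide)
      then show ?thesis by (intro order.trans[OF norm_blinfun] mult_left_mono) auto
    qed
    then show "AE s in \<mu>. norm (B (u s)) \<le> norm B * (1 + (norm (u s))\<^sup>2)" by simp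
  qed
  have Gyi: "integrable \<mu> (\<lambda>s. G s (y s))"
    using Gym
  proof (rule integrable_bounded_lebesgue_on)
    fix s assume s: "s \<in> {0..T}"
    show "norm (G s (y s)) \<le> K * Y"
      using Gnorm[OF s] Y[OF s] K by (intro order.trans[OF norm_blinfun] mult_mono) auto
  qed
  have wi: "integrable \<mu> w" unfolding w_def[abs_def] by (rule Bochner_Integration.integrable_add[OF Bui Gyi])
  have yconv: "y t = conv S T 1 w t" if "t \<in> {0..T}" for t
    using y that mild_integral_iff_conv(2)[OF that wm] by (simp add: mild_solution_def w_def)
  have "inner (y T) \<phi> = (LINT s|\<mu>. inner (w s) (p s)) - (LINT s|\<mu>. inner (conv S T 1 w s) (q s))"
    using state_adjoint_pairing[OF wi qm qC, of \<phi>] yconv[of T] T_pos by (simp add: p_def)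
  moreover have "(LINT s|\<mu>. inner (w s) (p s)) = (LINT s|\<mu>. inner (conv S T 1 w s) (q s))"
  proof (rule integral_cong_AE)
    show "(\<lambda>s. inner (w s) (p s)) \<in> borel_measurable \<mu>" by (intro borel_measurable_inner wm pm)
    have "(\<lambda>s. inner (conv S T 1 w s) (q s)) \<in> borel_measurable \<mu> \<longleftrightarrow> (\<lambda>s. inner (y s) (q s)) \<in> borel_measurable \<mu>"
      by (rule measurable_cong) (simp add: yconv)
    then show "(\<lambda>s. inner (conv S T 1 w s) (q s)) \<in> borel_measurable \<mu>" using ym qm by (simp add: borel_measurable_inner)
    show "AE s in \<mu>. inner (w s) (p s) = inner (conv S T 1 w s) (q s)"
      using Bp AE_space[of \<mu>]
    proof eventually_elim
      case (elim s)
      then have s: "s \<in> {0..T}" by simp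
      have "inner (B (u s)) (p s) = 0" using elim(1) by (simp add: hilbert_adjoint p_def)
      moreover have "inner (G s (y s)) (p s) = inner (y s) (q s)"
      proof (cases "p s = 0")
        case True
        then show ?thesis using qK[OF s] by (simp add: Gapp)
      qed (simp add: Gapp power2_norm_eq_inner)
      ultimately show ?case by (simp add: w_def inner_add_left yconv[OF s, symmetric])
    qed
  qed
  ultimately have "inner (y T) \<phi> = 0" by simp
  then have "norm \<phi> * norm \<phi> = inner (\<phi> - y T) \<phi>"
    by (simp add: inner_diff_left power2_norm_eq_inner[symmetric] power2_eq_square)
  also have "\<dots> \<le> norm (\<phi> - y T) * norm \<phi>" by (rule norm_cauchy_schwarz)
  also have "\<dots> \<le> norm \<phi> / 2 * norm \<phi>" using yT by (intro mult_right_mono) (auto simp: norm_minus_commute)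
  finally show False using \<open>\<phi> \<noteq> 0\<close> by (simp add: field_simps)
qed

text \<open>Backward Gronwall with \<open>\<alpha>\<close> = -1. The unspecified bound on q inside
  \<open>admissible\<close> only ensures finiteness and disappears. The rate M K + 1 is positive
  even if M K = 0.\<close>

lemma norm_adjoint_state_admissible_le:
  assumes "admissible K \<phi> q" "0 \<le> K" "t \<in> {0..T}"
  shows "norm (adjoint_state \<phi> q t) \<le> 2 * (M * norm \<phi>) * exp (4 * (M * K + 1) * T)"
proof -
  obtain C where qm: "q \<in> borel_measurable \<mu>" and qC: "\<And>s. s \<in> {0..T} \<Longrightarrow> norm (q s) \<le> C"
    and qK: "\<And>s. s \<in> {0..T} \<Longrightarrow> norm (q s) \<le> K * norm (adjoint_state \<phi> q s)"
    using assms(1) unfolding admissible_def by blast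
  have pm: "adjoint_state \<phi> q \<in> borel_measurable \<mu>" by (rule borel_measurable_adjoint_state[OF qm qC])
  have pb: "norm (adjoint_state \<phi> q s) \<le> M * norm \<phi> + M * (T * C)" if "s \<in> {0..T}" for s
    by (rule norm_adjoint_state_le[OF qm qC that])
  have qi: "integrable \<mu> q" by (rule integrable_bounded_lebesgue_on[OF qm qC])
  have pi: "integrable \<mu> (\<lambda>s. norm (adjoint_state \<phi> q s))"
    by (intro integrable_norm_complete integrable_bounded_lebesgue_on[OF pm pb])
  have le: "norm (adjoint_state \<phi> q t) \<le> M * norm \<phi> + (M * K + 1) * (LINT s|\<mu>. indicat_real {s. 0 < -1 * (t - s)} s * norm (adjoint_state \<phi> q s))"
    if t: "t \<in> {0..T}" for t
  proof -
    let ?I = "\<lambda>f. LINT s|\<mu>. indicat_real {s. 0 < -1 * (t - s)} s * f s"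
    have "norm (conv S_adj T (-1) q t) \<le> M * ?I (\<lambda>s. norm (q s))"
      by (rule adj.norm_conv_halfline_le) (use t qi in auto)
    also have "\<dots> \<le> M * ?I (\<lambda>s. K * norm (adjoint_state \<phi> q s))"
    proof (rule mult_left_mono[OF integral_mono_lebesgue_on M_nonneg])
      show "integrable \<mu> (\<lambda>s. indicat_real {s. 0 < -1 * (t - s)} s * norm (q s))"
        by (intro integrable_indicator_halfline integrable_norm_complete qi)
      show "integrable \<mu> (\<lambda>s. indicat_real {s. 0 < -1 * (t - s)} s * (K * norm (adjoint_state \<phi> q s)))"
        by (intro integrable_indicator_halfline integrable_mult_right pi)
      fix s assume "s \<in> {0..T}"
      then show "indicat_real {s. 0 < -1 * (t - s)} s * norm (q s) \<le> indicat_real {s. 0 < -1 * (t - s)} s * (K * norm (adjoint_state \<phi> q s))"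
        by (intro mult_left_mono qK) auto
    qed
    also have "?I (\<lambda>s. K * norm (adjoint_state \<phi> q s)) = K * ?I (\<lambda>s. norm (adjoint_state \<phi> q s))"
      by (simp add: mult.left_commute[of _ K])
    also have "M * (K * ?I (\<lambda>s. norm (adjoint_state \<phi> q s))) \<le> (M * K + 1) * ?I (\<lambda>s. norm (adjoint_state \<phi> q s))"
    proof -
      have "0 \<le> ?I (\<lambda>s. norm (adjoint_state \<phi> q s))" by (intro integral_nonneg_AE AE_I2) simp
      then show ?thesis by (simp add: algebra_simps)
    qed
    finally show ?thesis
      unfolding adjoint_state_def[of \<phi> q t] using adj.norm_kern_apply_le[of "T - t" \<phi>] t
      by (intro order.trans[OF norm_triangle_ineq] add_mono) auto
  qed
  have D: "0 < M * K + 1" using M_nonneg assms(2) by (simp add: add_nonneg_pos)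
  have c: "0 \<le> M * norm \<phi>" using M_nonneg by simp
  from gronwall_bounded[OF _ D c measurable_compose[OF pm borel_measurable_norm] _ pb le assms(3)]
  show ?thesis by simp
qed

end

section \<open>Compactness of adjoint states and coercivity\<close>

text \<open>A substitute for the convex hull: midpoints suffice for the minimization argument, and
  induction carries convex constraints over. The midpoint map is a parameter since it acts on pairs
  of a vector and a function.\<close>

inductive_set midpoint_closure :: "('a \<Rightarrow> 'a \<Rightarrow> 'a) \<Rightarrow> 'a set \<Rightarrow> 'a set" for mid A where
  base: "x \<in> A \<Longrightarrow> x \<in> midpoint_closure mid A"
| mid: "x \<in> midpoint_closure mid A \<Longrightarrow> y \<in> midpoint_closure mid A \<Longrightarrow> mid x y \<in> midpoint_closure mid A"

lemma midpoint_closure_mono: "A \<subseteq> A' \<Longrightarrow> midpoint_closure mid A \<subseteq> midpoint_closure mid A'"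
proof
  fix x assume "A \<subseteq> A'" "x \<in> midpoint_closure mid A"
  from this(2,1) show "x \<in> midpoint_closure mid A'"
    by induction (auto intro: midpoint_closure.intros)
qed

lemma norm_midpoint_le:
  fixes a b :: "'a::real_normed_vector"
  assumes "norm a \<le> c" "norm b \<le> c"
  shows "norm ((1/2) *\<^sub>R (a + b)) \<le> c"
  using norm_triangle_ineq[of a b] assms by simp

lemma norm_midpoint_diff_le:
  fixes a b :: "'a::real_normed_vector"
  assumes "norm (a - p) \<le> c" "norm (b - p) \<le> c"
  shows "norm ((1/2) *\<^sub>R (a + b) - p) \<le> c"
proof -
  have "(1/2) *\<^sub>R (a + b) - p = (1/2) *\<^sub>R ((a - p) + (b - p))"
    by (simp add: algebra_simps flip: scaleR_2)
  then show ?thesis using norm_midpoint_le[OF assms] by simp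
qed

lemma midpoint_parallelogram:
  fixes a b :: "'a::real_inner"
  shows "(norm a)\<^sup>2 + (norm b)\<^sup>2 - 2 * (norm ((1/2) *\<^sub>R (a + b)))\<^sup>2 = (norm (a - b))\<^sup>2 / 2"
  unfolding power2_norm_eq_inner by (simp add: inner_simps inner_commute field_simps)

context compact_semigroup
begin

lemma integrable_norm_power2:
  fixes f :: "real \<Rightarrow> 'a::{real_normed_vector,second_countable_topology}"
  assumes "f \<in> borel_measurable \<mu>" "\<And>s. s \<in> {0..T} \<Longrightarrow> norm (f s) \<le> C"
  shows "integrable \<mu> (\<lambda>s. (norm (f s))\<^sup>2)"
proof (rule integrable_bounded_lebesgue_on)
  show "(\<lambda>s. (norm (f s))\<^sup>2) \<in> borel_measurable \<mu>"
    by (intro borel_measurable_power measurable_compose[OF assms(1) borel_measurable_norm])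
  show "norm ((norm (f s))\<^sup>2) \<le> C\<^sup>2" if "s \<in> {0..T}" for s
    using power_mono[OF assms(2)[OF that] norm_ge_zero, of 2] by simp
qed

end

context control_system
begin

lemma adjoint_state_midpoint:
  assumes "integrable \<mu> q" "integrable \<mu> q'" "t \<in> {0..T}"
  shows "adjoint_state ((1/2) *\<^sub>R (\<phi> + \<phi>')) (\<lambda>s. (1/2) *\<^sub>R (q s + q' s)) t =
    (1/2) *\<^sub>R (adjoint_state \<phi> q t + adjoint_state \<phi>' q' t)"
  unfolding adjoint_state_def adj.conv_scaleR
  using adj.conv_add[of "-1" t q q'] assms by (simp add: blinfun.scaleR_right blinfun.add_right algebra_simps)

text \<open>The limit potential term \<open>q\<close> is obtained without weak compactness: a minimizing sequence of the
  strictly convex \<open>L\<^sup>2\<close> functional over the midpoint closures of the tails converges strongly, and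
  all constraints are stable under midpoints because the states \<open>p\<close> already converge pointwise.\<close>

lemma admissible_compactness:
  fixes \<phi> :: "nat \<Rightarrow> 'x" and q :: "nat \<Rightarrow> real \<Rightarrow> 'x" and L :: "'x \<Rightarrow>\<^sub>L 'x"
  assumes K: "0 \<le> K" and adm: "\<And>n. admissible K (\<phi> n) (q n)" and \<phi>C: "\<And>n. norm (\<phi> n) \<le> C1"
    and L: "compact_operator L"
  obtains r \<Phi> qq where "strict_mono r" "admissible K \<Phi> qq"
    "\<And>t. t \<in> {0..T} \<Longrightarrow> (\<lambda>n. adjoint_state (\<phi> (r n)) (q (r n)) t) \<longlonglongrightarrow> adjoint_state \<Phi> qq t"
    "(\<lambda>n. L (\<phi> (r n))) \<longlonglongrightarrow> L \<Phi>"
proof -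
  have C1: "0 \<le> C1" using order.trans[OF norm_ge_zero \<phi>C] .
  define C2 where "C2 = 2 * (M * C1) * exp (4 * (M * K + 1) * T)"
  have pC: "norm (adjoint_state (\<phi> n) (q n) t) \<le> C2" if "t \<in> {0..T}" for n t
  proof -
    have "norm (adjoint_state (\<phi> n) (q n) t) \<le> 2 * (M * norm (\<phi> n)) * exp (4 * (M * K + 1) * T)"
      by (rule norm_adjoint_state_admissible_le[OF adm K that])
    also have "\<dots> \<le> C2" unfolding C2_def using \<phi>C[of n] M_nonneg by (intro mult_right_mono mult_left_mono) auto
    finally show ?thesis .
  qed
  have C2: "0 \<le> C2" using M_nonneg C1 by (simp add: C2_def)
  define C3 where "C3 = K * C2"
  have qm: "q n \<in> borel_measurable \<mu>" for n using adm[of n] unfolding admissible_def by blast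
  have qC: "norm (q n s) \<le> C3" if "s \<in> {0..T}" for n s
  proof -
    have "norm (q n s) \<le> K * norm (adjoint_state (\<phi> n) (q n) s)" using adm[of n] that unfolding admissible_def by blast
    also have "\<dots> \<le> C3" unfolding C3_def by (intro mult_left_mono pC that K)
    finally show ?thesis .
  qed
  obtain r1 g1 where r1: "strict_mono r1" "\<And>t. 0 < t \<Longrightarrow> t \<le> T \<Longrightarrow> (\<lambda>n. S_adj t (\<phi> (r1 n))) \<longlonglongrightarrow> g1 t"
    by (rule adj.orbit_subseq[of \<phi>, OF \<phi>C]) (rule that)
  obtain r2 g2 where r2: "strict_mono r2" "uniform_limit {0..T} (\<lambda>n. conv S_adj T (-1) (q (r1 (r2 n)))) g2 sequentially"
    by (rule adj.conv_subseq[of "-1" "\<lambda>n. q (r1 n)" C3, OF _ qm qC]) (simp, assumption, rule that)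
  obtain r3 z where r3: "strict_mono r3" "(\<lambda>n. L (\<phi> (r1 (r2 (r3 n))))) \<longlonglongrightarrow> z"
    by (rule compact_operator_subseq[OF L, of "\<lambda>n. \<phi> (r1 (r2 n))" C1, OF \<phi>C]) (rule that)
  define r where "r n = r1 (r2 (r3 n))" for n
  have rm: "strict_mono r" using r1(1) r2(1) r3(1) by (auto simp: r_def strict_mono_def)
  have r23: "strict_mono (\<lambda>n. r2 (r3 n))" using r2(1) r3(1) by (auto simp: strict_mono_def)
  define \<psi> where "\<psi> n = \<phi> (r n)" for n
  define v where "v n = q (r n)" for n
  define P where "P n = adjoint_state (\<psi> n) (v n)" for n
  \<comment> \<open>The orbit part is absent at t = T, matching \<open>kern\<close> at 0; there the
    vectors themselves need not converge.\<close>
  define p where "p t = (if t < T then g1 (T - t) else 0) + g2 t" for t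
  have Plim: "(\<lambda>n. P n t) \<longlonglongrightarrow> p t" if t: "t \<in> {0..T}" for t
    unfolding P_def adjoint_state_def p_def
  proof (rule tendsto_add)
    show "(\<lambda>n. kern S_adj (T - t) (\<psi> n)) \<longlonglongrightarrow> (if t < T then g1 (T - t) else 0)"
    proof (cases "t < T")
      case True
      from LIMSEQ_subseq_LIMSEQ[OF r1(2) r23, of "T - t"] True t show ?thesis
        by (simp add: kern_def \<psi>_def r_def comp_def)
    qed (simp add: kern_def)
    from LIMSEQ_subseq_LIMSEQ[OF tendsto_uniform_limitI[OF r2(2) t] r3(1)]
    show "(\<lambda>n. conv S_adj T (-1) (v n) t) \<longlonglongrightarrow> g2 t" by (simp add: v_def r_def comp_def)
  qed
  have Lz: "(\<lambda>n. L (\<psi> n)) \<longlonglongrightarrow> z" using r3(2) by (simp add: \<psi>_def r_def)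
  have \<psi>C: "norm (\<psi> n) \<le> C1" for n using \<phi>C by (simp add: \<psi>_def)
  have vm: "v n \<in> borel_measurable \<mu>" for n using qm by (simp add: v_def)
  have vC: "norm (v n s) \<le> C3" if "s \<in> {0..T}" for n s using qC that by (simp add: v_def)
  have vK: "norm (v n s) \<le> K * norm (P n s)" if "s \<in> {0..T}" for n s
    using adm[of "r n"] that unfolding admissible_def v_def P_def \<psi>_def by blast
  define mid :: "'x \<times> (real \<Rightarrow> 'x) \<Rightarrow> 'x \<times> (real \<Rightarrow> 'x) \<Rightarrow> 'x \<times> (real \<Rightarrow> 'x)"
    where "mid a b = ((1/2) *\<^sub>R (fst a + fst b), \<lambda>s. (1/2) *\<^sub>R (snd a s + snd b s))" for a b
  define H where "H N = midpoint_closure mid ((\<lambda>n. (\<psi> n, v n)) ` {N..})" for N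
  have H1: "norm (fst a) \<le> C1 \<and> snd a \<in> borel_measurable \<mu> \<and> (\<forall>s\<in>{0..T}. norm (snd a s) \<le> C3)" if "a \<in> H N" for a N
    using that unfolding H_def
  proof induction
    case (base x)
    then show ?case using \<psi>C vm vC by auto
  next
    case (mid x y)
    then show ?case unfolding mid_def fst_conv snd_conv
      by (intro conjI ballI norm_midpoint_le borel_measurable_scaleR borel_measurable_add borel_measurable_const) auto
  qed
  have Hi: "integrable \<mu> (snd a)" if "a \<in> H N" for a N
    using H1[OF that] by (intro integrable_bounded_lebesgue_on[where C = C3]) auto
  \<comment> \<open>The bound K * norm p is relaxed to one around the fixed limit
    \<open>p t\<close>, which midpoints preserve. The bound by each pair's own adjoint state is not
    convex in the pair.\<close>
  have H2: "norm (adjoint_state (fst a) (snd a) t - p t) \<le> e \<and> norm (snd a t) \<le> K * (norm (p t) + e)"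
    if t: "t \<in> {0..T}" and e: "\<And>n. n \<ge> N \<Longrightarrow> norm (P n t - p t) \<le> e" and "a \<in> H N" for a N t e
    using that(3) unfolding H_def
  proof induction
    case (base x)
    then obtain n where n: "n \<ge> N" "x = (\<psi> n, v n)" by auto
    have "norm (P n t) \<le> norm (p t) + e" using e[OF n(1)] norm_triangle_sub[of "P n t" "p t"] by simp
    then have "norm (v n t) \<le> K * (norm (p t) + e)" using order.trans[OF vK[OF t] mult_left_mono[OF _ K]] by blast
    then show ?case using e[OF n(1)] n(2) by (simp add: P_def)
  next
    case (mid x y)
    have i: "integrable \<mu> (snd x)" "integrable \<mu> (snd y)" using mid(1,2) Hi unfolding H_def by blast+
    show ?case using mid(3,4) unfolding mid_def fst_conv snd_conv adjoint_state_midpoint[OF i t]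
      by (intro conjI norm_midpoint_diff_le norm_midpoint_le) auto
  qed
  have H3: "norm (L (fst a) - z) \<le> e" if e: "\<And>n. n \<ge> N \<Longrightarrow> norm (L (\<psi> n) - z) \<le> e" and "a \<in> H N" for a N e
    using that(2) unfolding H_def
  proof induction
    case (base x)
    then show ?case using e by auto
  next
    case (mid x y)
    then show ?case unfolding mid_def fst_conv blinfun.scaleR_right blinfun.add_right by (intro norm_midpoint_diff_le)
  qed
  define J where "J a = (norm (fst a))\<^sup>2 + (LINT s|\<mu>. (norm (snd a s))\<^sup>2)" for a :: "'x \<times> (real \<Rightarrow> 'x)"
  have defect: "J a + J b - 2 * J (mid a b) = ((norm (fst a - fst b))\<^sup>2 + (LINT s|\<mu>. (norm (snd a s - snd b s))\<^sup>2)) / 2"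
    if ab: "a \<in> H 0" "b \<in> H 0" for a b
  proof -
    have m: "mid a b \<in> H 0" using ab unfolding H_def by (rule midpoint_closure.mid)
    have i: "integrable \<mu> (\<lambda>s. (norm (snd c s))\<^sup>2)" if "c \<in> H 0" for c
      using H1[OF that] by (intro integrable_norm_power2[where C = C3]) auto
    have "(LINT s|\<mu>. (norm (snd a s - snd b s))\<^sup>2) / 2 =
        (LINT s|\<mu>. (norm (snd a s))\<^sup>2 + (norm (snd b s))\<^sup>2 - 2 * (norm (snd (mid a b) s))\<^sup>2)"
      unfolding mid_def snd_conv midpoint_parallelogram by simp
    also have "\<dots> = (LINT s|\<mu>. (norm (snd a s))\<^sup>2) + (LINT s|\<mu>. (norm (snd b s))\<^sup>2) - 2 * (LINT s|\<mu>. (norm (snd (mid a b) s))\<^sup>2)"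
      using i[OF ab(1)] i[OF ab(2)] i[OF m] by simp
    finally show ?thesis
      using midpoint_parallelogram[of "fst a" "fst b"] unfolding J_def by (simp add: mid_def)
  qed
  \<comment> \<open>\<open>J\<close> is the squared norm of both components, so its midpoint defect
    controls their distances. Its values on the original pairs are uniformly bounded, which keeps
    the infima over the tails bounded.\<close>
  obtain x where xH: "\<And>n. x n \<in> H n"
    and xC: "\<And>e. e > 0 \<Longrightarrow> \<exists>N. \<forall>m\<ge>N. \<forall>n\<ge>N. J (x m) + J (x n) - 2 * J (mid (x m) (x n)) < e"
  proof (rule minimizing_sequence_midpoint_defect[of H mid 0 J "C1\<^sup>2 + T * C3\<^sup>2"])
    show "H n \<subseteq> H m" if "m \<le> n" for m n unfolding H_def using that by (intro midpoint_closure_mono) auto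
    show "mid a b \<in> H n" if "a \<in> H n" "b \<in> H n" for n a b using that unfolding H_def by (rule midpoint_closure.mid)
    show "0 \<le> J a" for a unfolding J_def by (intro add_nonneg_nonneg integral_nonneg_AE AE_I2) auto
    show "\<exists>a\<in>H n. J a \<le> C1\<^sup>2 + T * C3\<^sup>2" for n
    proof (rule bexI[of _ "(\<psi> n, v n)"])
      show "(\<psi> n, v n) \<in> H n" unfolding H_def by (intro midpoint_closure.base) auto
      have "(LINT s|\<mu>. (norm (v n s))\<^sup>2) \<le> (LINT s|\<mu>. C3\<^sup>2)"
        using vC integrable_const_lebesgue_on
        by (intro integral_mono_lebesgue_on integrable_norm_power2[OF vm vC] power_mono) auto
      also have "\<dots> = T * C3\<^sup>2" using T_pos by (subst integral_const_lebesgue_on) auto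
      finally show "J (\<psi> n, v n) \<le> C1\<^sup>2 + T * C3\<^sup>2"
        using power_mono[OF \<psi>C[of n] norm_ge_zero, of 2] by (simp add: J_def)
    qed
  qed (rule that)
  define F where "F n = fst (x n)" for n
  define Q where "Q n = snd (x n)" for n
  have x0: "x n \<in> H 0" for n
  proof -
    have "H n \<subseteq> H 0" unfolding H_def by (intro midpoint_closure_mono) auto
    then show ?thesis using xH by blast
  qed
  have Qm: "Q n \<in> borel_measurable \<mu>" and QC: "s \<in> {0..T} \<Longrightarrow> norm (Q n s) \<le> C3" for n s
    using H1[OF xH[of n]] by (auto simp: Q_def)
  have Qi: "integrable \<mu> (Q n)" for n using Hi[OF xH] by (simp add: Q_def)
  have QiD: "integrable \<mu> (\<lambda>s. (norm (Q m s - Q n s))\<^sup>2)" for m n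
  proof (rule integrable_norm_power2)
    show "norm (Q m s - Q n s) \<le> C3 + C3" if "s \<in> {0..T}" for s
      using QC[OF that] by (intro order.trans[OF norm_triangle_ineq4] add_mono)
  qed (intro borel_measurable_diff Qm)
  have small: "\<exists>N. \<forall>m\<ge>N. \<forall>n\<ge>N. (norm (F m - F n))\<^sup>2 < e \<and> (LINT s|\<mu>. (norm (Q m s - Q n s))\<^sup>2) < e" if "e > 0" for e
  proof -
    obtain N where N: "\<And>m n. m \<ge> N \<Longrightarrow> n \<ge> N \<Longrightarrow> J (x m) + J (x n) - 2 * J (mid (x m) (x n)) < e / 2"
      using xC[OF half_gt_zero[OF \<open>e > 0\<close>]] by blast
    have "(norm (F m - F n))\<^sup>2 < e \<and> (LINT s|\<mu>. (norm (Q m s - Q n s))\<^sup>2) < e" if "m \<ge> N" "n \<ge> N" for m n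
    proof -
      have "(norm (F m - F n))\<^sup>2 + (LINT s|\<mu>. (norm (Q m s - Q n s))\<^sup>2) < e"
        using N[OF that] unfolding defect[OF x0 x0] F_def Q_def by simp
      moreover have "0 \<le> (LINT s|\<mu>. (norm (Q m s - Q n s))\<^sup>2)" by (intro integral_nonneg_AE AE_I2) auto
      moreover have "0 \<le> (norm (F m - F n))\<^sup>2" by simp
      ultimately show ?thesis by linarith
    qed
    then show ?thesis by blast
  qed
  have "Cauchy F"
  proof (rule metric_CauchyI)
    fix e :: real assume e: "e > 0"
    have "e\<^sup>2 > 0" using e by simp
    from small[OF this] obtain N where N: "\<And>m n. m \<ge> N \<Longrightarrow> n \<ge> N \<Longrightarrow> (norm (F m - F n))\<^sup>2 < e\<^sup>2" by blast
    have "dist (F m) (F n) < e" if "m \<ge> N" "n \<ge> N" for m n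
      unfolding dist_norm using power_less_imp_less_base[OF N[OF that]] e by simp
    then show "\<exists>M. \<forall>m\<ge>M. \<forall>n\<ge>M. dist (F m) (F n) < e" by blast
  qed
  then obtain \<Phi> where \<Phi>: "F \<longlonglongrightarrow> \<Phi>" by (meson Cauchy_convergent_iff convergent_def)
  obtain r4 where r4: "strict_mono r4" "AE s in \<mu>. Cauchy (\<lambda>i. Q (r4 i) s)"
  proof (rule cauchy_L1_AE_cauchy_subseq_complete[of \<mu> Q, OF Qi])
    fix e :: real assume e: "e > 0"
    obtain N where N: "\<And>m n. m \<ge> N \<Longrightarrow> n \<ge> N \<Longrightarrow> (LINT s|\<mu>. (norm (Q m s - Q n s))\<^sup>2) < e\<^sup>2 / T"
    proof -
      have "e\<^sup>2 / T > 0" using e T_pos by simp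
      from small[OF this] show thesis using that by blast
    qed
    have "(LINT s|\<mu>. norm (Q m s - Q n s)) < e" if mn: "m \<ge> N" "n \<ge> N" for m n
    proof -
      \<comment> \<open>The weighted inequality b \<le> e / (2 T) + T b b / (2 e) passes from the
        square integral to the integral of the norm; a square integral below e e / T makes both
        terms at most e / 2.\<close>
      have "(LINT s|\<mu>. norm (Q m s - Q n s)) \<le> (LINT s|\<mu>. e / (2 * T) + T / (2 * e) * (norm (Q m s - Q n s))\<^sup>2)"
      proof (rule integral_mono_lebesgue_on)
        show "integrable \<mu> (\<lambda>s. norm (Q m s - Q n s))"
          by (intro integrable_norm_complete Bochner_Integration.integrable_diff Qi)
        show "integrable \<mu> (\<lambda>s. e / (2 * T) + T / (2 * e) * (norm (Q m s - Q n s))\<^sup>2)"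
          using integrable_const_lebesgue_on
          by (intro Bochner_Integration.integrable_add integrable_mult_right QiD) auto
        fix s :: real
        have "b \<le> e / (2 * T) + T / (2 * e) * b\<^sup>2" for b :: real
        proof -
          have "0 \<le> (e - T * b)\<^sup>2 / (2 * T * e)" using e T_pos by simp
          also have "\<dots> = e / (2 * T) + T / (2 * e) * b\<^sup>2 - b"
            using e T_pos by (simp add: power2_eq_square field_simps)
          finally show ?thesis by simp
        qed
        then show "norm (Q m s - Q n s) \<le> e / (2 * T) + T / (2 * e) * (norm (Q m s - Q n s))\<^sup>2" .
      qed
      also have "\<dots> = T * (e / (2 * T)) + T / (2 * e) * (LINT s|\<mu>. (norm (Q m s - Q n s))\<^sup>2)"
      proof -
        have "(LINT s|\<mu>. e / (2 * T)) = T * (e / (2 * T))" using T_pos by (subst integral_const_lebesgue_on) auto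
        moreover have i: "integrable \<mu> (\<lambda>s. T / (2 * e) * (norm (Q m s - Q n s))\<^sup>2)" by (intro integrable_mult_right QiD)
        moreover note Bochner_Integration.integral_add[OF integrable_const_lebesgue_on i, of "e / (2 * T)"]
        ultimately show ?thesis by (simp only: integral_mult_right_zero)
      qed
      also have "\<dots> < T * (e / (2 * T)) + T / (2 * e) * (e\<^sup>2 / T)"
        using N[OF mn] e T_pos by (intro add_strict_left_mono mult_strict_left_mono) auto
      also have "\<dots> = e" using e T_pos by (simp add: power2_eq_square)
      finally show ?thesis .
    qed
    then show "\<exists>N. \<forall>i\<ge>N. \<forall>j\<ge>N. (LINT s|\<mu>. norm (Q i s - Q j s)) < e" by blast
  qed (rule that)
  \<comment> \<open>The limit is formed in the isometric copy, an instance of \<open>banach\<close>,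
    to get measurability. Where the sequence diverges the value is arbitrary.\<close>
  define ql where "ql s = of_copy (lim (\<lambda>i. to_copy (Q (r4 i) s)))" for s
  have ql: "(\<lambda>i. Q (r4 i) s) \<longlonglongrightarrow> ql s" if Cs: "Cauchy (\<lambda>i. Q (r4 i) s)" for s
  proof -
    obtain l where l: "(\<lambda>i. Q (r4 i) s) \<longlonglongrightarrow> l" using Cs by (meson Cauchy_convergent_iff convergent_def)
    then have "(\<lambda>i. to_copy (Q (r4 i) s)) \<longlonglongrightarrow> to_copy l" by (rule bounded_linear.tendsto[OF bounded_linear_to_copy])
    then have "ql s = l" unfolding ql_def by (simp add: limI)
    then show ?thesis using l by simp
  qed
  have qlm: "ql \<in> borel_measurable \<mu>"
  proof -
    have "(\<lambda>s. lim (\<lambda>i. to_copy (Q (r4 i) s))) \<in> borel_measurable \<mu>"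
      by (intro borel_measurable_lim_metric borel_measurable_copy Qm)
    then show ?thesis
      unfolding ql_def[abs_def]
      by (rule measurable_compose[OF _ borel_measurable_continuous_onI[OF linear_continuous_on[OF bounded_linear_of_copy]]])
  qed
  have Pm: "P n \<in> borel_measurable \<mu>" for n unfolding P_def by (rule borel_measurable_adjoint_state[OF vm vC])
  have pm: "p \<in> borel_measurable \<mu>"
    by (rule borel_measurable_LIMSEQ_metric[where f = P, OF Pm]) (simp add: Plim)
  \<comment> \<open>The almost everywhere limit obeys the bound only where it is a limit. Truncation
    makes the bound hold at every time, as \<open>admissible\<close> demands, and changes nothing at
    convergence points.\<close>
  define qq where "qq s = (if norm (ql s) \<le> K * norm (p s) then ql s else 0)" for s
  have qqm: "qq \<in> borel_measurable \<mu>"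
    unfolding qq_def[abs_def]
  proof (rule measurable_If[OF qlm])
    have "(\<lambda>s. norm (ql s)) \<in> borel_measurable \<mu>" "(\<lambda>s. K * norm (p s)) \<in> borel_measurable \<mu>"
      using measurable_compose[OF qlm borel_measurable_norm] measurable_compose[OF pm borel_measurable_norm] by auto
    then show "{s \<in> space \<mu>. norm (ql s) \<le> K * norm (p s)} \<in> sets \<mu>" by (rule borel_measurable_le)
  qed simp
  have qqK: "norm (qq s) \<le> K * norm (p s)" for s using K by (simp add: qq_def)
  have pC2: "norm (p s) \<le> C2" if "s \<in> {0..T}" for s
  proof (rule Lim_bounded[OF tendsto_norm[OF Plim[OF that]], of 0])
    show "\<forall>n\<ge>0. norm (P n s) \<le> C2" using pC[OF that] by (simp add: P_def \<psi>_def v_def)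
  qed
  have qqC: "norm (qq s) \<le> C3" if "s \<in> {0..T}" for s
    unfolding C3_def by (rule order.trans[OF qqK mult_left_mono[OF pC2[OF that] K]])
  have near: "\<exists>N. \<forall>n\<ge>N. norm (adjoint_state (F n) (Q n) s - p s) \<le> e \<and> norm (Q n s) \<le> K * (norm (p s) + e)"
    if s: "s \<in> {0..T}" and e: "e > 0" for s e
  proof -
    obtain N where N: "\<And>n. n \<ge> N \<Longrightarrow> norm (P n s - p s) < e" using LIMSEQ_D[OF Plim[OF s] e] by blast
    have "norm (adjoint_state (F n) (Q n) s - p s) \<le> e \<and> norm (Q n s) \<le> K * (norm (p s) + e)" if "n \<ge> N" for n
      unfolding F_def Q_def by (rule H2[OF s _ xH]) (use N that in \<open>auto intro: less_imp_le\<close>)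
    then show ?thesis by blast
  qed
  have tail: "\<exists>N. \<forall>i\<ge>N. r4 i \<ge> n" for n using seq_suble[OF r4(1)] order.trans by blast
  have lim_eq: "(\<lambda>i. Q (r4 i) s) \<longlonglongrightarrow> qq s" if s: "s \<in> {0..T}" and Cs: "Cauchy (\<lambda>i. Q (r4 i) s)" for s
  proof -
    have "norm (ql s) \<le> K * (norm (p s) + e)" if "e > 0" for e
    proof -
      obtain N where "\<forall>n\<ge>N. norm (Q n s) \<le> K * (norm (p s) + e)" using near[OF s \<open>e > 0\<close>] by blast
      moreover obtain N' where "\<forall>i\<ge>N'. r4 i \<ge> N" using tail by blast
      ultimately show ?thesis by (intro Lim_bounded[OF tendsto_norm[OF ql[OF Cs]], of N']) auto
    qed
    then have "norm (ql s) \<le> K * norm (p s) + e" if "e > 0" for e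
    proof -
      have "norm (ql s) \<le> K * (norm (p s) + e / (K + 1))" using \<open>\<And>e. e > 0 \<Longrightarrow> norm (ql s) \<le> K * (norm (p s) + e)\<close>[of "e / (K + 1)"] that K by simp
      also have "\<dots> = K * norm (p s) + e * (K / (K + 1))" by (simp add: distrib_left)
      also have "\<dots> \<le> K * norm (p s) + e * 1" using that K by (intro add_left_mono mult_left_mono) auto
      finally show ?thesis by simp
    qed
    then have "norm (ql s) \<le> K * norm (p s)" by (rule field_le_epsilon)
    then show ?thesis using ql[OF Cs] by (simp add: qq_def)
  qed
  have L1: "(\<lambda>i. LINT s|\<mu>. norm (Q (r4 i) s - qq s)) \<longlonglongrightarrow> (LINT s|\<mu>. 0)"
  proof (rule integral_dominated_convergence[where w = "\<lambda>_. C3 + C3"])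
    show "integrable \<mu> (\<lambda>_. C3 + C3)" using integrable_const_lebesgue_on by blast
    show "(\<lambda>s. norm (Q (r4 i) s - qq s)) \<in> borel_measurable \<mu>" for i
      by (rule measurable_compose[OF borel_measurable_diff[OF Qm qqm] borel_measurable_norm])
    show "AE s in \<mu>. norm (norm (Q (r4 i) s - qq s)) \<le> C3 + C3" for i
    proof (rule AE_I2)
      fix s assume "s \<in> space \<mu>"
      then have s: "s \<in> {0..T}" by simp
      show "norm (norm (Q (r4 i) s - qq s)) \<le> C3 + C3"
        using add_mono[OF QC[OF s, of "r4 i"] qqC[OF s]] norm_triangle_ineq4[of "Q (r4 i) s" "qq s"] by simp
    qed
    show "AE s in \<mu>. (\<lambda>i. norm (Q (r4 i) s - qq s)) \<longlonglongrightarrow> 0"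
      using r4(2) AE_space[of \<mu>]
    proof eventually_elim
      case (elim s)
      then have "(\<lambda>i. Q (r4 i) s) \<longlonglongrightarrow> qq s" by (intro lim_eq) auto
      then show ?case by (intro tendsto_norm_zero) (simp add: LIM_zero_iff)
    qed
  qed simp
  have qqi: "integrable \<mu> qq" by (rule integrable_bounded_lebesgue_on[OF qqm qqC])
  have \<Phi>4: "(\<lambda>i. F (r4 i)) \<longlonglongrightarrow> \<Phi>" using LIMSEQ_subseq_LIMSEQ[OF \<Phi> r4(1)] by (simp add: comp_def)
  \<comment> \<open>The adjoint states of the averaged pairs have two limits: \<open>p\<close>
    because averaging preserves closeness to \<open>p\<close>, and the state of the limit pair
    because of the L1 convergence of the sources.\<close>
  have eq: "adjoint_state \<Phi> qq t = p t" if t: "t \<in> {0..T}" for t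
  proof (rule LIMSEQ_unique)
    have "(\<lambda>i. conv S_adj T (-1) (Q (r4 i)) t - conv S_adj T (-1) qq t) \<longlonglongrightarrow> 0"
    proof (rule Lim_null_comparison)
      show "(\<lambda>i. M * (LINT s|\<mu>. norm (Q (r4 i) s - qq s))) \<longlonglongrightarrow> 0"
        using tendsto_mult[OF tendsto_const L1, of M] by simp
      have "norm (conv S_adj T (-1) (Q (r4 i)) t - conv S_adj T (-1) qq t) \<le> M * (LINT s|\<mu>. norm (Q (r4 i) s - qq s))" for i
        using adj.norm_conv_le[of "-1" t "\<lambda>s. Q (r4 i) s - qq s"] adj.conv_diff[of "-1" t "Q (r4 i)" qq] t Qi qqi by simp
      then show "\<forall>\<^sub>F i in sequentially. norm (conv S_adj T (-1) (Q (r4 i)) t - conv S_adj T (-1) qq t) \<le> M * (LINT s|\<mu>. norm (Q (r4 i) s - qq s))" by simp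
    qed
    then have "(\<lambda>i. conv S_adj T (-1) (Q (r4 i)) t) \<longlonglongrightarrow> conv S_adj T (-1) qq t" by (simp add: LIM_zero_iff)
    then show "(\<lambda>i. adjoint_state (F (r4 i)) (Q (r4 i)) t) \<longlonglongrightarrow> adjoint_state \<Phi> qq t"
      unfolding adjoint_state_def by (intro tendsto_add blinfun.tendsto tendsto_const \<Phi>4)
    have "(\<lambda>n. adjoint_state (F n) (Q n) t) \<longlonglongrightarrow> p t"
    proof (rule LIMSEQ_I)
      fix e :: real assume "e > 0"
      then obtain N where "\<forall>n\<ge>N. norm (adjoint_state (F n) (Q n) t - p t) \<le> e / 2" using near[OF t, of "e / 2"] by auto
      then show "\<exists>N. \<forall>n\<ge>N. norm (adjoint_state (F n) (Q n) t - p t) < e" using \<open>e > 0\<close>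
        by (intro exI[of _ N]) fastforce
    qed
    from LIMSEQ_subseq_LIMSEQ[OF this r4(1)] show "(\<lambda>i. adjoint_state (F (r4 i)) (Q (r4 i)) t) \<longlonglongrightarrow> p t" by (simp add: comp_def)
  qed
  \<comment> \<open>L commutes with midpoints, so the limit \<open>z\<close> along the original
    vectors is also the limit along the averages, and there it equals L \<open>\<Phi>\<close> by
    continuity.\<close>
  have "(\<lambda>n. L (F n)) \<longlonglongrightarrow> z"
  proof (rule LIMSEQ_I)
    fix e :: real assume e: "e > 0"
    obtain N where N: "\<And>n. n \<ge> N \<Longrightarrow> norm (L (\<psi> n) - z) < e / 2" using LIMSEQ_D[OF Lz, of "e / 2"] e by auto
    have "norm (L (F n) - z) \<le> e / 2" if "n \<ge> N" for n
      unfolding F_def by (rule H3[OF _ xH]) (use N that in \<open>auto intro: less_imp_le\<close>)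
    then show "\<exists>N. \<forall>n\<ge>N. norm (L (F n) - z) < e" using e by (intro exI[of _ N]) fastforce
  qed
  moreover have "(\<lambda>n. L (F n)) \<longlonglongrightarrow> L \<Phi>" by (intro blinfun.tendsto tendsto_const \<Phi>)
  ultimately have zL: "z = L \<Phi>" by (rule LIMSEQ_unique)
  show thesis
  proof (rule that[OF rm])
    show "admissible K \<Phi> qq" unfolding admissible_def
    proof (intro conjI exI[of _ C3] ballI qqm qqC)
      show "norm (qq s) \<le> K * norm (adjoint_state \<Phi> qq s)" if "s \<in> {0..T}" for s using qqK eq[OF that] by simp
    qed
    show "(\<lambda>n. adjoint_state (\<phi> (r n)) (q (r n)) t) \<longlonglongrightarrow> adjoint_state \<Phi> qq t" if "t \<in> {0..T}" for t
      using Plim[OF that] eq[OF that] by (simp add: P_def \<psi>_def v_def)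
    show "(\<lambda>n. L (\<phi> (r n))) \<longlonglongrightarrow> L \<Phi>" using Lz zL by (simp add: \<psi>_def)
  qed
qed

lemma borel_measurable_B_adj_state:
  assumes "admissible K \<phi> q"
  shows "(\<lambda>s. B_adj (adjoint_state \<phi> q s)) \<in> borel_measurable \<mu>"
proof -
  obtain C where "q \<in> borel_measurable \<mu>" "\<And>s. s \<in> {0..T} \<Longrightarrow> norm (q s) \<le> C"
    using assms unfolding admissible_def by blast
  from borel_measurable_adjoint_state[OF this] show ?thesis
    by (rule measurable_compose[OF _ borel_measurable_blinfun_apply])
qed

lemma norm_B_adj_state_le:
  assumes "admissible K \<phi> q" "0 \<le> K" "norm \<phi> \<le> C" "s \<in> {0..T}"
  shows "norm (B_adj (adjoint_state \<phi> q s)) \<le> norm B_adj * (2 * (M * C) * exp (4 * (M * K + 1) * T))"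
proof -
  have "norm (adjoint_state \<phi> q s) \<le> 2 * (M * norm \<phi>) * exp (4 * (M * K + 1) * T)"
    by (rule norm_adjoint_state_admissible_le[OF assms(1,2,4)])
  also have "\<dots> \<le> 2 * (M * C) * exp (4 * (M * K + 1) * T)"
    using assms(3) M_nonneg by (intro mult_right_mono mult_left_mono) auto
  finally show ?thesis by (intro order.trans[OF norm_blinfun] mult_left_mono) auto
qed

text \<open>Dominated convergence passes the vanishing observation to the limit pair, unique
  continuation gives \<open>\<Phi>\<close> = 0, and the Gronwall bound then makes the whole limit
  state 0.\<close>

lemma admissible_vanishing_subseq:
  fixes \<phi> :: "nat \<Rightarrow> 'x" and q :: "nat \<Rightarrow> real \<Rightarrow> 'x" and L :: "'x \<Rightarrow>\<^sub>L 'x"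
  assumes K: "0 \<le> K" and adm: "\<And>n. admissible K (\<phi> n) (q n)" and \<phi>C: "\<And>n. norm (\<phi> n) \<le> C1"
    and L: "compact_operator L"
    and lim: "(\<lambda>n. LINT s|\<mu>. (norm (B_adj (adjoint_state (\<phi> n) (q n) s)))\<^sup>2) \<longlonglongrightarrow> 0"
  obtains r where "strict_mono r"
    "\<And>t. t \<in> {0..T} \<Longrightarrow> (\<lambda>n. adjoint_state (\<phi> (r n)) (q (r n)) t) \<longlonglongrightarrow> 0"
    "(\<lambda>n. L (\<phi> (r n))) \<longlonglongrightarrow> 0"
proof -
  obtain r \<Phi> qq where r: "strict_mono r" "admissible K \<Phi> qq"
    "\<And>t. t \<in> {0..T} \<Longrightarrow> (\<lambda>n. adjoint_state (\<phi> (r n)) (q (r n)) t) \<longlonglongrightarrow> adjoint_state \<Phi> qq t"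
    "(\<lambda>n. L (\<phi> (r n))) \<longlonglongrightarrow> L \<Phi>"
    by (rule admissible_compactness[of K \<phi> q C1 L, OF K adm \<phi>C L]) (rule that)
  define C where "C = norm B_adj * (2 * (M * C1) * exp (4 * (M * K + 1) * T))"
  have bound: "norm (B_adj (adjoint_state (\<phi> n) (q n) s)) \<le> C" if "s \<in> {0..T}" for n s
    unfolding C_def by (rule norm_B_adj_state_le[OF adm K \<phi>C that])
  have Bm: "(\<lambda>s. (norm (B_adj (adjoint_state \<Phi> qq s)))\<^sup>2) \<in> borel_measurable \<mu>"
    by (intro borel_measurable_power measurable_compose[OF borel_measurable_B_adj_state[OF r(2)] borel_measurable_norm])
  have dct: "integrable \<mu> (\<lambda>s. (norm (B_adj (adjoint_state \<Phi> qq s)))\<^sup>2)"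
    "(\<lambda>n. LINT s|\<mu>. (norm (B_adj (adjoint_state (\<phi> (r n)) (q (r n)) s)))\<^sup>2) \<longlonglongrightarrow> (LINT s|\<mu>. (norm (B_adj (adjoint_state \<Phi> qq s)))\<^sup>2)"
  proof -
    have w: "integrable \<mu> (\<lambda>_. C\<^sup>2)" using integrable_const_lebesgue_on by blast
    have m: "(\<lambda>s. (norm (B_adj (adjoint_state (\<phi> (r n)) (q (r n)) s)))\<^sup>2) \<in> borel_measurable \<mu>" for n
      by (intro borel_measurable_power measurable_compose[OF borel_measurable_B_adj_state[OF adm] borel_measurable_norm])
    have l: "AE s in \<mu>. (\<lambda>n. (norm (B_adj (adjoint_state (\<phi> (r n)) (q (r n)) s)))\<^sup>2) \<longlonglongrightarrow> (norm (B_adj (adjoint_state \<Phi> qq s)))\<^sup>2"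
      by (rule AE_I2) (auto intro!: tendsto_power tendsto_norm blinfun.tendsto tendsto_const r(3))
    have b: "AE s in \<mu>. norm ((norm (B_adj (adjoint_state (\<phi> (r n)) (q (r n)) s)))\<^sup>2) \<le> C\<^sup>2" for n
      by (rule AE_I2) (use bound in \<open>auto intro!: power_mono\<close>)
    show "integrable \<mu> (\<lambda>s. (norm (B_adj (adjoint_state \<Phi> qq s)))\<^sup>2)"
      by (rule integrable_dominated_convergence[OF Bm m w l b])
    show "(\<lambda>n. LINT s|\<mu>. (norm (B_adj (adjoint_state (\<phi> (r n)) (q (r n)) s)))\<^sup>2) \<longlonglongrightarrow> (LINT s|\<mu>. (norm (B_adj (adjoint_state \<Phi> qq s)))\<^sup>2)"
      by (rule integral_dominated_convergence[OF Bm m w l b])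
  qed
  have "(LINT s|\<mu>. (norm (B_adj (adjoint_state \<Phi> qq s)))\<^sup>2) = 0"
    using LIMSEQ_unique[OF dct(2)] LIMSEQ_subseq_LIMSEQ[OF lim r(1)] by (simp add: comp_def)
  then have "AE s in \<mu>. (norm (B_adj (adjoint_state \<Phi> qq s)))\<^sup>2 = 0"
    using integral_nonneg_eq_0_iff_AE[OF dct(1)] by simp
  then have "AE s in \<mu>. B_adj (adjoint_state \<Phi> qq s) = 0" by simp
  then have \<Phi>: "\<Phi> = 0" by (rule unique_continuation[OF r(2) K])
  have "adjoint_state \<Phi> qq t = 0" if "t \<in> {0..T}" for t
    using norm_adjoint_state_admissible_le[OF r(2) K that] \<Phi> by simp
  then show thesis using r \<Phi> by (intro that[OF r(1)]) auto
qed

text \<open>Homogeneity permits normalizing a violating sequence for coercivity and rescaling the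
  multipliers by \<epsilon>.\<close>

lemma admissible_scaleR:
  assumes "admissible K \<phi> q"
  shows "admissible K (c *\<^sub>R \<phi>) (\<lambda>s. c *\<^sub>R q s)" and "adjoint_state (c *\<^sub>R \<phi>) (\<lambda>s. c *\<^sub>R q s) t = c *\<^sub>R adjoint_state \<phi> q t"
proof -
  show e: "adjoint_state (c *\<^sub>R \<phi>) (\<lambda>s. c *\<^sub>R q s) t = c *\<^sub>R adjoint_state \<phi> q t" for t
    unfolding adjoint_state_def adj.conv_scaleR by (simp add: blinfun.scaleR_right scaleR_add_right)
  obtain C where q: "q \<in> borel_measurable \<mu>" "\<And>s. s \<in> {0..T} \<Longrightarrow> norm (q s) \<le> C"
    "\<And>s. s \<in> {0..T} \<Longrightarrow> norm (q s) \<le> K * norm (adjoint_state \<phi> q s)"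
    using assms unfolding admissible_def by blast
  show "admissible K (c *\<^sub>R \<phi>) (\<lambda>s. c *\<^sub>R q s)"
    unfolding admissible_def e
  proof (intro conjI exI[of _ "\<bar>c\<bar> * C"] ballI)
    show "(\<lambda>s. c *\<^sub>R q s) \<in> borel_measurable \<mu>" using q(1) by (intro borel_measurable_scaleR borel_measurable_const)
    fix s assume s: "s \<in> {0..T}"
    show "norm (c *\<^sub>R q s) \<le> \<bar>c\<bar> * C" using q(2)[OF s] by (simp add: mult_left_mono)
    show "norm (c *\<^sub>R q s) \<le> K * norm (c *\<^sub>R adjoint_state \<phi> q s)"
      using mult_left_mono[OF q(3)[OF s], of "\<bar>c\<bar>"] by (simp add: mult_ac)
  qed
qed

text \<open>A normalized violating sequence has vanishing observation, so L of it tends to 0 along a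
  subsequence. Its difference to its image under L also tends to 0, against norm 1.\<close>

lemma coercivity:
  fixes L :: "'x \<Rightarrow>\<^sub>L 'x"
  assumes K: "0 \<le> K" and L: "compact_operator L"
  obtains c where "c > 0" "\<And>\<phi> q. admissible K \<phi> q \<Longrightarrow>
     c * (norm \<phi>)\<^sup>2 \<le> (norm (\<phi> - L \<phi>))\<^sup>2 + (LINT s|\<mu>. (norm (B_adj (adjoint_state \<phi> q s)))\<^sup>2)"
proof -
  have "\<exists>c>0. \<forall>\<phi> q. admissible K \<phi> q \<longrightarrow>
     c * (norm \<phi>)\<^sup>2 \<le> (norm (\<phi> - L \<phi>))\<^sup>2 + (LINT s|\<mu>. (norm (B_adj (adjoint_state \<phi> q s)))\<^sup>2)"
  proof (rule ccontr)
    assume neg: "\<not> ?thesis"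
    have "\<exists>\<phi> q. admissible K \<phi> q \<and> (norm (\<phi> - L \<phi>))\<^sup>2 + (LINT s|\<mu>. (norm (B_adj (adjoint_state \<phi> q s)))\<^sup>2) < 1 / real (Suc n) * (norm \<phi>)\<^sup>2" for n
      using neg not_le by (metis of_nat_0_less_iff zero_less_Suc zero_less_divide_1_iff)
    then obtain \<phi> q where a: "\<And>n. admissible K (\<phi> n) (q n)"
      "\<And>n. (norm (\<phi> n - L (\<phi> n)))\<^sup>2 + (LINT s|\<mu>. (norm (B_adj (adjoint_state (\<phi> n) (q n) s)))\<^sup>2) < 1 / real (Suc n) * (norm (\<phi> n))\<^sup>2"
      by metis
    have nn: "0 \<le> (LINT s|\<mu>. (norm (B_adj (adjoint_state \<phi> q s)))\<^sup>2)" for \<phi> q by (intro integral_nonneg_AE AE_I2) auto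
    have \<phi>0: "\<phi> n \<noteq> 0" for n
    proof
      assume "\<phi> n = 0"
      then show False using a(2)[of n] nn[of 0 "q n"] by simp
    qed
    define \<xi> where "\<xi> n = (1 / norm (\<phi> n)) *\<^sub>R \<phi> n" for n
    define v where "v n s = (1 / norm (\<phi> n)) *\<^sub>R q n s" for n s
    have adm: "admissible K (\<xi> n) (v n)" for n unfolding \<xi>_def v_def[abs_def] by (rule admissible_scaleR[OF a(1)])
    have st: "adjoint_state (\<xi> n) (v n) s = (1 / norm (\<phi> n)) *\<^sub>R adjoint_state (\<phi> n) (q n) s" for n s
      unfolding \<xi>_def v_def[abs_def] by (rule admissible_scaleR[OF a(1)])
    have \<xi>1: "norm (\<xi> n) = 1" for n using \<phi>0 by (simp add: \<xi>_def)
    have sm: "(norm (\<xi> n - L (\<xi> n)))\<^sup>2 + (LINT s|\<mu>. (norm (B_adj (adjoint_state (\<xi> n) (v n) s)))\<^sup>2) < 1 / real (Suc n)" for n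
    proof -
      define k where "k = (1 / norm (\<phi> n))\<^sup>2"
      have k: "k > 0" "k * (norm (\<phi> n))\<^sup>2 = 1" using \<phi>0[of n] by (auto simp: k_def power_one_over)
      have "\<xi> n - L (\<xi> n) = (1 / norm (\<phi> n)) *\<^sub>R (\<phi> n - L (\<phi> n))"
        by (simp add: \<xi>_def blinfun.scaleR_right scaleR_diff_right)
      then have 1: "(norm (\<xi> n - L (\<xi> n)))\<^sup>2 = k * (norm (\<phi> n - L (\<phi> n)))\<^sup>2"
        by (simp add: k_def power_mult_distrib power_divide)
      have "(norm (B_adj (adjoint_state (\<xi> n) (v n) s)))\<^sup>2 = k * (norm (B_adj (adjoint_state (\<phi> n) (q n) s)))\<^sup>2" for s
        unfolding st by (simp add: k_def blinfun.scaleR_right power_mult_distrib power_divide)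
      then have 2: "(LINT s|\<mu>. (norm (B_adj (adjoint_state (\<xi> n) (v n) s)))\<^sup>2) = k * (LINT s|\<mu>. (norm (B_adj (adjoint_state (\<phi> n) (q n) s)))\<^sup>2)" by simp
      have "k * ((norm (\<phi> n - L (\<phi> n)))\<^sup>2 + (LINT s|\<mu>. (norm (B_adj (adjoint_state (\<phi> n) (q n) s)))\<^sup>2)) < k * (1 / real (Suc n) * (norm (\<phi> n))\<^sup>2)"
        by (rule mult_strict_left_mono[OF a(2) k(1)])
      also have "\<dots> = 1 / real (Suc n)" using k(2) by (simp add: field_simps)
      finally show ?thesis unfolding 1 2 by (simp add: distrib_left)
    qed
    have nn2: "0 \<le> (norm (\<xi> n - L (\<xi> n)))\<^sup>2" for n by simp
    have lim: "(\<lambda>n. LINT s|\<mu>. (norm (B_adj (adjoint_state (\<xi> n) (v n) s)))\<^sup>2) \<longlonglongrightarrow> 0"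
      and lim2: "(\<lambda>n. (norm (\<xi> n - L (\<xi> n)))\<^sup>2) \<longlonglongrightarrow> 0"
    proof -
      have up: "(LINT s|\<mu>. (norm (B_adj (adjoint_state (\<xi> n) (v n) s)))\<^sup>2) \<le> 1 / real (Suc n)"
        "(norm (\<xi> n - L (\<xi> n)))\<^sup>2 \<le> 1 / real (Suc n)" for n
        using sm[of n] nn[of "\<xi> n" "v n"] nn2[of n] by linarith+
      show "(\<lambda>n. LINT s|\<mu>. (norm (B_adj (adjoint_state (\<xi> n) (v n) s)))\<^sup>2) \<longlonglongrightarrow> 0"
        by (rule tendsto_sandwich[OF _ _ tendsto_const LIMSEQ_Suc[OF lim_1_over_n]])
          (intro always_eventually allI nn, intro always_eventually allI up)
      show "(\<lambda>n. (norm (\<xi> n - L (\<xi> n)))\<^sup>2) \<longlonglongrightarrow> 0"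
        by (rule tendsto_sandwich[OF _ _ tendsto_const LIMSEQ_Suc[OF lim_1_over_n]])
          (intro always_eventually allI nn2, intro always_eventually allI up)
    qed
    obtain r where r: "strict_mono r" "(\<lambda>n. L (\<xi> (r n))) \<longlonglongrightarrow> 0"
      by (rule admissible_vanishing_subseq[of K \<xi> v 1 L, OF K adm eq_refl[OF \<xi>1] L lim]) (rule that)
    have "(\<lambda>n. norm (\<xi> n - L (\<xi> n))) \<longlonglongrightarrow> 0"
      using tendsto_real_sqrt[OF lim2] by simp
    then have "(\<lambda>n. \<xi> (r n) - L (\<xi> (r n))) \<longlonglongrightarrow> 0"
      using LIMSEQ_subseq_LIMSEQ[OF _ r(1)] tendsto_norm_zero_iff by (fastforce simp: comp_def)
    from tendsto_norm[OF tendsto_add[OF this r(2)]] have "(\<lambda>n. 1::real) \<longlonglongrightarrow> 0" by (simp add: \<xi>1)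
    then have "(1::real) = 0" by (rule LIMSEQ_unique[OF tendsto_const])
    then show False by simp
  qed
  then show thesis by (elim exE conjE) (rule that, assumption, simp)
qed

end

section \<open>The optimality system\<close>

text \<open>Constant continuation outside [0, T] places continuous functions on the interval in a
  normed space type, with the supremum norm, to which the fixed point theorem applies.\<close>

definition ext_bcontfun :: "real \<Rightarrow> (real \<Rightarrow> 'a::metric_space) \<Rightarrow> (real \<Rightarrow>\<^sub>C 'a)" where
  "ext_bcontfun T F = Bcontfun (\<lambda>t. F (max 0 (min T t)))"

lemma apply_ext_bcontfun:
  assumes "0 \<le> T" "continuous_on {0..T} F"
  shows "apply_bcontfun (ext_bcontfun T F) t = F (max 0 (min T t))"
proof -
  have sub: "(\<lambda>t. max 0 (min T t)) ` UNIV \<subseteq> {0..T}" using assms(1) by auto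
  have "continuous_on UNIV (\<lambda>t. F (max 0 (min T t)))"
    using sub by (intro continuous_on_compose2[OF assms(2)] continuous_intros) auto
  moreover have "bounded (range (\<lambda>t. F (max 0 (min T t))))"
    using sub by (intro bounded_subset[OF compact_imp_bounded[OF compact_continuous_image[OF assms(2) compact_Icc]]]) auto
  ultimately show ?thesis by (simp add: ext_bcontfun_def Bcontfun_inverse bcontfun_def)
qed

lemma ext_bcontfun_tendsto:
  assumes "0 \<le> T" "\<And>n. continuous_on {0..T} (F n)" "uniform_limit {0..T} F G sequentially"
  shows "(\<lambda>n. ext_bcontfun T (F n)) \<longlonglongrightarrow> ext_bcontfun T G"
proof (rule metric_LIMSEQ_I)
  fix e :: real assume e: "e > 0"
  have G: "continuous_on {0..T} G"
    by (rule uniform_limit_theorem[OF _ assms(3)]) (use assms(2) in auto)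
  obtain N where N: "\<And>n t. n \<ge> N \<Longrightarrow> t \<in> {0..T} \<Longrightarrow> dist (F n t) (G t) < e / 2"
    using uniform_limitD[OF assms(3) half_gt_zero[OF e]] unfolding eventually_sequentially by blast
  have "dist (ext_bcontfun T (F n)) (ext_bcontfun T G) < e" if "n \<ge> N" for n
  proof -
    have "dist (ext_bcontfun T (F n)) (ext_bcontfun T G) \<le> e / 2"
    proof (rule dist_bound)
      fix t
      have "max 0 (min T t) \<in> {0..T}" using assms(1) by auto
      then show "dist (apply_bcontfun (ext_bcontfun T (F n)) t) (apply_bcontfun (ext_bcontfun T G) t) \<le> e / 2"
        unfolding apply_ext_bcontfun[OF assms(1,2)] apply_ext_bcontfun[OF assms(1) G] using N[OF that] less_imp_le by blast
    qed
    then show ?thesis using e by simp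
  qed
  then show "\<exists>N. \<forall>n\<ge>N. dist (ext_bcontfun T (F n)) (ext_bcontfun T G) < e" by blast
qed

lemma tendsto_apply_bcontfun:
  fixes f :: "nat \<Rightarrow> (real, 'a::metric_space) bcontfun"
  assumes "f \<longlonglongrightarrow> g"
  shows "(\<lambda>n. apply_bcontfun (f n) t) \<longlonglongrightarrow> apply_bcontfun g t"
  by (rule metric_tendsto_imp_tendsto[OF assms]) (simp add: dist_bounded)

lemma uniform_limit_add_const:
  fixes F :: "nat \<Rightarrow> 'b \<Rightarrow> 'a::real_normed_vector"
  shows "uniform_limit A F G sequentially \<Longrightarrow> uniform_limit A (\<lambda>n t. c t + F n t) (\<lambda>t. c t + G t) sequentially"
  by (intro uniform_limit_add uniform_limit_const)

context compact_semigroup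
begin

lemma L1_tendsto_bounded:
  fixes w :: "nat \<Rightarrow> real \<Rightarrow> 'a::{real_normed_vector,complete_space,second_countable_topology}"
  assumes w: "\<And>n. w n \<in> borel_measurable \<mu>" "\<And>n s. s \<in> {0..T} \<Longrightarrow> norm (w n s) \<le> C"
    and lim: "\<And>s. s \<in> {0..T} \<Longrightarrow> (\<lambda>n. w n s) \<longlonglongrightarrow> v s" and v: "v \<in> borel_measurable \<mu>"
  shows "(\<lambda>n. LINT s|\<mu>. norm (w n s - v s)) \<longlonglongrightarrow> 0"
proof -
  have vC: "norm (v s) \<le> C" if "s \<in> {0..T}" for s
    using Lim_bounded[OF tendsto_norm[OF lim[OF that]], of 0 C] w(2)[OF that] by simp
  have "(\<lambda>n. LINT s|\<mu>. norm (w n s - v s)) \<longlonglongrightarrow> (LINT s|\<mu>. 0)"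
  proof (rule integral_dominated_convergence[where w = "\<lambda>_. C + C"])
    show "integrable \<mu> (\<lambda>_. C + C)" using integrable_const_lebesgue_on by blast
    show "(\<lambda>s. norm (w n s - v s)) \<in> borel_measurable \<mu>" for n
      by (rule measurable_compose[OF borel_measurable_diff[OF w(1) v] borel_measurable_norm])
    show "AE s in \<mu>. norm (norm (w n s - v s)) \<le> C + C" for n
    proof (rule AE_I2)
      fix s assume "s \<in> space \<mu>"
      then have s: "s \<in> {0..T}" by simp
      show "norm (norm (w n s - v s)) \<le> C + C"
        using add_mono[OF w(2)[OF s, of n] vC[OF s]] norm_triangle_ineq4[of "w n s" "v s"] by simp
    qed
    show "AE s in \<mu>. (\<lambda>n. norm (w n s - v s)) \<longlonglongrightarrow> 0"
    proof (rule AE_I2)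
      fix s assume "s \<in> space \<mu>"
      then have "(\<lambda>n. w n s) \<longlonglongrightarrow> v s" by (intro lim) simp
      then show "(\<lambda>n. norm (w n s - v s)) \<longlonglongrightarrow> 0" by (intro tendsto_norm_zero) (simp add: LIM_zero_iff)
    qed
  qed simp
  then show ?thesis by simp
qed

text \<open>Bounded pointwise convergence of the sources is convergence in L1, and the L1 norm
  controls the convolution uniformly in time.\<close>

lemma conv_uniform_limit:
  assumes a: "\<bar>a\<bar> = 1" and w: "\<And>n. w n \<in> borel_measurable \<mu>" "\<And>n s. s \<in> {0..T} \<Longrightarrow> norm (w n s) \<le> C"
    and lim: "\<And>s. s \<in> {0..T} \<Longrightarrow> (\<lambda>n. w n s) \<longlonglongrightarrow> v s" and v: "v \<in> borel_measurable \<mu>"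
  shows "uniform_limit {0..T} (\<lambda>n. conv R T a (w n)) (conv R T a v) sequentially"
proof (rule uniform_limitI)
  fix e :: real assume e: "e > 0"
  have vC: "norm (v s) \<le> C" if "s \<in> {0..T}" for s
    using Lim_bounded[OF tendsto_norm[OF lim[OF that]], of 0 C] w(2)[OF that] by simp
  have vi: "integrable \<mu> v" by (rule integrable_bounded_lebesgue_on[OF v vC])
  have wi: "integrable \<mu> (w n)" for n by (rule integrable_bounded_lebesgue_on[OF w])
  have "(\<lambda>n. M * (LINT s|\<mu>. norm (w n s - v s))) \<longlonglongrightarrow> M * 0"
    by (intro tendsto_mult tendsto_const L1_tendsto_bounded[OF w lim v])
  then have "(\<lambda>n. M * (LINT s|\<mu>. norm (w n s - v s))) \<longlonglongrightarrow> 0" by simp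
  from order_tendstoD(2)[OF this e]
  show "\<forall>\<^sub>F n in sequentially. \<forall>t\<in>{0..T}. dist (conv R T a (w n) t) (conv R T a v t) < e"
  proof eventually_elim
    case (elim n)
    show ?case
    proof
      fix t assume t: "t \<in> {0..T}"
      have "dist (conv R T a (w n) t) (conv R T a v t) = norm (conv R T a (\<lambda>s. w n s - v s) t)"
        unfolding conv_diff[OF a t wi vi] by (simp add: dist_norm)
      also have "\<dots> \<le> M * (LINT s|\<mu>. norm (w n s - v s))"
        by (intro norm_conv_le a t Bochner_Integration.integrable_diff wi vi)
      finally show "dist (conv R T a (w n) t) (conv R T a v t) < e" using elim by simp
    qed
  qed
qed

end

section \<open>The steering problem as a fixed point equation\<close>

text \<open>The components are the state y, the convolution part of the adjoint state p, and the
  multiplier \<open>\<phi>\<close>. The orbit part of p is reconstructed from \<open>\<phi>\<close>,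
  because its value at T is set to 0 and it may jump there.\<close>

type_synonym 'y unknown = "(real, 'y) bcontfun \<times> (real, 'y) bcontfun \<times> 'y"

text \<open>\<open>Pr_perp\<close> makes \<open>Pr\<close> the orthogonal projection onto its range.
  \<open>h\<close> stands for f + g, of which the growth bound is the quantitative input.\<close>

locale steering_problem = control_system S T M B
  for S :: "real \<Rightarrow> 'x::{real_inner,complete_space,second_countable_topology} \<Rightarrow>\<^sub>L 'x" and T M :: real
    and B :: "'u::{real_inner,complete_space,second_countable_topology} \<Rightarrow>\<^sub>L 'x" +
  fixes h :: "real \<Rightarrow> 'x \<Rightarrow> 'x" and K :: real and y0 yf :: 'x and Pr :: "'x \<Rightarrow>\<^sub>L 'x"
  assumes h_cont: "continuous_on ({0..T} \<times> UNIV) (\<lambda>(t, z). h t z)"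
    and h_growth: "\<And>t z. t \<in> {0..T} \<Longrightarrow> norm (h t z) \<le> K * (1 + norm z)"
    and K_nonneg: "0 \<le> K"
    and orbit_cont: "continuous_on {0..T} (\<lambda>t. S t y0)"
    and Pr_compact: "compact_operator Pr"
    and Pr_perp: "\<And>x z. inner (x - Pr x) (Pr z) = 0"
begin

definition k :: "real \<Rightarrow> 'x \<Rightarrow> 'x" where
  "k t z = (1 / (1 + (norm z)\<^sup>2)) *\<^sub>R h t z"

lemma h_eq_k: "h t z = (1 + (norm z)\<^sup>2) *\<^sub>R k t z"
proof -
  have "1 + (norm z)\<^sup>2 \<noteq> 0" by (smt (verit) zero_le_power2)
  then show ?thesis by (simp add: k_def)
qed

text \<open>Linear growth over a quadratic denominator: with r = norm z, both 1 + r and r + r r are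
  at most 2 (1 + r r). The second bound limits the rank-one potential whatever the size of the
  state.\<close>

lemma norm_k_le:
  assumes "t \<in> {0..T}"
  shows "norm (k t z) \<le> 2 * K" and "norm (k t z) * norm z \<le> 2 * K"
proof -
  define r where "r = norm z"
  have r: "0 \<le> r" "r \<le> 1 + r\<^sup>2"
  proof -
    show "0 \<le> r" by (simp add: r_def)
    have "0 \<le> (r - 1/2)\<^sup>2" by simp
    then show "r \<le> 1 + r\<^sup>2" by (simp add: power2_diff power_divide)
  qed
  have pos: "1 + r\<^sup>2 > 0" by (smt (verit) zero_le_power2)
  have "norm (k t z) = norm (h t z) / (1 + r\<^sup>2)" using pos by (simp add: k_def r_def)
  also have "\<dots> \<le> K * (1 + r) / (1 + r\<^sup>2)"
    using h_growth[OF assms, of z] pos by (intro divide_right_mono) (auto simp: r_def)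
  finally have 1: "norm (k t z) \<le> K * (1 + r) / (1 + r\<^sup>2)" .
  have "1 + r \<le> 2 * (1 + r\<^sup>2)" "r + r\<^sup>2 \<le> 2 * (1 + r\<^sup>2)" 
  proof -
    obtain q where q: "q = r\<^sup>2" "0 \<le> q" by simp
    then show "1 + r \<le> 2 * (1 + r\<^sup>2)" "r + r\<^sup>2 \<le> 2 * (1 + r\<^sup>2)" using r(2) unfolding q(1)[symmetric] by auto
  qed
  then have K2: "K * (1 + r) \<le> K * (2 * (1 + r\<^sup>2))" "K * (r + r\<^sup>2) \<le> K * (2 * (1 + r\<^sup>2))"
    using K_nonneg by (auto intro: mult_left_mono)
  from K2(1) have "K * (1 + r) / (1 + r\<^sup>2) \<le> 2 * K" using pos by (simp add: pos_divide_le_eq mult_ac)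
  then show "norm (k t z) \<le> 2 * K" using 1 by linarith
  have "norm (k t z) * r \<le> K * (1 + r) / (1 + r\<^sup>2) * r" by (intro mult_right_mono 1 r)
  also have "\<dots> = K * (r + r\<^sup>2) / (1 + r\<^sup>2)" by (simp add: power2_eq_square algebra_simps)
  also have "\<dots> \<le> 2 * K"
    using K2(2) pos by (simp add: pos_divide_le_eq mult_ac)
  finally show "norm (k t z) * norm z \<le> 2 * K" by (simp add: r_def)
qed

lemma k_cont: "continuous_on ({0..T} \<times> UNIV) (\<lambda>(t, z). k t z)"
proof -
  have "1 + (norm z)\<^sup>2 \<noteq> 0" for z :: 'x by (smt (verit) zero_le_power2)
  then show ?thesis
    unfolding k_def using h_cont by (auto simp: case_prod_beta' intro!: continuous_intros)
qed

definition st :: "'x unknown \<Rightarrow> real \<Rightarrow> 'x" where "st x = apply_bcontfun (fst x)"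
definition ph :: "'x unknown \<Rightarrow> 'x" where "ph x = snd (snd x)"
definition ps :: "'x unknown \<Rightarrow> real \<Rightarrow> 'x" where
  "ps x s = kern S_adj (T - s) (ph x) + apply_bcontfun (fst (snd x)) s"
text \<open>The adjoint of the rank-one potential z \<mapsto> <z, y> k(s, y), applied to p.\<close>

definition qs :: "'x unknown \<Rightarrow> real \<Rightarrow> 'x" where "qs x s = inner (ps x s) (k s (st x s)) *\<^sub>R st x s"
definition ws :: "'x unknown \<Rightarrow> real \<Rightarrow> 'x" where "ws x s = B (B_adj (ps x s)) + h s (st x s)"
definition next_state :: "'x unknown \<Rightarrow> real \<Rightarrow> 'x" where "next_state x t = S t y0 + conv S T 1 (ws x) t"

text \<open>Its fixed points are the solutions of the optimality system of the linear problem whose potential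
  \<open>\<langle>\<cdot>, y\<rangle> k(s, y)\<close> is frozen along the solution \<open>y\<close> itself.\<close>

definition step :: "real \<Rightarrow> 'x unknown \<Rightarrow> 'x unknown" where
  "step \<epsilon> x = (ext_bcontfun T (next_state x), ext_bcontfun T (conv S_adj T (-1) (qs x)),
     (1 / \<epsilon>) *\<^sub>R (yf - next_state x T) + Pr (ph x))"

lemma T_nonneg: "0 \<le> T" using T_pos by simp

lemma st_cont: "continuous_on A (st x)"
  by (simp add: st_def)

lemma comp_cont:
  assumes "continuous_on ({0..T} \<times> UNIV) (\<lambda>(t, z). F t z)"
  shows "continuous_on {0..T} (\<lambda>s. F s (st x s))"
proof -
  have "continuous_on {0..T} (\<lambda>s. (\<lambda>(t, z). F t z) (s, st x s))"
    by (rule continuous_on_compose2[OF assms]) (auto intro!: continuous_intros st_cont)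
  then show ?thesis by simp
qed

lemma comp_tendsto:
  assumes "continuous_on ({0..T} \<times> UNIV) (\<lambda>(t, z). F t z)" "s \<in> {0..T}" "u \<longlonglongrightarrow> (z :: 'x)"
  shows "(\<lambda>n. F s (u n)) \<longlonglongrightarrow> (F s z :: 'x)"
proof -
  have "(\<lambda>n. (\<lambda>(t, z). F t z) (s, u n)) \<longlonglongrightarrow> (\<lambda>(t, z). F t z) (s, z)"
    by (rule continuous_on_tendsto_compose[OF assms(1)]) (use assms in \<open>auto intro!: tendsto_intros\<close>)
  then show ?thesis by simp
qed

lemma ps_measurable: "ps x \<in> borel_measurable \<mu>"
  unfolding ps_def[abs_def]
proof (intro borel_measurable_add adj.borel_measurable_kern borel_measurable_diff borel_measurable_const)
  show "apply_bcontfun (fst (snd x)) \<in> borel_measurable \<mu>"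
    by (rule borel_measurable_continuous_lebesgue_on) simp
  show "(\<lambda>s. s) \<in> borel_measurable \<mu>" by (rule borel_measurable_id_lebesgue_on)
qed

lemma qs_measurable: "qs x \<in> borel_measurable \<mu>"
  unfolding qs_def[abs_def]
  by (intro borel_measurable_scaleR borel_measurable_inner ps_measurable
      borel_measurable_continuous_lebesgue_on[OF comp_cont[OF k_cont]] borel_measurable_continuous_lebesgue_on[OF st_cont])

lemma ws_measurable: "ws x \<in> borel_measurable \<mu>"
  unfolding ws_def[abs_def]
proof (intro borel_measurable_add borel_measurable_continuous_lebesgue_on[OF comp_cont[OF h_cont]])
  have "continuous_on UNIV (\<lambda>z. B (B_adj z))" by (intro continuous_intros)
  from measurable_compose[OF ps_measurable borel_measurable_continuous_onI[OF this]]
  show "(\<lambda>s. B (B_adj (ps x s))) \<in> borel_measurable \<mu>" .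
qed

lemma norm_components_le:
  "norm (st x s) \<le> norm x" "norm (apply_bcontfun (fst (snd x)) s) \<le> norm x" "norm (ph x) \<le> norm x"
proof -
  show "norm (st x s) \<le> norm x"
    unfolding st_def by (rule order.trans[OF norm_bounded norm_fst_le[of "fst x" "snd x", simplified]])
  have "norm (fst (snd x)) \<le> norm x" "norm (snd (snd x)) \<le> norm x"
    using norm_fst_le[of "fst (snd x)" "snd (snd x)"] norm_snd_le[of "snd (snd x)" "fst (snd x)"] norm_snd_le[of "snd x" "fst x"] by auto
  then show "norm (apply_bcontfun (fst (snd x)) s) \<le> norm x" "norm (ph x) \<le> norm x"
    unfolding ph_def using norm_bounded order.trans by blast+
qed

lemma norm_ps_le:
  assumes "norm x \<le> \<rho>" "s \<in> {0..T}"
  shows "norm (ps x s) \<le> (M + 1) * \<rho>"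
proof -
  have "norm (ps x s) \<le> M * norm (ph x) + norm x"
    unfolding ps_def using assms(2)
    by (intro order.trans[OF norm_triangle_ineq] add_mono adj.norm_kern_apply_le norm_components_le) auto
  also have "\<dots> \<le> M * \<rho> + \<rho>"
    using assms(1) order.trans[OF norm_components_le(3) assms(1)] M_nonneg by (intro add_mono mult_left_mono) auto
  finally show ?thesis by (simp add: algebra_simps)
qed

text \<open>The factor does not involve the state, so all solutions along the homotopy belong to one
  admissible class and one coercivity constant serves them all.\<close>

lemma norm_qs_le_ps:
  assumes "s \<in> {0..T}"
  shows "norm (qs x s) \<le> 2 * K * norm (ps x s)"
proof -
  have "norm (qs x s) \<le> (norm (ps x s) * norm (k s (st x s))) * norm (st x s)"
    unfolding qs_def norm_scaleR by (intro mult_right_mono Cauchy_Schwarz_ineq2) auto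
  also have "\<dots> = norm (ps x s) * (norm (k s (st x s)) * norm (st x s))" by simp
  also have "\<dots> \<le> norm (ps x s) * (2 * K)" by (intro mult_left_mono norm_k_le(2) assms) auto
  finally show ?thesis by (simp add: mult_ac)
qed

lemma norm_qs_le:
  assumes "norm x \<le> \<rho>" "s \<in> {0..T}"
  shows "norm (qs x s) \<le> 2 * K * ((M + 1) * \<rho>)"
  by (rule order.trans[OF norm_qs_le_ps[OF assms(2)] mult_left_mono[OF norm_ps_le[OF assms]]]) (use K_nonneg in simp)

lemma norm_ws_le:
  assumes "norm x \<le> \<rho>" "s \<in> {0..T}"
  shows "norm (ws x s) \<le> norm (B o\<^sub>L B_adj) * ((M + 1) * \<rho>) + K * (1 + \<rho>)"
proof -
  have "norm ((B o\<^sub>L B_adj) (ps x s)) \<le> norm (B o\<^sub>L B_adj) * ((M + 1) * \<rho>)"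
    by (rule order.trans[OF norm_blinfun mult_left_mono[OF norm_ps_le[OF assms]]]) simp
  moreover have "norm (h s (st x s)) \<le> K * (1 + \<rho>)"
    using order.trans[OF norm_components_le(1) assms(1)] K_nonneg
    by (intro order.trans[OF h_growth[OF assms(2)] mult_left_mono]) auto
  ultimately show ?thesis
    unfolding ws_def by (intro order.trans[OF norm_triangle_ineq] add_mono) auto
qed

lemma next_state_cont: "continuous_on {0..T} (next_state x)"
  unfolding next_state_def[abs_def]
  by (intro continuous_on_add orbit_cont continuous_on_conv[OF _ ws_measurable norm_ws_le[OF order_refl]]) auto

lemma qs_conv_cont: "continuous_on {0..T} (conv S_adj T (-1) (qs x))"
  by (rule adj.continuous_on_conv[OF _ qs_measurable norm_qs_le[OF order_refl]]) auto

lemma step_continuous: "continuous_on UNIV (step \<epsilon>)"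
proof (rule continuous_on_sequentiallyI)
  fix u :: "nat \<Rightarrow> 'x unknown" and x assume u: "u \<longlonglongrightarrow> x"
  obtain \<rho> where \<rho>: "\<And>n. norm (u n) \<le> \<rho>"
    using convergent_imp_Bseq[OF convergentI[OF u]] by (auto simp: Bseq_def)
  have lst: "(\<lambda>n. st (u n) s) \<longlonglongrightarrow> st x s" for s
    unfolding st_def by (intro tendsto_apply_bcontfun tendsto_fst u)
  have lph: "(\<lambda>n. ph (u n)) \<longlonglongrightarrow> ph x" unfolding ph_def by (intro tendsto_snd u)
  have lps: "(\<lambda>n. ps (u n) s) \<longlonglongrightarrow> ps x s" for s
    unfolding ps_def by (intro tendsto_add blinfun.tendsto tendsto_const lph tendsto_apply_bcontfun tendsto_fst tendsto_snd u)
  have lqs: "(\<lambda>n. qs (u n) s) \<longlonglongrightarrow> qs x s" if "s \<in> {0..T}" for s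
    unfolding qs_def by (intro tendsto_scaleR tendsto_inner lps lst comp_tendsto[OF k_cont that])
  have lws: "(\<lambda>n. ws (u n) s) \<longlonglongrightarrow> ws x s" if "s \<in> {0..T}" for s
    unfolding ws_def by (intro tendsto_add blinfun.tendsto tendsto_const lps comp_tendsto[OF h_cont that lst])
  have uw: "uniform_limit {0..T} (\<lambda>n. conv S T 1 (ws (u n))) (conv S T 1 (ws x)) sequentially"
    by (rule conv_uniform_limit[OF _ ws_measurable norm_ws_le[OF \<rho>] lws ws_measurable]) auto
  have uq: "uniform_limit {0..T} (\<lambda>n. conv S_adj T (-1) (qs (u n))) (conv S_adj T (-1) (qs x)) sequentially"
    by (rule adj.conv_uniform_limit[OF _ qs_measurable norm_qs_le[OF \<rho>] lqs qs_measurable]) auto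
  have uy: "uniform_limit {0..T} (\<lambda>n. next_state (u n)) (next_state x) sequentially"
    unfolding next_state_def[abs_def] by (rule uniform_limit_add_const[OF uw])
  have yT: "(\<lambda>n. next_state (u n) T) \<longlonglongrightarrow> next_state x T"
    by (rule tendsto_uniform_limitI[OF uy]) (use T_pos in simp)
  show "(\<lambda>n. step \<epsilon> (u n)) \<longlonglongrightarrow> step \<epsilon> x"
    unfolding step_def
    by (intro tendsto_Pair ext_bcontfun_tendsto T_nonneg next_state_cont qs_conv_cont uy uq
        tendsto_add tendsto_scaleR tendsto_diff tendsto_const yT blinfun.tendsto lph)
qed

text \<open>The two paths and the terminal value are compact through the convolutions, the remaining
  term of the multiplier through \<open>Pr_compact\<close>.\<close>

lemma step_compact: "\<exists>C. compact C \<and> step \<epsilon> ` cball 0 \<rho> \<subseteq> C"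
proof (intro exI conjI)
  show "step \<epsilon> ` cball 0 \<rho> \<subseteq> closure (step \<epsilon> ` cball 0 \<rho>)" by (rule closure_subset)
  show "compact (closure (step \<epsilon> ` cball 0 \<rho>))"
  proof (rule compact_closureI_subseq)
    fix a :: "nat \<Rightarrow> 'x unknown" assume "\<And>n. a n \<in> step \<epsilon> ` cball 0 \<rho>"
    then have "\<forall>n. \<exists>x. norm x \<le> \<rho> \<and> a n = step \<epsilon> x" by force
    then obtain x where x: "\<And>n. norm (x n) \<le> \<rho>" "\<And>n. a n = step \<epsilon> (x n)" by metis
    obtain r1 g1 where r1: "strict_mono r1" "uniform_limit {0..T} (\<lambda>n. conv S T 1 (ws (x (r1 n)))) g1 sequentially"
      by (rule conv_subseq[of 1 "\<lambda>n. ws (x n)", OF _ ws_measurable norm_ws_le[OF x(1)]]) (simp, assumption, rule that)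
    obtain r2 g2 where r2: "strict_mono r2" "uniform_limit {0..T} (\<lambda>n. conv S_adj T (-1) (qs (x (r1 (r2 n))))) g2 sequentially"
      by (rule adj.conv_subseq[of "-1" "\<lambda>n. qs (x (r1 n))", OF _ qs_measurable norm_qs_le[OF x(1)]]) (simp, assumption, rule that)
    obtain r3 z where r3: "strict_mono r3" "(\<lambda>n. Pr (ph (x (r1 (r2 (r3 n)))))) \<longlonglongrightarrow> z"
      by (rule compact_operator_subseq[OF Pr_compact, of "\<lambda>n. ph (x (r1 (r2 n)))", OF order.trans[OF norm_components_le(3) x(1)]]) (rule that)
    define r where "r n = r1 (r2 (r3 n))" for n
    have rm: "strict_mono r" using r1(1) r2(1) r3(1) by (auto simp: r_def strict_mono_def)
    have r23: "strict_mono (\<lambda>n. r2 (r3 n))" using r2(1) r3(1) by (auto simp: strict_mono_def)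
    have sub: "uniform_limit A (\<lambda>n. F (\<sigma> n)) G sequentially" if "uniform_limit A F G sequentially" "strict_mono \<sigma>"
      for A :: "real set" and F :: "nat \<Rightarrow> real \<Rightarrow> 'x" and G and \<sigma> :: "nat \<Rightarrow> nat"
      by (rule filterlim_compose[OF that(1) filterlim_subseq[OF that(2)]])
    have uw: "uniform_limit {0..T} (\<lambda>n. conv S T 1 (ws (x (r n)))) g1 sequentially"
      using sub[OF r1(2) r23] by (simp add: r_def)
    have uq: "uniform_limit {0..T} (\<lambda>n. conv S_adj T (-1) (qs (x (r n)))) g2 sequentially"
      using sub[OF r2(2) r3(1)] by (simp add: r_def)
    have uy: "uniform_limit {0..T} (\<lambda>n. next_state (x (r n))) (\<lambda>t. S t y0 + g1 t) sequentially"
      unfolding next_state_def[abs_def] by (rule uniform_limit_add_const[OF uw])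
    have yT: "(\<lambda>n. next_state (x (r n)) T) \<longlonglongrightarrow> S T y0 + g1 T"
      by (rule tendsto_uniform_limitI[OF uy]) (use T_pos in simp)
    have "(\<lambda>n. step \<epsilon> (x (r n))) \<longlonglongrightarrow> (ext_bcontfun T (\<lambda>t. S t y0 + g1 t), ext_bcontfun T g2, (1 / \<epsilon>) *\<^sub>R (yf - (S T y0 + g1 T)) + z)"
      unfolding step_def using r3(2) unfolding r_def[symmetric]
      by (intro tendsto_Pair ext_bcontfun_tendsto T_nonneg next_state_cont qs_conv_cont uy uq
        tendsto_add tendsto_scaleR tendsto_diff tendsto_const yT)
    then show "\<exists>r l. strict_mono r \<and> (\<lambda>n. a (r n)) \<longlonglongrightarrow> l" using rm x(2) by auto
  qed
qed

section \<open>A priori bounds along the homotopy\<close>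

lemma homotopy_solution:
  assumes x: "x = c *\<^sub>R step \<epsilon> x"
  shows "s \<in> {0..T} \<Longrightarrow> st x s = c *\<^sub>R next_state x s"
    and "s \<in> {0..T} \<Longrightarrow> ps x s = adjoint_state (ph x) (\<lambda>s. c *\<^sub>R qs x s) s"
    and "ph x = c *\<^sub>R ((1 / \<epsilon>) *\<^sub>R (yf - next_state x T) + Pr (ph x))"
    and "fst x = c *\<^sub>R ext_bcontfun T (next_state x)" "fst (snd x) = c *\<^sub>R ext_bcontfun T (conv S_adj T (-1) (qs x))"
proof -
  show f: "fst x = c *\<^sub>R ext_bcontfun T (next_state x)" and s: "fst (snd x) = c *\<^sub>R ext_bcontfun T (conv S_adj T (-1) (qs x))"
    using arg_cong[OF x, of fst] arg_cong[OF x, of "\<lambda>x. fst (snd x)"] by (simp_all add: step_def)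
  show "ph x = c *\<^sub>R ((1 / \<epsilon>) *\<^sub>R (yf - next_state x T) + Pr (ph x))"
    using arg_cong[OF x, of "\<lambda>x. snd (snd x)"] by (simp add: step_def ph_def)
  have cl: "max 0 (min T s) = s" if "s \<in> {0..T}" using that by auto
  show "st x s = c *\<^sub>R next_state x s" if "s \<in> {0..T}"
    unfolding st_def f by (simp add: apply_ext_bcontfun[OF T_nonneg next_state_cont] cl[OF that])
  show "ps x s = adjoint_state (ph x) (\<lambda>s. c *\<^sub>R qs x s) s" if "s \<in> {0..T}"
    unfolding ps_def adjoint_state_def adj.conv_scaleR s
    by (simp add: apply_ext_bcontfun[OF T_nonneg qs_conv_cont] cl[OF that])
qed

lemma homotopy_admissible:
  assumes x: "x = c *\<^sub>R step \<epsilon> x" and c: "0 \<le> c" "c \<le> 1"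
  shows "admissible (2 * K) (ph x) (\<lambda>s. c *\<^sub>R qs x s)"
  unfolding admissible_def
proof (intro conjI exI[of _ "2 * K * ((M + 1) * norm x)"] ballI)
  show "(\<lambda>s. c *\<^sub>R qs x s) \<in> borel_measurable \<mu>" by (intro borel_measurable_scaleR borel_measurable_const qs_measurable)
  fix s assume s: "s \<in> {0..T}"
  have le: "norm (c *\<^sub>R qs x s) \<le> norm (qs x s)" using c by (simp add: mult_left_le_one_le)
  show "norm (c *\<^sub>R qs x s) \<le> 2 * K * ((M + 1) * norm x)" by (rule order.trans[OF le norm_qs_le[OF order_refl s]])
  show "norm (c *\<^sub>R qs x s) \<le> 2 * K * norm (adjoint_state (ph x) (\<lambda>s. c *\<^sub>R qs x s) s)"
    using order.trans[OF le norm_qs_le_ps[OF s]] unfolding homotopy_solution(2)[OF x s] .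
qed

text \<open>\<open>c0\<close> is the Gronwall factor for adjoint states with potentials bounded by 2
  K. In \<open>c2\<close> the first term bounds the forcing k, the second the pairing of the free
  orbit of \<open>y0\<close> with q; these are what the cancellation in the energy estimate
  leaves.\<close>

definition c0 where "c0 = 2 * M * exp (4 * (M * (2 * K) + 1) * T)"
definition c2 where "c2 = 2 * K * (1 + M * norm y0)"

lemma c0_nonneg: "0 \<le> c0" and c2_nonneg: "0 \<le> c2"
  using M_nonneg K_nonneg by (simp_all add: c0_def c2_def)

lemma norm_ps_homotopy_le:
  assumes x: "x = c *\<^sub>R step \<epsilon> x" and c: "0 \<le> c" "c \<le> 1" and s: "s \<in> {0..T}"
  shows "norm (ps x s) \<le> c0 * norm (ph x)"
  using norm_adjoint_state_admissible_le[OF homotopy_admissible[OF x c] _ s] K_nonneg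
  unfolding homotopy_solution(2)[OF x s] by (simp add: c0_def mult_ac)

lemma integrable_norm_ps: "integrable \<mu> (\<lambda>s. norm (ps x s))"
  by (intro integrable_norm_complete integrable_bounded_lebesgue_on[OF ps_measurable norm_ps_le[OF order_refl]])

text \<open>Pair the state with the adjoint state and insert the terminal condition. The pairing of
  h with p contains norm y squared times <k, p>, which has no sign but equals <y, q> and cancels;
  the remainder is linear in p.\<close>

lemma energy_estimate:
  assumes x: "x = c *\<^sub>R step \<epsilon> x" and c: "0 \<le> c" "c \<le> 1" and \<epsilon>: "\<epsilon> > 0"
  shows "\<epsilon> * (norm (ph x))\<^sup>2 + c * (LINT s|\<mu>. (norm (B_adj (ps x s)))\<^sup>2) \<le>
     c * (inner (yf - S T y0) (ph x) + c2 * (LINT s|\<mu>. norm (ps x s))) + c * \<epsilon> * (norm (Pr (ph x)))\<^sup>2"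
proof -
  define q where "q s = c *\<^sub>R qs x s" for s
  define Ib where "Ib = (LINT s|\<mu>. (norm (B_adj (ps x s)))\<^sup>2)"
  define Ip where "Ip = (LINT s|\<mu>. norm (ps x s))"
  have qm: "q \<in> borel_measurable \<mu>" unfolding q_def[abs_def] by (intro borel_measurable_scaleR borel_measurable_const qs_measurable)
  define Cq where "Cq = c * (2 * K * ((M + 1) * norm x))"
  have qC: "norm (q s) \<le> Cq" if "s \<in> {0..T}" for s
    unfolding q_def Cq_def using mult_left_mono[OF norm_qs_le[OF order_refl that] c(1)] c by simp
  have wi: "integrable \<mu> (ws x)" by (rule integrable_bounded_lebesgue_on[OF ws_measurable norm_ws_le[OF order_refl]])
  have psa: "ps x s = adjoint_state (ph x) q s" if "s \<in> {0..T}" for s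
    unfolding q_def[abs_def] by (rule homotopy_solution(2)[OF x that])
  define a where "a s = inner (ws x s) (ps x s)" for s
  define b where "b s = inner (conv S T 1 (ws x) s) (q s)" for s
  have ai: "integrable \<mu> a"
  proof (rule integrable_bounded_lebesgue_on)
    show "a \<in> borel_measurable \<mu>" unfolding a_def[abs_def] by (intro borel_measurable_inner ws_measurable ps_measurable)
    fix s assume s: "s \<in> {0..T}"
    have "norm (a s) \<le> norm (ws x s) * norm (ps x s)" unfolding a_def using Cauchy_Schwarz_ineq2 by simp
    also have "\<dots> \<le> (norm (B o\<^sub>L B_adj) * ((M + 1) * norm x) + K * (1 + norm x)) * ((M + 1) * norm x)"
      using norm_ws_le[OF order_refl s] norm_ps_le[OF order_refl s] order.trans[OF norm_ge_zero norm_ws_le[OF order_refl s]]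
      by (intro mult_mono) auto
    finally show "norm (a s) \<le> (norm (B o\<^sub>L B_adj) * ((M + 1) * norm x) + K * (1 + norm x)) * ((M + 1) * norm x)" .
  qed
  have bi: "integrable \<mu> b"
  proof (rule integrable_bounded_lebesgue_on)
    have cc: "continuous_on {0..T} (conv S T 1 (ws x))"
      by (rule continuous_on_conv[OF _ ws_measurable norm_ws_le[OF order_refl]]) auto
    show "b \<in> borel_measurable \<mu>"
      unfolding b_def[abs_def] by (intro borel_measurable_inner qm borel_measurable_continuous_lebesgue_on[OF cc])
    fix s assume s: "s \<in> {0..T}"
    have "norm (b s) \<le> norm (conv S T 1 (ws x) s) * norm (q s)" unfolding b_def using Cauchy_Schwarz_ineq2 by simp
    also have "\<dots> \<le> (M * (LINT s|\<mu>. norm (ws x s))) * Cq"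
      using norm_conv_le[of 1 s "ws x"] s wi qC[OF s] order.trans[OF norm_ge_zero norm_conv_le[of 1 s "ws x"]]
      by (intro mult_mono) auto
    finally show "norm (b s) \<le> (M * (LINT s|\<mu>. norm (ws x s))) * Cq" .
  qed
  have "inner (conv S T 1 (ws x) T) (ph x) = (LINT s|\<mu>. inner (ws x s) (adjoint_state (ph x) q s)) - (LINT s|\<mu>. b s)"
    unfolding b_def by (rule state_adjoint_pairing[OF wi qm qC])
  also have "(LINT s|\<mu>. inner (ws x s) (adjoint_state (ph x) q s)) = (LINT s|\<mu>. a s)"
    unfolding a_def by (rule Bochner_Integration.integral_cong) (simp_all add: psa)
  also have "(LINT s|\<mu>. a s) - (LINT s|\<mu>. b s) = (LINT s|\<mu>. a s - b s)"
    by (rule Bochner_Integration.integral_diff[OF ai bi, symmetric])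
  finally have pair: "inner (conv S T 1 (ws x) T) (ph x) = (LINT s|\<mu>. a s - b s)" .
  have Bi: "integrable \<mu> (\<lambda>s. (norm (B_adj (ps x s)))\<^sup>2)"
  proof (rule integrable_norm_power2)
    show "(\<lambda>s. B_adj (ps x s)) \<in> borel_measurable \<mu>"
      by (rule measurable_compose[OF ps_measurable borel_measurable_blinfun_apply])
    show "norm (B_adj (ps x s)) \<le> norm B_adj * ((M + 1) * norm x)" if "s \<in> {0..T}" for s
      by (rule order.trans[OF norm_blinfun mult_left_mono[OF norm_ps_le[OF order_refl that]]]) simp
  qed
  have "Ib - c2 * Ip = (LINT s|\<mu>. (norm (B_adj (ps x s)))\<^sup>2 - c2 * norm (ps x s))"
    unfolding Ib_def Ip_def using Bi integrable_norm_ps by simp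
  also have "\<dots> \<le> (LINT s|\<mu>. a s - b s)"
  proof (rule integral_mono_lebesgue_on)
    fix s assume s: "s \<in> {0..T}"
    \<comment> \<open>The source of p carries the factor c, while y is c times
      \<open>next_state\<close>. Moving c onto the convolution turns it into y minus a free orbit,
      which is what makes the cancellation exact for every c.\<close>
    have cv: "c *\<^sub>R conv S T 1 (ws x) s = st x s - c *\<^sub>R S s y0"
      unfolding homotopy_solution(1)[OF x s] next_state_def by (simp add: scaleR_add_right)
    have bs: "b s = inner (st x s) (qs x s) - c * inner (S s y0) (qs x s)"
    proof -
      have "b s = inner (c *\<^sub>R conv S T 1 (ws x) s) (qs x s)" by (simp add: b_def q_def)
      then show ?thesis by (simp add: cv inner_diff_left)
    qed
    have as: "a s = (norm (B_adj (ps x s)))\<^sup>2 + (1 + (norm (st x s))\<^sup>2) * inner (k s (st x s)) (ps x s)"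
    proof -
      have "inner (B (B_adj (ps x s))) (ps x s) = (norm (B_adj (ps x s)))\<^sup>2"
        unfolding power2_norm_eq_inner by (rule hilbert_adjoint)
      moreover have "inner (h s (st x s)) (ps x s) = (1 + (norm (st x s))\<^sup>2) * inner (k s (st x s)) (ps x s)"
        by (subst h_eq_k) (rule inner_scaleR_left)
      ultimately show ?thesis by (simp only: a_def ws_def inner_add_left)
    qed
    have yq: "inner (st x s) (qs x s) = (norm (st x s))\<^sup>2 * inner (k s (st x s)) (ps x s)"
      by (simp add: qs_def power2_norm_eq_inner inner_commute)
    have ab: "a s - b s = (norm (B_adj (ps x s)))\<^sup>2 + (inner (k s (st x s)) (ps x s) + c * inner (S s y0) (qs x s))"
      unfolding bs as yq by (simp add: algebra_simps)
    have 1: "\<bar>inner (k s (st x s)) (ps x s)\<bar> \<le> 2 * K * norm (ps x s)"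
      by (rule order.trans[OF Cauchy_Schwarz_ineq2 mult_right_mono[OF norm_k_le(1)[OF s]]]) simp
    have "\<bar>inner (S s y0) (qs x s)\<bar> \<le> norm (S s y0) * norm (qs x s)" by (rule Cauchy_Schwarz_ineq2)
    also have "\<dots> \<le> (M * norm y0) * (2 * K * norm (ps x s))"
      using bound[of s] s M_nonneg
      by (intro mult_mono norm_qs_le_ps[OF s] order.trans[OF norm_blinfun mult_right_mono]) auto
    finally have "c * \<bar>inner (S s y0) (qs x s)\<bar> \<le> 1 * ((M * norm y0) * (2 * K * norm (ps x s)))"
      using c by (intro mult_mono) auto
    then have 2: "\<bar>c * inner (S s y0) (qs x s)\<bar> \<le> (M * norm y0) * (2 * K * norm (ps x s))"
      using c by (simp add: abs_mult)
    have "c2 * norm (ps x s) = 2 * K * norm (ps x s) + (M * norm y0) * (2 * K * norm (ps x s))"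
      by (simp add: c2_def algebra_simps)
    then show "(norm (B_adj (ps x s)))\<^sup>2 - c2 * norm (ps x s) \<le> a s - b s"
      unfolding ab using 1 2 by linarith
  qed (intro Bochner_Integration.integrable_diff Bi integrable_mult_right integrable_norm_ps ai bi)+
  finally have low: "Ib - c2 * Ip \<le> inner (conv S T 1 (ws x) T) (ph x)" unfolding pair .
  \<comment> \<open>The equation for the multiplier, cleared of 1 / \<epsilon>: at c = 1 it is the
    terminal condition y T + \<epsilon> (\<phi> - Pr \<phi>) = yf.\<close>
  have "\<epsilon> *\<^sub>R ph x = c *\<^sub>R (yf - next_state x T) + (c * \<epsilon>) *\<^sub>R Pr (ph x)"
    using arg_cong[OF homotopy_solution(3)[OF x], of "\<lambda>z. \<epsilon> *\<^sub>R z"] \<epsilon> by (simp add: scaleR_add_right mult.commute)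
  then have "inner (\<epsilon> *\<^sub>R ph x) (ph x) = inner (c *\<^sub>R (yf - next_state x T) + (c * \<epsilon>) *\<^sub>R Pr (ph x)) (ph x)" by simp
  moreover have "inner (Pr (ph x)) (ph x) = (norm (Pr (ph x)))\<^sup>2"
    using Pr_perp[of "ph x" "ph x"]
    by (simp add: inner_diff_left power2_norm_eq_inner inner_commute[of "Pr (ph x)" "ph x"])
  ultimately have id: "\<epsilon> * (norm (ph x))\<^sup>2 = c * (inner (yf - S T y0) (ph x) - inner (conv S T 1 (ws x) T) (ph x)) + c * \<epsilon> * (norm (Pr (ph x)))\<^sup>2"
    by (simp add: next_state_def inner_add_left inner_diff_left power2_norm_eq_inner algebra_simps)
  have "c * (Ib - c2 * Ip) \<le> c * inner (conv S T 1 (ws x) T) (ph x)" by (rule mult_left_mono[OF low c(1)])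
  then show ?thesis unfolding id Ib_def[symmetric] Ip_def[symmetric] by (simp add: algebra_simps)
qed

lemma norm_Pr_decomp: "(norm x)\<^sup>2 = (norm (x - Pr x))\<^sup>2 + (norm (Pr x))\<^sup>2"
proof -
  have "inner x (Pr x) = inner (Pr x) (Pr x)" using Pr_perp[of x x] by (simp add: inner_diff_left)
  then show ?thesis
    unfolding power2_norm_eq_inner by (simp add: inner_diff_left inner_diff_right inner_commute[of "Pr x" x])
qed

lemma integral_norm_ps_homotopy_le:
  assumes x: "x = c *\<^sub>R step \<epsilon> x" and c: "0 \<le> c" "c \<le> 1"
  shows "(LINT s|\<mu>. norm (ps x s)) \<le> T * c0 * norm (ph x)"
proof -
  have "(LINT s|\<mu>. norm (ps x s)) \<le> (LINT s|\<mu>. c0 * norm (ph x))"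
    using integrable_const_lebesgue_on
    by (intro integral_mono_lebesgue_on integrable_norm_ps norm_ps_homotopy_le[OF x c]) auto
  also have "\<dots> = T * (c0 * norm (ph x))" using T_nonneg by (rule integral_const_lebesgue_on)
  finally show ?thesis by (simp add: mult.assoc)
qed

definition c1 where "c1 = norm (yf - S T y0) + c2 * (T * c0)"

lemma c1_nonneg: "0 \<le> c1"
  using c2_nonneg c0_nonneg T_nonneg by (simp add: c1_def)

lemma energy_rhs_le:
  assumes x: "x = c *\<^sub>R step \<epsilon> x" and c: "0 \<le> c" "c \<le> 1"
  shows "inner (yf - S T y0) (ph x) + c2 * (LINT s|\<mu>. norm (ps x s)) \<le> c1 * norm (ph x)"
proof -
  have "c2 * (LINT s|\<mu>. norm (ps x s)) \<le> c2 * (T * c0 * norm (ph x))"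
    by (rule mult_left_mono[OF integral_norm_ps_homotopy_le[OF x c] c2_nonneg])
  then show ?thesis using norm_cauchy_schwarz[of "yf - S T y0" "ph x"] by (simp add: c1_def algebra_simps)
qed

text \<open>The multiplier is the hard component. Once it is bounded, the adjoint state is bounded
  by \<open>c0\<close>, hence so is the control, and Gronwall with the growth of h bounds the
  state.\<close>

lemma homotopy_bound:
  assumes \<epsilon>: "\<epsilon> > 0"
  obtains \<rho> where "\<And>x c. \<lbrakk>0 \<le> c; c \<le> 1; x = c *\<^sub>R step \<epsilon> x\<rbrakk> \<Longrightarrow> norm x < \<rho>"
proof -
  obtain c3 where c3: "c3 > 0" "\<And>\<phi> q. admissible (2 * K) \<phi> q \<Longrightarrow>
     c3 * (norm \<phi>)\<^sup>2 \<le> (norm (\<phi> - Pr \<phi>))\<^sup>2 + (LINT s|\<mu>. (norm (B_adj (adjoint_state \<phi> q s)))\<^sup>2)"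
    by (rule coercivity[of "2 * K" Pr, OF _ Pr_compact]) (use K_nonneg in simp, rule that)
  \<comment> \<open>The sum of the two bounds found below, for c > 1/2 and for c \<le> 1/2.\<close>
  define r1 where "r1 = (1 / \<epsilon> + 2) * c1 / c3 + 2 * c1 / \<epsilon>"
  have phb: "norm (ph x) \<le> r1" if c: "0 \<le> c" "c \<le> 1" and x: "x = c *\<^sub>R step \<epsilon> x" for x c
  proof -
    define n where "n = norm (ph x)"
    define d where "d = (norm (ph x - Pr (ph x)))\<^sup>2"
    define e where "e = (norm (Pr (ph x)))\<^sup>2"
    define Ib where "Ib = (LINT s|\<mu>. (norm (B_adj (ps x s)))\<^sup>2)"
    have nde: "n\<^sup>2 = d + e" unfolding n_def d_def e_def by (rule norm_Pr_decomp)
    have nn: "0 \<le> n" "0 \<le> d" "0 \<le> e" "0 \<le> Ib"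
      unfolding n_def d_def e_def Ib_def by (auto intro!: integral_nonneg_AE AE_I2)
    have "c * (inner (yf - S T y0) (ph x) + c2 * (LINT s|\<mu>. norm (ps x s))) \<le> c * (c1 * n)"
      unfolding n_def by (rule mult_left_mono[OF energy_rhs_le[OF x c] c(1)])
    moreover have "c * (c1 * n) \<le> 1 * (c1 * n)" using c nn c1_nonneg by (intro mult_right_mono) auto
    ultimately have E: "\<epsilon> * n\<^sup>2 + c * Ib \<le> c1 * n + c * \<epsilon> * e"
      using energy_estimate[OF x c \<epsilon>] unfolding n_def Ib_def e_def by linarith
    have pos: "0 \<le> (1 / \<epsilon> + 2) * c1 / c3" "0 \<le> 2 * c1 / \<epsilon>" using c1_nonneg c3(1) \<epsilon> by auto
    show "norm (ph x) \<le> r1"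
    proof (cases "n = 0")
      case True
      then show ?thesis using pos by (simp add: n_def r1_def)
    next
      case False
      then have n0: "n > 0" using nn by simp
      show ?thesis
      \<comment> \<open>For small c the projection term on the right is at most half of the left
        side and is absorbed. For larger c the control keeps weight at least 1/2; the projection
        term cancels up to the orthogonal component, and coercivity closes the estimate.\<close>
      proof (cases "c \<le> 1/2")
        case True
        have "c * \<epsilon> * e \<le> 1/2 * \<epsilon> * n\<^sup>2" using True nn nde \<epsilon> c by (intro mult_mono) auto
        moreover have "0 \<le> c * Ib" using c nn by simp
        ultimately have "\<epsilon> * n\<^sup>2 \<le> 2 * c1 * n" using E by linarith
        then have "(\<epsilon> * n) * n \<le> (2 * c1) * n" by (simp add: power2_eq_square mult.assoc)
        then have "\<epsilon> * n \<le> 2 * c1" using n0 by simp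
        then have "n \<le> 2 * c1 / \<epsilon>" using \<epsilon> by (simp add: pos_le_divide_eq mult.commute)
        then show ?thesis using pos by (simp add: n_def r1_def)
      next
        case False
        have "c * \<epsilon> * e \<le> 1 * \<epsilon> * e" using c nn \<epsilon> by (intro mult_right_mono) auto
        moreover have "1/2 * Ib \<le> c * Ib" using False nn by (intro mult_right_mono) auto
        moreover have "\<epsilon> * n\<^sup>2 = \<epsilon> * d + \<epsilon> * e" unfolding nde by (simp add: distrib_left)
        ultimately have F: "\<epsilon> * d + 1/2 * Ib \<le> c1 * n" using E by linarith
        have "0 \<le> \<epsilon> * d" using \<epsilon> nn by simp
        then have "Ib \<le> 2 * (c1 * n)" "\<epsilon> * d \<le> c1 * n" using F nn by linarith+
        moreover from this(2) have "d \<le> c1 * n / \<epsilon>" using \<epsilon> by (simp add: pos_le_divide_eq mult.commute)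
        moreover have "c3 * n\<^sup>2 \<le> d + Ib"
        proof -
          have "Ib = (LINT s|\<mu>. (norm (B_adj (adjoint_state (ph x) (\<lambda>s. c *\<^sub>R qs x s) s)))\<^sup>2)"
            unfolding Ib_def by (rule Bochner_Integration.integral_cong) (simp_all add: homotopy_solution(2)[OF x])
          then show ?thesis unfolding n_def d_def using c3(2)[OF homotopy_admissible[OF x c]] by simp
        qed
        ultimately have "c3 * n\<^sup>2 \<le> c1 * n / \<epsilon> + 2 * (c1 * n)" by linarith
        then have "(c3 * n) * n \<le> ((1 / \<epsilon> + 2) * c1) * n" by (simp add: power2_eq_square algebra_simps)
        then have "c3 * n \<le> (1 / \<epsilon> + 2) * c1" using n0 by simp
        then have "n \<le> (1 / \<epsilon> + 2) * c1 / c3" using c3(1) by (simp add: pos_le_divide_eq mult.commute)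
        then show ?thesis using pos by (simp add: n_def r1_def)
      qed
    qed
  qed
  \<comment> \<open>The second component is p minus its orbit part, hence c0 + M. \<open>C\<close>
    is the free term in Gronwall's inequality for the state, from the initial value, the control and
    the constant part of the growth bound.\<close>
  define r2 where "r2 = (c0 + M) * r1"
  define C where "C = M * norm y0 + M * (T * (norm (B o\<^sub>L B_adj) * (c0 * r1) + K))"
  define r3 where "r3 = 2 * C * exp (4 * (M * K + 1) * T)"
  have all: "norm x \<le> r3 + (r2 + r1)" if c: "0 \<le> c" "c \<le> 1" and x: "x = c *\<^sub>R step \<epsilon> x" for x c
  proof -
    have ph: "norm (ph x) \<le> r1" by (rule phb[OF c x])
    have r1: "0 \<le> r1" using order.trans[OF norm_ge_zero ph] .
    have psb: "norm (ps x s) \<le> c0 * r1" if "s \<in> {0..T}" for s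
      by (rule order.trans[OF norm_ps_homotopy_le[OF x c that] mult_left_mono[OF ph c0_nonneg]])
    have clamp: "max 0 (min T t) \<in> {0..T}" for t using T_nonneg by auto
    have P: "norm (fst (snd x)) \<le> r2"
    proof (rule norm_bound)
      fix t
      define s where "s = max 0 (min T t)"
      have s: "s \<in> {0..T}" unfolding s_def by (rule clamp)
      have cl: "max 0 (min T s) = s" using s by auto
      have "apply_bcontfun (fst (snd x)) t = apply_bcontfun (fst (snd x)) s"
        unfolding homotopy_solution(5)[OF x] by (simp add: apply_ext_bcontfun[OF T_nonneg qs_conv_cont] cl flip: s_def)
      also have "\<dots> = ps x s - kern S_adj (T - s) (ph x)" by (simp add: ps_def)
      also have "norm \<dots> \<le> c0 * r1 + M * r1"
        using s by (intro order.trans[OF norm_triangle_ineq4] add_mono psb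
             order.trans[OF adj.norm_kern_apply_le mult_left_mono[OF ph M_nonneg]]) auto
      finally show "norm (apply_bcontfun (fst (snd x)) t) \<le> r2" by (simp add: r2_def distrib_right)
    qed
    have C0: "0 \<le> C" unfolding C_def using M_nonneg T_nonneg K_nonneg c0_nonneg r1 by simp
    have sti: "integrable \<mu> (\<lambda>s. norm (st x s))"
      using borel_measurable_continuous_lebesgue_on[OF st_cont] norm_components_le(1)
      by (intro integrable_norm_complete integrable_bounded_lebesgue_on)
    define b where "b = norm (B o\<^sub>L B_adj) * (c0 * r1) + K"
    have b0: "0 \<le> b" unfolding b_def using K_nonneg c0_nonneg r1 by simp
    have le: "norm (st x t) \<le> C + (M * K + 1) * (LINT s|\<mu>. indicat_real {s. 0 < 1 * (t - s)} s * norm (st x s))"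
      if t: "t \<in> {0..T}" for t
    proof -
      let ?I = "\<lambda>f. LINT s|\<mu>. indicat_real {s. 0 < 1 * (t - s)} s * f s"
      have wsi: "integrable \<mu> (ws x)" by (rule integrable_bounded_lebesgue_on[OF ws_measurable norm_ws_le[OF order_refl]])
      have bi: "integrable \<mu> (\<lambda>s. b)" using integrable_const_lebesgue_on by blast
      have wsb: "norm (ws x s) \<le> b + K * norm (st x s)" if s: "s \<in> {0..T}" for s
      proof -
        have "norm ((B o\<^sub>L B_adj) (ps x s)) \<le> norm (B o\<^sub>L B_adj) * (c0 * r1)"
          by (rule order.trans[OF norm_blinfun mult_left_mono[OF psb[OF s]]]) simp
        then show ?thesis using h_growth[OF s, of "st x s"] norm_triangle_ineq[of "B (B_adj (ps x s))" "h s (st x s)"]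
          by (simp add: ws_def b_def algebra_simps)
      qed
      have Ii: "integrable \<mu> (\<lambda>s. indicat_real {s. 0 < 1 * (t - s)} s * norm (st x s))" by (intro integrable_indicator_halfline sti)
      have "norm (conv S T 1 (ws x) t) \<le> M * ?I (\<lambda>s. norm (ws x s))"
        by (rule norm_conv_halfline_le) (use t wsi in auto)
      also have "\<dots> \<le> M * (LINT s|\<mu>. b + K * (indicat_real {s. 0 < 1 * (t - s)} s * norm (st x s)))"
      proof (rule mult_left_mono[OF integral_mono_lebesgue_on M_nonneg])
        show "integrable \<mu> (\<lambda>s. indicat_real {s. 0 < 1 * (t - s)} s * norm (ws x s))"
          by (intro integrable_indicator_halfline integrable_norm_complete wsi)
        show "integrable \<mu> (\<lambda>s. b + K * (indicat_real {s. 0 < 1 * (t - s)} s * norm (st x s)))"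
          by (rule Bochner_Integration.integrable_add[OF bi integrable_mult_right[OF Ii]])
        fix s assume "s \<in> {0..T}"
        from wsb[OF this] show "indicat_real {s. 0 < 1 * (t - s)} s * norm (ws x s) \<le> b + K * (indicat_real {s. 0 < 1 * (t - s)} s * norm (st x s))"
          using b0 K_nonneg by (auto simp: indicator_def)
      qed
      also have "(LINT s|\<mu>. b + K * (indicat_real {s. 0 < 1 * (t - s)} s * norm (st x s))) = T * b + K * ?I (\<lambda>s. norm (st x s))"
        unfolding Bochner_Integration.integral_add[OF bi integrable_mult_right[OF Ii]] integral_const_lebesgue_on[OF T_nonneg] by simp
      finally have cb: "norm (conv S T 1 (ws x) t) \<le> M * (T * b + K * ?I (\<lambda>s. norm (st x s)))" .
      have I0: "0 \<le> ?I (\<lambda>s. norm (st x s))" by (intro integral_nonneg_AE AE_I2) simp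
      have "norm (st x t) \<le> norm (next_state x t)"
        unfolding homotopy_solution(1)[OF x t] using c by (simp add: mult_left_le_one_le)
      also have "\<dots> \<le> M * norm y0 + M * (T * b + K * ?I (\<lambda>s. norm (st x s)))"
        unfolding next_state_def using bound[of t] t
        by (intro order.trans[OF norm_triangle_ineq] add_mono cb order.trans[OF norm_blinfun mult_right_mono]) auto
      also have "\<dots> \<le> C + (M * K + 1) * ?I (\<lambda>s. norm (st x s))"
        using I0 by (simp add: C_def b_def algebra_simps)
      finally show ?thesis .
    qed
    have MK: "0 < M * K + 1" using M_nonneg K_nonneg by (simp add: add_nonneg_pos)
    have stm: "(\<lambda>s. norm (st x s)) \<in> borel_measurable \<mu>"
      by (rule measurable_compose[OF borel_measurable_continuous_lebesgue_on[OF st_cont] borel_measurable_norm])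
    have stb: "norm (st x t) \<le> r3" if "t \<in> {0..T}" for t
      unfolding r3_def by (rule gronwall_bounded[OF _ MK C0 stm _ norm_components_le(1) le that]) auto
    have Y: "norm (fst x) \<le> r3"
    proof (rule norm_bound)
      fix t
      have cl: "max 0 (min T (max 0 (min T t))) = max 0 (min T t)" using T_nonneg by auto
      have "apply_bcontfun (fst x) t = st x (max 0 (min T t))"
        unfolding st_def homotopy_solution(4)[OF x] by (simp add: apply_ext_bcontfun[OF T_nonneg next_state_cont] cl)
      then show "norm (apply_bcontfun (fst x) t) \<le> r3" using stb[OF clamp] by simp
    qed
    have "norm x \<le> norm (fst x) + (norm (fst (snd x)) + norm (snd (snd x)))"
      using norm_Pair_le[of "fst x" "snd x"] norm_Pair_le[of "fst (snd x)" "snd (snd x)"] by simp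
    then show ?thesis using Y P ph unfolding ph_def by linarith
  qed
  show thesis
  proof (rule that)
    fix x c assume "0 \<le> c" "c \<le> 1" "x = c *\<^sub>R step \<epsilon> x"
    from all[OF this] show "norm x < r3 + (r2 + r1) + 1" by linarith
  qed
qed

section \<open>From fixed points to steering controls\<close>

lemma fixed_point: "\<epsilon> > 0 \<Longrightarrow> \<exists>x. step \<epsilon> x = x"
proof -
  assume "\<epsilon> > 0"
  from homotopy_bound[OF this] obtain \<rho> where "\<And>x c. \<lbrakk>0 \<le> c; c \<le> 1; x = c *\<^sub>R step \<epsilon> x\<rbrakk> \<Longrightarrow> norm x < \<rho>" by blast
  then show ?thesis by (rule schaefer_fixed_point[OF step_continuous step_compact])
qed

text \<open>The terminal error is a multiple of \<phi> - Pr \<phi>, which \<open>Pr\<close>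
  annihilates, so the projected target is hit exactly for every \<epsilon>; only the norm of the
  error depends on \<epsilon>.\<close>

lemma fixed_point_mild_solution:
  assumes x: "step \<epsilon> x = x" and \<epsilon>: "\<epsilon> > 0"
  shows "L2_on T (\<lambda>s. B_adj (ps x s))" "mild_solution S B h T y0 (\<lambda>s. B_adj (ps x s)) (st x)"
    "st x T - yf = - (\<epsilon> *\<^sub>R (ph x - Pr (ph x)))" "Pr (st x T) = Pr yf"
proof -
  have x1: "x = 1 *\<^sub>R step \<epsilon> x" using x by simp
  have Bm: "(\<lambda>s. B_adj (ps x s)) \<in> borel_measurable \<mu>"
    by (rule measurable_compose[OF ps_measurable borel_measurable_blinfun_apply])
  have Bb: "norm (B_adj (ps x s)) \<le> norm B_adj * ((M + 1) * norm x)" if "s \<in> {0..T}" for s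
    by (rule order.trans[OF norm_blinfun mult_left_mono[OF norm_ps_le[OF order_refl that]]]) simp
  show "L2_on T (\<lambda>s. B_adj (ps x s))"
    unfolding L2_on_def by (intro conjI Bm integrable_norm_power2[OF Bm Bb])
  have wsi: "integrable \<mu> (ws x)" by (rule integrable_bounded_lebesgue_on[OF ws_measurable norm_ws_le[OF order_refl]])
  show "mild_solution S B h T y0 (\<lambda>s. B_adj (ps x s)) (st x)"
    unfolding mild_solution_def
  proof (intro conjI ballI st_cont)
    fix t assume t: "t \<in> {0..T}"
    have "integrable \<mu> (\<lambda>s. kern S (t - s) (ws x s))" using integrable_kern[of 1 t "ws x"] t wsi by simp
    then show "integrable (lebesgue_on {0..t}) (\<lambda>s. S (t - s) (B (B_adj (ps x s)) + h s (st x s)))"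
      using mild_integral_iff_conv(1)[OF t ws_measurable] by (simp add: ws_def)
    show "st x t = S t y0 + integral\<^sup>L (lebesgue_on {0..t}) (\<lambda>s. S (t - s) (B (B_adj (ps x s)) + h s (st x s)))"
      using homotopy_solution(1)[OF x1 t] mild_integral_iff_conv(2)[OF t ws_measurable] by (simp add: next_state_def ws_def)
  qed
  have sT: "st x T = next_state x T" using homotopy_solution(1)[OF x1, of T] T_pos by simp
  have e: "\<epsilon> *\<^sub>R ph x = (yf - st x T) + \<epsilon> *\<^sub>R Pr (ph x)"
    using arg_cong[OF homotopy_solution(3)[OF x1], of "\<lambda>z. \<epsilon> *\<^sub>R z"] \<epsilon> by (simp add: scaleR_add_right sT)
  then have e1: "yf - st x T = \<epsilon> *\<^sub>R ph x - \<epsilon> *\<^sub>R Pr (ph x)" by (simp add: algebra_simps)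
  have "st x T - yf = - (yf - st x T)" by simp
  also have "\<dots> = - (\<epsilon> *\<^sub>R (ph x - Pr (ph x)))" unfolding e1 by (simp only: scaleR_diff_right)
  finally show fin: "st x T - yf = - (\<epsilon> *\<^sub>R (ph x - Pr (ph x)))" .
  define d where "d = ph x - Pr (ph x)"
  have "inner d (Pr d) = 0" unfolding d_def by (rule Pr_perp)
  then have "Pr d = 0" using Pr_perp[of d d] by (simp add: inner_diff_left)
  then have "Pr (st x T - yf) = 0" unfolding fin d_def[symmetric] by (simp add: blinfun.minus_right blinfun.scaleR_right)
  then show "Pr (st x T) = Pr yf" by (simp add: blinfun.diff_right)
qed

text \<open>For fixed points of \<open>step \<epsilon>\<close> with \<open>\<epsilon> \<rightarrow> 0\<close> the rescaled multipliers \<open>\<epsilon> *\<^sub>R ph x\<close> tend weakly to \<open>0\<close> along a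
  subsequence, and the energy estimate turns this into norm convergence of their components orthogonal
  to the range of \<open>Pr\<close>, which are the errors \<open>yf - y T\<close>.\<close>

theorem finite_approximate_steering:
  assumes "\<delta> > 0"
  shows "\<exists>u y. L2_on T u \<and> mild_solution S B h T y0 u y \<and> norm (y T - yf) < \<delta> \<and> Pr (y T) = Pr yf"
proof -
  define \<epsilon> where "\<epsilon> n = 1 / real (Suc n)" for n
  have \<epsilon>: "\<epsilon> n > 0" "\<epsilon> n \<le> 1" for n by (auto simp: \<epsilon>_def)
  have \<epsilon>0: "\<epsilon> \<longlonglongrightarrow> 0" unfolding \<epsilon>_def[abs_def] by (rule LIMSEQ_Suc[OF lim_1_over_n])
  obtain x where x: "\<And>n. step (\<epsilon> n) (x n) = x n" using fixed_point[OF \<epsilon>(1)] by metis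
  have x1: "x n = 1 *\<^sub>R step (\<epsilon> n) (x n)" for n using x by simp
  define \<psi> where "\<psi> n = \<epsilon> n *\<^sub>R ph (x n)" for n
  define q where "q n s = \<epsilon> n *\<^sub>R (1 *\<^sub>R qs (x n) s)" for n s
  have adm: "admissible (2 * K) (\<psi> n) (q n)" for n
    unfolding \<psi>_def q_def[abs_def] by (rule admissible_scaleR[OF homotopy_admissible[OF x1]]) auto
  have as: "adjoint_state (\<psi> n) (q n) s = \<epsilon> n *\<^sub>R ps (x n) s" if "s \<in> {0..T}" for n s
    unfolding \<psi>_def q_def[abs_def] homotopy_solution(2)[OF x1 that]
    by (rule admissible_scaleR[OF homotopy_admissible[OF x1]]) auto
  define Ib where "Ib n = (LINT s|\<mu>. (norm (B_adj (adjoint_state (\<psi> n) (q n) s)))\<^sup>2)" for n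
  define Ip where "Ip n = (LINT s|\<mu>. norm (adjoint_state (\<psi> n) (q n) s))" for n
  define v where "v = yf - S T y0"
  have Ib0: "0 \<le> Ib n" for n unfolding Ib_def by (intro integral_nonneg_AE AE_I2) auto
  have Ipe: "Ip n = \<epsilon> n * (LINT s|\<mu>. norm (ps (x n) s))" for n
  proof -
    have "Ip n = (LINT s|\<mu>. \<epsilon> n * norm (ps (x n) s))"
      unfolding Ip_def using \<epsilon>(1)[of n] by (intro Bochner_Integration.integral_cong) (simp_all add: as)
    then show ?thesis by simp
  qed
  have Ibe: "Ib n = (\<epsilon> n)\<^sup>2 * (LINT s|\<mu>. (norm (B_adj (ps (x n) s)))\<^sup>2)" for n
  proof -
    have "Ib n = (LINT s|\<mu>. (\<epsilon> n)\<^sup>2 * (norm (B_adj (ps (x n) s)))\<^sup>2)"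
      unfolding Ib_def using \<epsilon>(1)[of n]
      by (intro Bochner_Integration.integral_cong) (simp_all add: as blinfun.scaleR_right power_mult_distrib)
    then show ?thesis by simp
  qed
  \<comment> \<open>The estimate at c = 1, multiplied by \<epsilon> squared. By Pythagoras the
    projection term on the right removes the \<open>Pr\<close> component on the left.\<close>
  have energy: "\<epsilon> n * (norm (\<psi> n - Pr (\<psi> n)))\<^sup>2 + Ib n \<le> \<epsilon> n * (inner v (\<psi> n) + c2 * Ip n)" for n
  proof -
    define J where "J = (LINT s|\<mu>. (norm (B_adj (ps (x n) s)))\<^sup>2)"
    define I where "I = (LINT s|\<mu>. norm (ps (x n) s))"
    have "\<epsilon> n * (norm (ph (x n)))\<^sup>2 + J \<le> inner v (ph (x n)) + c2 * I + \<epsilon> n * (norm (Pr (ph (x n))))\<^sup>2"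
      using energy_estimate[OF x1 _ _ \<epsilon>(1), of n] unfolding J_def I_def v_def by simp
    then have "\<epsilon> n * (norm (ph (x n) - Pr (ph (x n))))\<^sup>2 + J \<le> inner v (ph (x n)) + c2 * I"
      unfolding norm_Pr_decomp[of "ph (x n)"] by (simp add: distrib_left)
    then have "(\<epsilon> n)\<^sup>2 * (\<epsilon> n * (norm (ph (x n) - Pr (ph (x n))))\<^sup>2 + J) \<le> (\<epsilon> n)\<^sup>2 * (inner v (ph (x n)) + c2 * I)"
      by (rule mult_left_mono) simp
    moreover have "\<psi> n - Pr (\<psi> n) = \<epsilon> n *\<^sub>R (ph (x n) - Pr (ph (x n)))"
      by (simp add: \<psi>_def blinfun.scaleR_right scaleR_diff_right)
    then have "(norm (\<psi> n - Pr (\<psi> n)))\<^sup>2 = (\<epsilon> n)\<^sup>2 * (norm (ph (x n) - Pr (ph (x n))))\<^sup>2"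
      by (simp add: power_mult_distrib)
    ultimately show ?thesis unfolding Ibe Ipe J_def[symmetric] I_def[symmetric]
      by (simp add: \<psi>_def power2_eq_square algebra_simps)
  qed
  have rhs: "inner v (\<psi> n) + c2 * Ip n \<le> c1 * norm (\<psi> n)" for n
  proof -
    have "\<epsilon> n * (inner v (ph (x n)) + c2 * (LINT s|\<mu>. norm (ps (x n) s))) \<le> \<epsilon> n * (c1 * norm (ph (x n)))"
      unfolding v_def using energy_rhs_le[OF x1, of n] \<epsilon>(1)[of n] by (intro mult_left_mono) auto
    then show ?thesis using \<epsilon>(1)[of n] unfolding Ipe by (simp add: \<psi>_def algebra_simps)
  qed
  \<comment> \<open>Dropping the control term and dividing by \<epsilon> bounds the terminal error;
    dropping the error term instead shows that the rescaled observation is of order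
    \<epsilon>.\<close>
  have energy1: "(norm (\<psi> n - Pr (\<psi> n)))\<^sup>2 \<le> inner v (\<psi> n) + c2 * Ip n" "Ib n \<le> \<epsilon> n * (c1 * norm (\<psi> n))" for n
  proof -
    have "\<epsilon> n * (norm (\<psi> n - Pr (\<psi> n)))\<^sup>2 \<le> \<epsilon> n * (inner v (\<psi> n) + c2 * Ip n)" using energy[of n] Ib0[of n] by linarith
    then show "(norm (\<psi> n - Pr (\<psi> n)))\<^sup>2 \<le> inner v (\<psi> n) + c2 * Ip n" using \<epsilon>(1)[of n] by simp
    have "0 \<le> \<epsilon> n * (norm (\<psi> n - Pr (\<psi> n)))\<^sup>2" using \<epsilon>(1)[of n] by simp
    moreover have "\<epsilon> n * (inner v (\<psi> n) + c2 * Ip n) \<le> \<epsilon> n * (c1 * norm (\<psi> n))"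
      using rhs[of n] \<epsilon>(1)[of n] by (intro mult_left_mono) auto
    ultimately show "Ib n \<le> \<epsilon> n * (c1 * norm (\<psi> n))" using energy[of n] by linarith
  qed
  obtain c3 where c3: "c3 > 0" "\<And>\<phi> q. admissible (2 * K) \<phi> q \<Longrightarrow>
     c3 * (norm \<phi>)\<^sup>2 \<le> (norm (\<phi> - Pr \<phi>))\<^sup>2 + (LINT s|\<mu>. (norm (B_adj (adjoint_state \<phi> q s)))\<^sup>2)"
    by (rule coercivity[of "2 * K" Pr, OF _ Pr_compact]) (use K_nonneg in simp, rule that)
  \<comment> \<open>Coercivity bounds c3 times the squared norm of \<open>\<psi> n\<close> by the
    sum of the two estimates, each at most c1 times its norm since \<epsilon> n \<le> 1.\<close>
  define C where "C = 2 * c1 / c3"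
  have \<psi>C: "norm (\<psi> n) \<le> C" for n
  proof (cases "\<psi> n = 0")
    case True
    then show ?thesis using c1_nonneg c3(1) by (simp add: C_def)
  next
    case False
    have "\<epsilon> n * (c1 * norm (\<psi> n)) \<le> 1 * (c1 * norm (\<psi> n))" using \<epsilon>(2)[of n] c1_nonneg by (intro mult_right_mono) auto
    then have "c3 * (norm (\<psi> n))\<^sup>2 \<le> 2 * (c1 * norm (\<psi> n))"
      using c3(2)[OF adm[of n], folded Ib_def] energy1[of n] rhs[of n] by linarith
    then have "(c3 * norm (\<psi> n)) * norm (\<psi> n) \<le> (2 * c1) * norm (\<psi> n)" by (simp add: power2_eq_square mult.assoc)
    then have "c3 * norm (\<psi> n) \<le> 2 * c1" using False by simp
    then show ?thesis using c3(1) by (simp add: C_def pos_le_divide_eq mult.commute)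
  qed
  have Iblim: "Ib \<longlonglongrightarrow> 0"
  proof (rule tendsto_sandwich[OF _ _ tendsto_const])
    show "(\<lambda>n. \<epsilon> n * (c1 * C)) \<longlonglongrightarrow> 0" using tendsto_mult[OF \<epsilon>0 tendsto_const, of "c1 * C"] by simp
    have "Ib n \<le> \<epsilon> n * (c1 * C)" for n
      using \<psi>C[of n] \<epsilon>(1)[of n] c1_nonneg by (intro order.trans[OF energy1(2)] mult_left_mono) auto
    then show "\<forall>\<^sub>F n in sequentially. Ib n \<le> \<epsilon> n * (c1 * C)" by simp
    show "\<forall>\<^sub>F n in sequentially. 0 \<le> Ib n" using Ib0 by simp
  qed
  \<comment> \<open>The only weak limit needed is that of <v, \<psi> n>. Taking the projection onto
    the line through v as the compact operator in the vanishing lemma provides it.\<close>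
  obtain Q :: "'x \<Rightarrow>\<^sub>L 'x" where Q: "\<And>x. inner (x - Q x) v = 0" "compact_operator Q"
  proof -
    have "finite_dim_subspace (span {v})" unfolding finite_dim_subspace_def by blast
    then show thesis
    proof (rule finite_dim_subspace_projection)
      fix P :: "'x \<Rightarrow>\<^sub>L 'x"
      assume P: "\<And>x m. m \<in> span {v} \<Longrightarrow> inner (x - P x) m = 0" "compact_operator P"
      have "v \<in> span {v}" by (simp add: span_base)
      from P(1)[OF this] P(2) show thesis by (rule that)
    qed
  qed
  obtain r where r: "strict_mono r"
    "\<And>t. t \<in> {0..T} \<Longrightarrow> (\<lambda>n. adjoint_state (\<psi> (r n)) (q (r n)) t) \<longlonglongrightarrow> 0" "(\<lambda>n. Q (\<psi> (r n))) \<longlonglongrightarrow> 0"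
  proof (rule admissible_vanishing_subseq[of "2 * K" \<psi> q C Q, OF _ adm \<psi>C Q(2) Iblim[unfolded Ib_def[abs_def]]])
    show "0 \<le> 2 * K" using K_nonneg by simp
  qed (rule that)
  have "(\<lambda>n. inner v (Q (\<psi> (r n)))) \<longlonglongrightarrow> inner v 0" by (intro tendsto_inner tendsto_const r(3))
  moreover have "inner v (Q z) = inner v z" for z
    using Q(1)[of z] by (simp add: inner_diff_left inner_commute[of v])
  ultimately have vlim: "(\<lambda>n. inner v (\<psi> (r n))) \<longlonglongrightarrow> 0" by simp
  have "(\<lambda>n. LINT s|\<mu>. norm (adjoint_state (\<psi> (r n)) (q (r n)) s - 0)) \<longlonglongrightarrow> 0"
  proof (rule L1_tendsto_bounded[where v = "\<lambda>_. 0"])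
    fix n
    show "adjoint_state (\<psi> (r n)) (q (r n)) \<in> borel_measurable \<mu>"
    proof -
      obtain C where "q (r n) \<in> borel_measurable \<mu>" "\<And>s. s \<in> {0..T} \<Longrightarrow> norm (q (r n) s) \<le> C"
        using adm[of "r n"] unfolding admissible_def by blast
      then show ?thesis by (rule borel_measurable_adjoint_state)
    qed
    fix s assume s: "s \<in> {0..T}"
    have "norm (adjoint_state (\<psi> (r n)) (q (r n)) s) \<le> 2 * (M * norm (\<psi> (r n))) * exp (4 * (M * (2 * K) + 1) * T)"
      using K_nonneg by (intro norm_adjoint_state_admissible_le[OF adm _ s]) simp
    also have "\<dots> \<le> 2 * (M * C) * exp (4 * (M * (2 * K) + 1) * T)"
      using \<psi>C[of "r n"] M_nonneg by (intro mult_right_mono mult_left_mono) auto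
    finally show "norm (adjoint_state (\<psi> (r n)) (q (r n)) s) \<le> 2 * (M * C) * exp (4 * (M * (2 * K) + 1) * T)" .
  qed (use r(2) in auto)
  then have Iplim: "(\<lambda>n. Ip (r n)) \<longlonglongrightarrow> 0" by (simp add: Ip_def)
  have "(\<lambda>n. inner v (\<psi> (r n)) + c2 * Ip (r n)) \<longlonglongrightarrow> 0 + c2 * 0" by (intro tendsto_add tendsto_mult tendsto_const vlim Iplim)
  then have "(\<lambda>n. inner v (\<psi> (r n)) + c2 * Ip (r n)) \<longlonglongrightarrow> 0" by simp
  moreover have "\<delta>\<^sup>2 > 0" using assms by simp
  ultimately have "eventually (\<lambda>n. inner v (\<psi> (r n)) + c2 * Ip (r n) < \<delta>\<^sup>2) sequentially" by (rule order_tendstoD(2))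
  then obtain n where n: "inner v (\<psi> (r n)) + c2 * Ip (r n) < \<delta>\<^sup>2" unfolding eventually_sequentially by blast
  define m where "m = r n"
  have "(norm (\<psi> m - Pr (\<psi> m)))\<^sup>2 < \<delta>\<^sup>2" using energy1(1)[of m] n unfolding m_def by linarith
  then have "norm (\<psi> m - Pr (\<psi> m)) < \<delta>" by (rule power_less_imp_less_base) (use assms in simp)
  moreover have "\<epsilon> m *\<^sub>R (ph (x m) - Pr (ph (x m))) = \<psi> m - Pr (\<psi> m)"
    by (simp add: \<psi>_def blinfun.scaleR_right scaleR_diff_right)
  then have "norm (st (x m) T - yf) = norm (\<psi> m - Pr (\<psi> m))"
    unfolding fixed_point_mild_solution(3)[OF x[of m] \<epsilon>(1)] by (simp only: norm_minus_cancel)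
  ultimately have "norm (st (x m) T - yf) < \<delta>" by simp
  with fixed_point_mild_solution(1,2,4)[OF x[of m] \<epsilon>(1)] show ?thesis by blast
qed

end

section \<open>Verification of the abstract assumptions\<close>

theorem theorem6:
  fixes A :: "'x::{real_inner,complete_space,second_countable_topology} \<Rightarrow> 'x"
    and D :: "'x set"
    and S :: "real \<Rightarrow> ('x \<Rightarrow>\<^sub>L 'x)"
    and B :: "'u::{real_inner,complete_space,second_countable_topology} \<Rightarrow>\<^sub>L 'x"
    and f g :: "real \<Rightarrow> 'x \<Rightarrow> 'x"
    and f' :: "real \<Rightarrow> 'x \<Rightarrow> ('x \<Rightarrow>\<^sub>L 'x)"
    and m :: "real \<Rightarrow> real"
    and T L :: real
  assumes T_pos: "0 < T"
    and A_dense: "closure D = UNIV"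
    and semigroup: "C0_semigroup S"
    and gen: "generator A D S"
    and S_compact: "\<forall>t>0. compact_operator (S t)"
    and f_cont: "continuous_on ({0..T} \<times> UNIV) (\<lambda>(t, z). f t z)"
    and f_deriv: "\<forall>t\<in>{0..T}. \<forall>z. (f t has_derivative blinfun_apply (f' t z)) (at z)"
    and f'_cont: "continuous_on ({0..T} \<times> UNIV) (\<lambda>(t, z). f' t z)"
    and L_pos: "0 < L"
    and f'_bound: "\<forall>t\<in>{0..T}. \<forall>z. norm (f' t z) \<le> L"
    and g_cont: "continuous_on ({0..T} \<times> UNIV) (\<lambda>(t, z). g t z)"
    and m_cont: "continuous_on {0..T} m"
    and m_nonneg: "\<forall>t\<in>{0..T}. 0 \<le> m t"
    and g_bound: "\<forall>t\<in>{0..T}. \<forall>z. norm (g t z) \<le> m t"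
    and AC: "\<forall>G :: real \<Rightarrow> ('x \<Rightarrow>\<^sub>L 'x). L2_on T G \<longrightarrow>
              (\<forall>y0 yf. \<forall>\<epsilon>>0. \<exists>u y. L2_on T u \<and>
                 mild_solution S B (\<lambda>s z. blinfun_apply (G s) z) T y0 u y \<and> norm (y T - yf) < \<epsilon>)"
  shows "\<forall>M y0 yf. finite_dim_subspace M \<longrightarrow> (\<forall>\<epsilon>>0. \<exists>u y. L2_on T u \<and>
            mild_solution S B (\<lambda>s z. f s z + g s z) T y0 u y \<and>
            norm (y T - yf) < \<epsilon> \<and> orth_proj M (y T) = orth_proj M yf)"
proof (intro allI impI)
  fix V y0 yf and \<epsilon> :: real
  assume V: "finite_dim_subspace (V :: 'x set)" and \<epsilon>: "\<epsilon> > 0"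
  note C0 = semigroup
  obtain N where "compact_semigroup S T N" using C0_compact_semigroup[OF semigroup S_compact T_pos] .
  then interpret compact_semigroup S T N .
  interpret control_system S T N B
    by unfold_locales (use AC in blast)
  obtain P :: "'x \<Rightarrow>\<^sub>L 'x" where P: "\<And>x. P x \<in> V" "\<And>x v. v \<in> V \<Longrightarrow> inner (x - P x) v = 0"
    "compact_operator P" "\<And>x. orth_proj V x = P x"
    by (rule finite_dim_subspace_projection[OF V]) (rule that)
  have "continuous_on {0..T} (\<lambda>t. (\<lambda>(t, z). f t z) (t, 0))"
    by (rule continuous_on_compose2[OF f_cont]) (auto intro!: continuous_intros)
  then have "bounded ((\<lambda>t. f t 0) ` {0..T})"
    by (intro compact_imp_bounded compact_continuous_image) auto
  then obtain Cf where Cf: "\<And>t. t \<in> {0..T} \<Longrightarrow> norm (f t 0) \<le> Cf" unfolding bounded_iff by (metis imageI)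
  have "bounded (m ` {0..T})" by (intro compact_imp_bounded compact_continuous_image m_cont) auto
  then obtain Cm where Cm: "\<And>t. t \<in> {0..T} \<Longrightarrow> norm (m t) \<le> Cm" unfolding bounded_iff by (metis imageI)
  have T0: "0 \<in> {0..T}" using T_pos by simp
  have Cf0: "0 \<le> Cf" and Cm0: "0 \<le> Cm"
    using order.trans[OF norm_ge_zero Cf[OF T0]] order.trans[OF norm_ge_zero Cm[OF T0]] .
  \<comment> \<open>The mean value inequality turns the bound on the derivative into linear growth
    of f, uniformly in time.\<close>
  have lip: "norm (f t z - f t 0) \<le> L * norm z" if t: "t \<in> {0..T}" for t z
  proof -
    have "norm (f t z - f t 0) \<le> L * norm (z - 0)"
    proof (rule differentiable_bound[of UNIV "f t" "\<lambda>z. blinfun_apply (f' t z)"])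
      show "(f t has_derivative blinfun_apply (f' t z)) (at z within UNIV)" for z using f_deriv t by blast
      show "onorm (blinfun_apply (f' t z)) \<le> L" for z using f'_bound t by (simp add: norm_blinfun.rep_eq)
    qed auto
    then show ?thesis by simp
  qed
  \<comment> \<open>The growth constant collects the maximum of f at z = 0, the bound of g and the
    Lipschitz constant, since Cf + L r + Cm \<le> (Cf + Cm + L) (1 + r) for r \<ge> 0.\<close>
  interpret steering_problem S T N B "\<lambda>t z. f t z + g t z" "Cf + Cm + L" y0 yf P
  proof
    show "continuous_on ({0..T} \<times> UNIV) (\<lambda>(t, z). f t z + g t z)"
      using continuous_on_add[OF f_cont g_cont] by (simp add: case_prod_beta')
    show "0 \<le> Cf + Cm + L" using Cf0 Cm0 L_pos by simp
    show "continuous_on {0..T} (\<lambda>t. S t y0)" by (rule C0_semigroup_strongly_continuous[OF C0])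
    show "compact_operator P" by (rule P)
    show "inner (x - P x) (P z) = 0" for x z by (rule P(2)[OF P(1)])
    fix t z assume t: "t \<in> {0..T}"
    have "norm (f t z) \<le> Cf + L * norm z" using norm_triangle_sub[of "f t z" "f t 0"] lip[OF t, of z] Cf[OF t] by linarith
    moreover have "norm (g t z) \<le> Cm" using g_bound t Cm[OF t] by (smt (verit) real_norm_def)
    ultimately have "norm (f t z + g t z) \<le> Cf + L * norm z + Cm" using norm_triangle_ineq[of "f t z" "g t z"] by linarith
    also have "\<dots> \<le> (Cf + Cm + L) * (1 + norm z)"
    proof -
      have "0 \<le> (Cf + Cm) * norm z" using Cf0 Cm0 by simp
      then show ?thesis using L_pos by (simp add: algebra_simps)
    qed
    finally show "norm (f t z + g t z) \<le> (Cf + Cm + L) * (1 + norm z)" .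
  qed
  show "\<exists>u y. L2_on T u \<and> mild_solution S B (\<lambda>s z. f s z + g s z) T y0 u y \<and>
      norm (y T - yf) < \<epsilon> \<and> orth_proj V (y T) = orth_proj V yf"
    unfolding P(4) by (rule finite_approximate_steering[OF \<epsilon>])
qed

end
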